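(* Let $g\in\mathcal G$, let $k\ge 1$ be an integer, and let $Z\subset\Lambda_1(g)$ be a nonempty compact set. The following are equivalent: (a) $Z$ is a recurrent $g$-invariant $k$-fold semi-monotone (kfsm) set for $g$. (b) The symbolic coding of $Z$ is constructable by the HM process, that is, there is an allowable pair $(\omega,\vec\nu)$ (for $k$) with $\iota_1(Z)=C_k(\omega,\vec\nu)$. (c) $Z$ is a recurrent set of an interpolated semi-monotone map in the $k$-fold cover, that is, there are $\vec c\in[L_g,U_g]^k$ and a compact set $Z^*\subset P(H_{k\vec c})\subset S_k$ such that $\pi_k(Z^* )=Z$, $H_{k\vec c}(Z^* )\subset Z^*$, and every point of $Z^*$ is recurrent under $H_{k\vec c}$.
   Context: Covers: $S^1=\mathbb R/\mathbb Z$, $T(x)=x+1$ on $\mathbb R$, $S_k=\mathbb R/k\mathbb Z$ with projections $p_k:\mathbb R\to S_k$, $\pi_k:S_k\to S^1$, $\pi:\mathbb R\to S^1$. Class $\mathcal G$: $g:S^1\to S^1$ is in $\mathcal G$ if it has a lift $\tilde g:\mathbb R\to\mathbb R$ (fixed as the preferred lift) that is continuous, satisfies $\tilde g(x+1)=\tilde g(x)+1$, is piecewise $C^2$ (on $[0,1]$ it is $C^2$ off finitely many points, at which one-sided derivatives exist), and for which there are $0=x_{\min}<x_{\max}<1$ with $\tilde g'>1$ on $[x_{\min},x_{\max}]$, $\tilde g$ monotone decreasing on $[x_{\max},x_{\min}+1]$, and $x_{\min}\le\tilde g(x_{\min})<\tilde g(x_{\max})\le x_{\max}+1$. $\tilde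 g_k:S_k\to S_k$ is the map induced by $\tilde g$. $\Lambda_\infty(g)$ is the set of $x\in\mathbb R$ whose forward $\tilde g$-orbit stays in $\bigcup_{j\in\mathbb Z}[j,j+x_{\max}]$; $\Lambda_k(g)=p_k(\Lambda_\infty(g))$. Invariant means forward invariant ($f(Z)\subset Z$). A point $x$ is recurrent under $f$ if $f^{n_i}(x)\to x$ for some $n_i\to\infty$; an invariant set is recurrent if all its points are. A $\tilde g$-invariant $Z'\subset\mathbb R$ is kfsm if $T^k(Z')=Z'$ and $z_1<z_2$ in $Z'$ implies $\tilde g(z_1)\le\tilde g(z_2)$. A $g$-invariant $Z\subset S^1$ is kfsm if there is a $\tilde g$-invariant kfsm $Z'\subset\mathbb R$ with $\pi(Z')=Z$. Coding: let $z_{\max},z_{\min}\in(0,x_{\max})$ with $\tilde g(z_{\max})=x_{\max}$, $\tilde g(z_{\min})=1$; $I_{2j}=[j,z_{\max}+j]$, $I_{2j+1}=[z_{\min}+j,x_{\max}+j]$ for $j\in\mathbb Z$. The itinerary map $\iota_1:\Lambda_1(g)\to\{0,1\}^{\mathbb N}$ is $\iota_1(x)_n=i$ if $g^n(x)\in\pi(I_i)$, $i\in\{0,1\}$, $n\geq 0$. HM construction: $(\omega,\vec\nu)$ is allowable if $\omega\in[0,1]$, $\vec\nu=(\nu_1,\dots,\nu_k)$, $\nu_i\ge0$, $\sum\nu_i=k(1-\omega)$. Put $\ell_{2j}=\sum_{i=1}^{j}\nu_i+j\omega$, $\ell_{2j+1}=\sum_{i=1}^{j+1}\nu_i+j\omega$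 ($0\le j\le k-1$), $\ell_{2k}=k$, $X_i=[\ell_i,\ell_{i+1}]$ for $0\le i\le 2k-1$, viewed in $S_k=[0,k]/(0\sim k)$. Let $R_\omega(x)=x+\omega \bmod k$ on $S_k$. Let $G$ be the set of $x\in S_k$ whose forward $R_\omega$-orbit avoids all $\ell_i$, and for $x\in G$ let $\zeta(x)\in\{0,\dots,2k-1\}^{\mathbb N}$ be given by $\zeta(x)_n=i$ if $R_\omega^n(x)\in \mathrm{Int}\,X_i$. $B_k(\omega,\vec\nu)$ is the closure of $\zeta(G)$, and $C_k(\omega,\vec\nu)=\hat\pi_k(B_k(\omega,\vec\nu))$, where $\hat\pi_k:\{0,\dots,2k-1\}^{\mathbb N}\to\{0,1\}^{\mathbb N}$ reduces every symbol mod 2. Interpolated maps: for $n\in\mathbb Z$ and $y\in[\tilde g(x_{\min}+n),\tilde g(x_{\max}+n)]$ let $b_n(y)$ be the unique $x\in[x_{\min}+n,x_{\max}+n]$ with $\tilde g(x)=y$. $L_g=\tilde g(\min(\Lambda_\infty(g)\cap I_0))$, $U_g=\tilde g(\max(\Lambda_\infty(g)\cap I_{-1}))$. For $\vec c\in[L_g,U_g]^k$ put $\tilde c_j=c_j+j-1$; $\tilde H_{k\vec c}:\mathbb R\to\mathbb R$ equals $\tilde c_j$ on the flat spot $[b_{j-2}(\tilde c_j),b_{j-1}(\tilde c_j)]$ ($1\le j\le k$), satisfies $\tilde H_{k\vec c}(x+k)=\tilde H_{k\vec c}(x)+k$, and equals $\tilde g$ off the translates by $k\mathbb Z$ of these flat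 spots. $H_{k\vec c}:S_k\to S_k$ is the induced map, and $P(H_{k\vec c})$ is the complement in $S_k$ of the interiors of its flat spots.
   Formalization: The formal theorem additionally assumes L_g ≤ U_g, so that [L_g,U_g] is nonempty; membership of g in the class G does not imply this, and without it (c) is impossible while a periodic orbit can satisfy (a) and (b). *)

theory Defs
  imports "HOL-Analysis.Analysis"
begin

section \<open>The circles \<open>S\<^sub>k = \<real>/k\<int>\<close>\<close>

text \<open>Points of \<open>S\<^sub>k\<close> are the cosets \<open>x + k\<int>\<close>; \<open>S\<^sup>1\<close> is \<open>circ 1\<close> and \<open>\<pi>\<close> is \<open>cproj 1\<close>.\<close>

definition circ_rel :: "nat \<Rightarrow> (real \<times> real) set" where
  "circ_rel k = {(x, y). \<exists>m::int. y = x + of_int m * real k}"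

definition circ :: "nat \<Rightarrow> real set set" where
  "circ k = UNIV // circ_rel k"

definition cproj :: "nat \<Rightarrow> real \<Rightarrow> real set" where
  "cproj k x = circ_rel k `` {x}"

text \<open>The quotient topology.\<close>

definition circ_top :: "nat \<Rightarrow> real set topology" where
  "circ_top k = topology (\<lambda>U. U \<subseteq> circ k \<and> open (cproj k -` U))"

lemma openin_circ_top: "openin (circ_top k) U \<longleftrightarrow> U \<subseteq> circ k \<and> open (cproj k -` U)"
proof -
  have "istopology (\<lambda>U. U \<subseteq> circ k \<and> open (cproj k -` U))"
    unfolding istopology_def
  proof (intro conjI allI impI)
    fix S T
    assume S: "S \<subseteq> circ k \<and> open (cproj k -` S)" and T: "T \<subseteq> circ k \<and> open (cproj k -` T)"
    show "S \<inter> T \<subseteq> circ k" using S by blast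
    show "open (cproj k -` (S \<inter> T))" using S T by (simp add: vimage_Int open_Int)
  next
    fix K
    assume K: "\<forall>U\<in>K. U \<subseteq> circ k \<and> open (cproj k -` U)"
    show "\<Union>K \<subseteq> circ k" using K by blast
    show "open (cproj k -` \<Union>K)" unfolding vimage_Union using K by (intro open_UN) blast
  qed
  then show ?thesis
    unfolding circ_top_def by (simp only: topology_inverse')
qed

lemma quotient_map_cproj: "quotient_map euclidean (circ_top k) (cproj k)"
proof -
  have img: "range (cproj k) = circ k"
    unfolding circ_def cproj_def quotient_def by (rule UNION_singleton_eq_range[symmetric])
  have "cproj k x \<in> circ k" for x
    unfolding img[symmetric] by (rule rangeI)
  then have "cproj k -` circ k = UNIV"
    by (intro equalityI subset_UNIV subsetI vimageI2)
  then have op: "openin (circ_top k) (circ k)"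
    unfolding openin_circ_top by (intro conjI subset_refl) (erule ssubst, rule open_UNIV)
  have top: "topspace (circ_top k) = circ k"
  proof (rule subset_antisym)
    show "topspace (circ_top k) \<subseteq> circ k"
      by (rule conjunct1[OF openin_topspace[of "circ_top k", unfolded openin_circ_top]])
    show "circ k \<subseteq> topspace (circ_top k)"
      by (rule openin_subset[OF op])
  qed
  show ?thesis
    unfolding quotient_map_def
  proof (intro conjI allI impI)
    show "cproj k ` topspace euclidean = topspace (circ_top k)"
      unfolding top topspace_euclidean by (rule img)
    fix U
    assume U: "U \<subseteq> topspace (circ_top k)"
    have "{x \<in> topspace euclidean. cproj k x \<in> U} = cproj k -` U"
      by (rule set_eqI) (simp only: mem_Collect_eq vimage_eq topspace_euclidean UNIV_I simp_thms)
    then show "openin euclidean {x \<in> topspace euclidean. cproj k x \<in> U} \<longleftrightarrow> openin (circ_top k) U"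
      using U top by (simp only: openin_circ_top open_openin simp_thms)
  qed
qed

definition cover_proj :: "real set \<Rightarrow> real set" where  \<comment> \<open>\<open>\<pi>\<^sub>k\<close>, for every \<open>k\<close>\<close>
  "cover_proj A = (\<Union>x\<in>A. cproj 1 x)"

text \<open>The map of \<open>S\<^sub>k\<close> induced by \<open>F\<close>; used only for \<open>F\<close> with \<open>F (x + k) = F x + k\<close>, so that
  all members of the union coincide.\<close>

definition induced :: "nat \<Rightarrow> (real \<Rightarrow> real) \<Rightarrow> real set \<Rightarrow> real set" where
  "induced k F A = (\<Union>x\<in>A. cproj k (F x))"

section \<open>Recurrence\<close>

definition recurrent_pt :: "'a topology \<Rightarrow> ('a \<Rightarrow> 'a) \<Rightarrow> 'a \<Rightarrow> bool" where
  "recurrent_pt X f x \<longleftrightarrow>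
    (\<exists>n :: nat \<Rightarrow> nat. filterlim n at_top sequentially \<and>
       limitin X (\<lambda>i. (f ^^ n i) x) x sequentially)"

definition invariant_set :: "('a \<Rightarrow> 'a) \<Rightarrow> 'a set \<Rightarrow> bool" where
  "invariant_set f Z \<longleftrightarrow> f ` Z \<subseteq> Z"

definition recurrent_set :: "'a topology \<Rightarrow> ('a \<Rightarrow> 'a) \<Rightarrow> 'a set \<Rightarrow> bool" where
  "recurrent_set X f Z \<longleftrightarrow> invariant_set f Z \<and> (\<forall>x\<in>Z. recurrent_pt X f x)"

section \<open>The class \<open>\<G>\<close>\<close>

text \<open>Throughout, \<open>gt\<close> is the preferred lift of \<open>g\<close>, \<open>xm\<close> is \<open>x\<^sub>m\<^sub>a\<^sub>x\<close>, and \<open>x\<^sub>m\<^sub>i\<^sub>n = 0\<close>.\<close>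

definition piecewise_C2 :: "(real \<Rightarrow> real) \<Rightarrow> bool" where
  "piecewise_C2 f \<longleftrightarrow>
    (\<exists>F. finite F \<and> F \<subseteq> {0..1} \<and>
      (\<forall>x\<in>{0..1} - F. f differentiable (at x) \<and> deriv f differentiable (at x) \<and>
          isCont (deriv (deriv f)) x) \<and>
      (\<forall>x\<in>F. (\<exists>D. (f has_real_derivative D) (at_left x)) \<and>
              (\<exists>D. (f has_real_derivative D) (at_right x))))"

text \<open>The condition \<open>gt' > 1\<close> on \<open>[0, xm]\<close> is imposed on the one-sided derivatives taken from
  within \<open>[0, xm]\<close>: \<open>gt\<close> has corners at \<open>0\<close> and \<open>xm\<close> and possibly at other points.\<close>

definition in_class_G :: "(real set \<Rightarrow> real set) \<Rightarrow> (real \<Rightarrow> real) \<Rightarrow> real \<Rightarrow> bool" where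
  "in_class_G g gt xm \<longleftrightarrow>
    (\<forall>x. g (cproj 1 x) = cproj 1 (gt x)) \<and>
    continuous_on UNIV gt \<and>
    (\<forall>x. gt (x + 1) = gt x + 1) \<and>
    piecewise_C2 gt \<and>
    0 < xm \<and> xm < 1 \<and>
    (\<forall>x\<in>{0..<xm}. \<exists>D>1. (gt has_real_derivative D) (at_right x)) \<and>
    (\<forall>x\<in>{0<..xm}. \<exists>D>1. (gt has_real_derivative D) (at_left x)) \<and>
    antimono_on {xm..1} gt \<and>
    0 \<le> gt 0 \<and> gt 0 < gt xm \<and> gt xm \<le> xm + 1"

definition Lambda_inf :: "(real \<Rightarrow> real) \<Rightarrow> real \<Rightarrow> real set" where
  "Lambda_inf gt xm = {x. \<forall>n. (gt ^^ n) x \<in> (\<Union>j::int. {of_int j..of_int j + xm})}"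

definition Lambda :: "nat \<Rightarrow> (real \<Rightarrow> real) \<Rightarrow> real \<Rightarrow> real set set" where
  "Lambda k gt xm = cproj k ` Lambda_inf gt xm"

section \<open>\<open>k\<close>-fold semi-monotone sets\<close>

definition kfsm_lift :: "nat \<Rightarrow> (real \<Rightarrow> real) \<Rightarrow> real set \<Rightarrow> bool" where
  "kfsm_lift k gt Z' \<longleftrightarrow>
    invariant_set gt Z' \<and>
    (\<lambda>x. x + real k) ` Z' = Z' \<and>
    (\<forall>z1\<in>Z'. \<forall>z2\<in>Z'. z1 < z2 \<longrightarrow> gt z1 \<le> gt z2)"

definition kfsm :: "nat \<Rightarrow> (real set \<Rightarrow> real set) \<Rightarrow> (real \<Rightarrow> real) \<Rightarrow> real set set \<Rightarrow> bool" where
  "kfsm k g gt Z \<longleftrightarrow> invariant_set g Z \<and> (\<exists>Z'. kfsm_lift k gt Z' \<and> cproj 1 ` Z' = Z)"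

section \<open>Coding\<close>

text \<open>The two-sided family of address intervals \<open>I\<^sub>i\<close>; the arguments are
  \<open>x\<^sub>m\<^sub>a\<^sub>x\<close>, \<open>z\<^sub>m\<^sub>a\<^sub>x\<close>, \<open>z\<^sub>m\<^sub>i\<^sub>n\<close>.\<close>

definition address :: "real \<Rightarrow> real \<Rightarrow> real \<Rightarrow> int \<Rightarrow> real set" where
  "address xm zmax zmin i =
    (let j = of_int (i div 2)
     in if even i then {j..zmax + j} else {zmin + j..xm + j})"

definition itinerary ::
    "(real set \<Rightarrow> real set) \<Rightarrow> real \<Rightarrow> real \<Rightarrow> real \<Rightarrow> real set \<Rightarrow> nat \<Rightarrow> nat" where
  "itinerary g xm zmax zmin x n =
    (THE i. i \<in> {0, 1} \<and> (g ^^ n) x \<in> cproj 1 ` address xm zmax zmin (int i))"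

section \<open>The HM construction\<close>

text \<open>A vector \<open>(v\<^sub>1, \<dots>, v\<^sub>k)\<close> is a function on \<open>nat\<close> of which only the values at \<open>1, \<dots>, k\<close>
  are used.\<close>

definition allowable :: "nat \<Rightarrow> real \<Rightarrow> (nat \<Rightarrow> real) \<Rightarrow> bool" where
  "allowable k \<omega> \<nu> \<longleftrightarrow>
    0 \<le> \<omega> \<and> \<omega> \<le> 1 \<and> (\<forall>i\<in>{1..k}. 0 \<le> \<nu> i) \<and> (\<Sum>i=1..k. \<nu> i) = real k * (1 - \<omega>)"

definition hm_ell :: "nat \<Rightarrow> real \<Rightarrow> (nat \<Rightarrow> real) \<Rightarrow> nat \<Rightarrow> real" where
  "hm_ell k \<omega> \<nu> i =
    (let j = i div 2
     in if i = 2 * k then real k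
        else if even i then (\<Sum>r=1..j. \<nu> r) + real j * \<omega>
        else (\<Sum>r=1..j + 1. \<nu> r) + real j * \<omega>)"

definition hm_X :: "nat \<Rightarrow> real \<Rightarrow> (nat \<Rightarrow> real) \<Rightarrow> nat \<Rightarrow> real set set" where
  "hm_X k \<omega> \<nu> i = cproj k ` {hm_ell k \<omega> \<nu> i..hm_ell k \<omega> \<nu> (i + 1)}"

definition rotation :: "nat \<Rightarrow> real \<Rightarrow> real set \<Rightarrow> real set" where
  "rotation k \<omega> = induced k (\<lambda>x. x + \<omega>)"

definition hm_G :: "nat \<Rightarrow> real \<Rightarrow> (nat \<Rightarrow> real) \<Rightarrow> real set set" where
  "hm_G k \<omega> \<nu> =
    {x \<in> circ k. \<forall>n. \<forall>i\<le>2 * k. (rotation k \<omega> ^^ n) x \<noteq> cproj k (hm_ell k \<omega> \<nu> i)}"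

definition hm_zeta :: "nat \<Rightarrow> real \<Rightarrow> (nat \<Rightarrow> real) \<Rightarrow> real set \<Rightarrow> nat \<Rightarrow> nat" where
  "hm_zeta k \<omega> \<nu> x n =
    (THE i. i < 2 * k \<and>
       (rotation k \<omega> ^^ n) x \<in> circ_top k interior_of (hm_X k \<omega> \<nu> i))"

text \<open>The closure is taken in the product topology on \<open>nat \<Rightarrow> nat\<close> (\<open>nat\<close> is discrete), in which
  the space of sequences with symbols below \<open>2k\<close> is a closed subspace.\<close>

definition hm_B :: "nat \<Rightarrow> real \<Rightarrow> (nat \<Rightarrow> real) \<Rightarrow> (nat \<Rightarrow> nat) set" where
  "hm_B k \<omega> \<nu> = closure (hm_zeta k \<omega> \<nu> ` hm_G k \<omega> \<nu>)"

definition hm_C :: "nat \<Rightarrow> real \<Rightarrow> (nat \<Rightarrow> real) \<Rightarrow> (nat \<Rightarrow> nat) set" where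
  "hm_C k \<omega> \<nu> = (\<lambda>s n. s n mod 2) ` hm_B k \<omega> \<nu>"

section \<open>Interpolated semi-monotone maps\<close>

definition branch_inv :: "(real \<Rightarrow> real) \<Rightarrow> real \<Rightarrow> int \<Rightarrow> real \<Rightarrow> real" where
  "branch_inv gt xm n y = (THE x. x \<in> {of_int n..xm + of_int n} \<and> gt x = y)"

text \<open>Membership of \<open>g\<close> in \<open>\<G>\<close> does not imply \<open>L\<^sub>g \<le> U\<^sub>g\<close>: the inequality fails when
  \<open>\<Lambda>\<^sub>\<infinity>(g)\<close> is the lift of a single periodic orbit of period two.\<close>

definition L_val :: "(real \<Rightarrow> real) \<Rightarrow> real \<Rightarrow> real \<Rightarrow> real \<Rightarrow> real" where
  "L_val gt xm zmax zmin =
    gt (LEAST x. x \<in> Lambda_inf gt xm \<inter> address xm zmax zmin 0)"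

definition U_val :: "(real \<Rightarrow> real) \<Rightarrow> real \<Rightarrow> real \<Rightarrow> real \<Rightarrow> real" where
  "U_val gt xm zmax zmin =
    gt (GREATEST x. x \<in> Lambda_inf gt xm \<inter> address xm zmax zmin (- 1))"

definition c_shift :: "(nat \<Rightarrow> real) \<Rightarrow> nat \<Rightarrow> real" where
  "c_shift c j = c j + real j - 1"

definition flat_spot :: "(real \<Rightarrow> real) \<Rightarrow> real \<Rightarrow> (nat \<Rightarrow> real) \<Rightarrow> nat \<Rightarrow> real set" where
  "flat_spot gt xm c j =
    {branch_inv gt xm (int j - 2) (c_shift c j)..branch_inv gt xm (int j - 1) (c_shift c j)}"

text \<open>For \<open>c\<^sub>j\<close> in \<open>[L\<^sub>g, U\<^sub>g]\<close> the translates of the flat spots by \<open>k\<int>\<close> are pairwise disjoint,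
  so a point lies in at most one of them.\<close>

definition H_lift :: "nat \<Rightarrow> (real \<Rightarrow> real) \<Rightarrow> real \<Rightarrow> (nat \<Rightarrow> real) \<Rightarrow> real \<Rightarrow> real" where
  "H_lift k gt xm c x =
    (if \<exists>m::int. \<exists>j\<in>{1..k}. x - of_int m * real k \<in> flat_spot gt xm c j
     then THE y. \<exists>m::int. \<exists>j\<in>{1..k}. x - of_int m * real k \<in> flat_spot gt xm c j \<and>
                   y = c_shift c j + of_int m * real k
     else gt x)"

definition H_map :: "nat \<Rightarrow> (real \<Rightarrow> real) \<Rightarrow> real \<Rightarrow> (nat \<Rightarrow> real) \<Rightarrow> real set \<Rightarrow> real set" where
  "H_map k gt xm c = induced k (H_lift k gt xm c)"

definition P_set :: "nat \<Rightarrow> (real \<Rightarrow> real) \<Rightarrow> real \<Rightarrow> (nat \<Rightarrow> real) \<Rightarrow> real set set" where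
  "P_set k gt xm c =
    circ k - (\<Union>j\<in>{1..k}. circ_top k interior_of (cproj k ` flat_spot gt xm c j))"

section \<open>Constructability and recurrence in the k-fold cover\<close>

definition hm_constructable ::
    "nat \<Rightarrow> (real set \<Rightarrow> real set) \<Rightarrow> real \<Rightarrow> real \<Rightarrow> real \<Rightarrow> real set set \<Rightarrow> bool" where
  "hm_constructable k g xm zmax zmin Z \<longleftrightarrow>
    (\<exists>\<omega> \<nu>. allowable k \<omega> \<nu> \<and> itinerary g xm zmax zmin ` Z = hm_C k \<omega> \<nu>)"

definition interpolated_recurrent ::
    "nat \<Rightarrow> (real \<Rightarrow> real) \<Rightarrow> real \<Rightarrow> real \<Rightarrow> real \<Rightarrow> real set set \<Rightarrow> bool" where
  "interpolated_recurrent k gt xm zmax zmin Z \<longleftrightarrow>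
    (\<exists>c Zs.
      (\<forall>j\<in>{1..k}. c j \<in> {L_val gt xm zmax zmin..U_val gt xm zmax zmin}) \<and>
      compactin (circ_top k) Zs \<and> Zs \<subseteq> P_set k gt xm c \<and>
      cover_proj ` Zs = Z \<and>
      recurrent_set (circ_top k) (H_map k gt xm c) Zs)"

end

theory Submission
  imports Defs
begin

text \<open>
  Everything is transported to the line. Since \<open>gt\<close> strictly expands distances on each branch
  \<open>[j, j + xm]\<close>, a point of \<open>\<Lambda>\<^sub>\<infinity>\<close> is determined by its lifted itinerary, and the order of
  itineraries is the order of points. The HM coding consists of the limits from the right
  and from the left of the itineraries of a rotation; such codes are totally ordered, the shift
  preserves their order, and they are recurrent, so the points of \<open>\<Lambda>\<^sub>\<infinity>\<close> they code form a kfsm set.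

  Conversely, a closed recurrent kfsm lift carries a monotone map to the line that conjugates
  \<open>gt\<close> to a translation. If \<open>\<omega> / k\<close> is rational, recurrence forces all points to be periodic,
  there are finitely many modulo \<open>k\<close>, and the map counts points; otherwise it is
  \<open>z \<mapsto> limsup (gt\<^sup>n z - n \<omega>)\<close>. The lengths \<open>\<nu>\<^sub>i\<close> are read off from its values at the gaps between
  the address intervals. Finally, \<open>gt\<close> is monotone on a kfsm lift exactly when the heights of the
  flat spots of the interpolated map can be chosen between its values on the two sides of every gap.
\<close>

section \<open>Topology of the circles\<close>

text \<open>The circle coding keeps only parities, whereas the order lives on the line. The bridge
  is the transition law \<open>s (Suc n) div 2 = (s n + 1) div 2\<close>. Lifted itineraries obey it
  because a branch is cut where its image crosses an integer, and integer codes of a rotation obey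
  it because every odd cell has length exactly \<open>\<omega>\<close>. With this law the parities
  and the initial integer part restore the whole integer sequence, so the reduction modulo 2 loses
  only a translation. Two obstacles shape the converse. Recurrence of \<open>Z\<close> is given
  modulo 1, while the coding needs returns modulo \<open>k\<close>, so recurrence has to be lifted
  to the cover first. Moreover \<open>Z\<close> need not be the closure of one orbit: in the
  rational case it may consist of several periodic orbits, and all points of a period are counted
  together. In the irrational case several points may share one value of the map to the line;
  monotonicity and density of its values then take the place of continuity and injectivity.\<close>

lemma cproj_eq_iff: "cproj k x = cproj k y \<longleftrightarrow> (\<exists>m::int. y = x + of_int m * real k)"
proof
  assume "cproj k x = cproj k y"
  moreover have "y \<in> cproj k y"
    by (auto simp: cproj_def circ_rel_def intro: exI[of _ 0])
  ultimately have "y \<in> cproj k x" by simp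
  then show "\<exists>m::int. y = x + of_int m * real k"
    by (auto simp: cproj_def circ_rel_def)
next
  assume "\<exists>m::int. y = x + of_int m * real k"
  then obtain m :: int where y: "y = x + of_int m * real k" by blast
  have "(\<exists>i::int. z = x + of_int i * real k) \<longleftrightarrow> (\<exists>i::int. z = y + of_int i * real k)" for z
  proof
    assume "\<exists>i::int. z = x + of_int i * real k"
    then obtain i :: int where "z = x + of_int i * real k" by blast
    then have "z = y + of_int (i - m) * real k" by (simp add: y algebra_simps)
    then show "\<exists>i::int. z = y + of_int i * real k" by blast
  next
    assume "\<exists>i::int. z = y + of_int i * real k"
    then obtain i :: int where "z = y + of_int i * real k" by blast
    then have "z = x + of_int (i + m) * real k" by (simp add: y algebra_simps)
    then show "\<exists>i::int. z = x + of_int i * real k" by blast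
  qed
  then show "cproj k x = cproj k y"
    by (auto simp: cproj_def circ_rel_def)
qed

lemma mem_cproj_iff: "y \<in> cproj k x \<longleftrightarrow> cproj k y = cproj k x"
proof -
  have "y \<in> cproj k x \<longleftrightarrow> cproj k x = cproj k y"
    unfolding cproj_eq_iff by (simp add: cproj_def circ_rel_def)
  then show ?thesis by auto
qed

lemma cproj_shift [simp]: "cproj k (x + of_int m * real k) = cproj k x"
  using cproj_eq_iff by metis

lemma range_cproj: "range (cproj k) = circ k"
  by (auto simp: circ_def cproj_def quotient_def)

lemma cproj_in_circ [simp]: "cproj k x \<in> circ k"
  using range_cproj by blast

lemma topspace_circ [simp]: "topspace (circ_top k) = circ k"
  using quotient_map_cproj[of k] unfolding quotient_map_def by (simp add: range_cproj)

lemma cproj_representative: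
  assumes "A \<in> circ k" "k \<ge> 1"
  obtains x where "0 \<le> x" "x < real k" "A = cproj k x"
proof -
  obtain y where y: "A = cproj k y" using assms(1) range_cproj by blast
  define x where "x = y + of_int (- \<lfloor>y / real k\<rfloor>) * real k"
  have k0: "real k > 0" using assms(2) by simp
  have "of_int \<lfloor>y / real k\<rfloor> \<le> y / real k" "y / real k < of_int \<lfloor>y / real k\<rfloor> + 1"
    by linarith+
  then have "of_int \<lfloor>y / real k\<rfloor> * real k \<le> y" "y < (of_int \<lfloor>y / real k\<rfloor> + 1) * real k"
    using k0 by (simp_all only: pos_le_divide_eq pos_divide_less_eq)
  then have "0 \<le> x" "x < real k"
    by (auto simp: x_def algebra_simps)
  moreover have "A = cproj k x" unfolding x_def y by (rule cproj_shift[symmetric])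
  ultimately show ?thesis using that by blast
qed

text \<open>The saturation of \<open>U\<close> is the union of its translates by multiples of
  \<open>k\<close>, so the projection is an open map.\<close>

lemma openin_cproj_image:
  assumes "open U"
  shows "openin (circ_top k) (cproj k ` U)"
proof -
  have "cproj k -` (cproj k ` U) = (\<Union>m::int. (\<lambda>x. of_int m * real k + x) ` U)"
    (is "?L = ?R")
  proof (intro equalityI subsetI)
    fix y assume "y \<in> ?L"
    then obtain x where x: "x \<in> U" "cproj k x = cproj k y" by auto
    then obtain m :: int where "y = x + of_int m * real k" unfolding cproj_eq_iff by blast
    then have "y \<in> (\<lambda>x. of_int m * real k + x) ` U"
      using x(1) by (intro image_eqI[of _ _ x]) auto
    then show "y \<in> ?R" by blast
  next
    fix y assume "y \<in> ?R"
    then obtain m :: int and x where "x \<in> U" "y = x + of_int m * real k"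
      by (auto simp: add.commute)
    then show "y \<in> ?L" by simp
  qed
  moreover have "open ?R" by (intro open_UN ballI open_translation assms)
  ultimately show ?thesis by (auto simp: openin_circ_top)
qed

lemma continuous_map_cproj: "continuous_map euclidean (circ_top k) (cproj k)"
  by (rule quotient_imp_continuous_map[OF quotient_map_cproj])

text \<open>Because the projection is open and continuous, interiors in the quotient can be tested
  on the line. This serves both the cells of the HM construction and the flat spots.\<close>

lemma mem_interior_of_cproj_image:
  "cproj k x \<in> circ_top k interior_of (cproj k ` S) \<longleftrightarrow>
    (\<exists>e>0. \<forall>y. \<bar>y - x\<bar> < e \<longrightarrow> cproj k y \<in> cproj k ` S)"
proof
  assume "cproj k x \<in> circ_top k interior_of (cproj k ` S)"
  then obtain U where U: "openin (circ_top k) U" "cproj k x \<in> U" "U \<subseteq> cproj k ` S"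
    by (auto simp: interior_of_def)
  then have "open (cproj k -` U)" "x \<in> cproj k -` U" by (auto simp: openin_circ_top)
  then obtain e where "e > 0" "\<forall>y. dist y x < e \<longrightarrow> y \<in> cproj k -` U"
    unfolding open_dist by blast
  then show "\<exists>e>0. \<forall>y. \<bar>y - x\<bar> < e \<longrightarrow> cproj k y \<in> cproj k ` S"
    using U(3) by (intro exI[of _ e]) (auto simp: dist_real_def)
next
  assume "\<exists>e>0. \<forall>y. \<bar>y - x\<bar> < e \<longrightarrow> cproj k y \<in> cproj k ` S"
  then obtain e where e: "e > 0" "\<And>y. \<bar>y - x\<bar> < e \<Longrightarrow> cproj k y \<in> cproj k ` S" by blast
  have "openin (circ_top k) (cproj k ` ball x e)" by (rule openin_cproj_image) simp
  moreover have "cproj k ` ball x e \<subseteq> cproj k ` S"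
    using e(2) by (auto simp: dist_real_def abs_minus_commute)
  ultimately show "cproj k x \<in> circ_top k interior_of (cproj k ` S)"
    using e(1) unfolding interior_of_def by (auto intro!: exI[of _ "cproj k ` ball x e"])
qed

lemma Hausdorff_circ:
  assumes k: "k \<ge> 1"
  shows "Hausdorff_space (circ_top k)"
  unfolding Hausdorff_space_def
proof (intro allI impI)
  fix A B assume AB: "A \<in> topspace (circ_top k) \<and> B \<in> topspace (circ_top k) \<and> A \<noteq> B"
  then obtain x y where x: "A = cproj k x" and y: "B = cproj k y"
    using range_cproj by (metis topspace_circ imageE)
  define t where "t = (y - x) / real k"
  have nt: "t \<noteq> of_int m" for m :: int
  proof
    assume "t = of_int m"
    then have "y = x + of_int m * real k" using k by (simp add: t_def field_simps)
    then show False using AB x y by simp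
  qed
  \<comment> \<open>Distance from \<open>t\<close> to the nearest integer. Multiplying by
    \<open>k\<close>, which is at least 1, does not shrink it, so \<open>d\<close> also bounds the
    distance from \<open>y - x\<close> to the multiples of \<open>k\<close>.\<close>
  define d where "d = min (t - of_int \<lfloor>t\<rfloor>) (of_int \<lfloor>t\<rfloor> + 1 - t)"
  have d: "d > 0" using nt[of "\<lfloor>t\<rfloor>"] unfolding d_def by linarith
  have far: "\<bar>y - x - of_int m * real k\<bar> \<ge> d" for m :: int
  proof -
    have "m \<le> \<lfloor>t\<rfloor> \<or> m \<ge> \<lfloor>t\<rfloor> + 1" by linarith
    then have "real_of_int m \<le> of_int \<lfloor>t\<rfloor> \<or> real_of_int m \<ge> of_int \<lfloor>t\<rfloor> + 1" by linarith
    then have "\<bar>t - of_int m\<bar> \<ge> d" unfolding d_def by linarith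
    moreover have "\<bar>t - of_int m\<bar> * 1 \<le> \<bar>t - of_int m\<bar> * real k" using k by (intro mult_left_mono) auto
    moreover have "y - x - of_int m * real k = (t - of_int m) * real k"
      using k by (simp add: t_def field_simps)
    ultimately show ?thesis by (simp add: abs_mult)
  qed
  have "disjnt (cproj k ` ball x (d / 2)) (cproj k ` ball y (d / 2))"
  proof (rule ccontr)
    assume "\<not> ?thesis"
    then obtain u v where uv: "u \<in> ball x (d / 2)" "v \<in> ball y (d / 2)" "cproj k u = cproj k v"
      by (auto simp: disjnt_iff)
    then obtain m :: int where "v = u + of_int m * real k" unfolding cproj_eq_iff by blast
    then show False using uv(1,2) far[of m] unfolding mem_ball dist_real_def by linarith
  qed
  then show "\<exists>U V. openin (circ_top k) U \<and> openin (circ_top k) V \<and> A \<in> U \<and> B \<in> V \<and> disjnt U V"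
    using d unfolding x y
    by (intro exI[of _ "cproj k ` ball x (d / 2)"] exI[of _ "cproj k ` ball y (d / 2)"])
      (simp add: openin_cproj_image)
qed

lemma closed_vimage_cproj:
  assumes "compactin (circ_top k) C" "k \<ge> 1"
  shows "closed (cproj k -` C)"
  using closedin_continuous_map_preimage[OF continuous_map_cproj
      compactin_imp_closedin[OF Hausdorff_circ[OF assms(2)] assms(1)]]
  by (simp add: vimage_def)

text \<open>By invariance the image of \<open>S\<close> is already the image of its part in a single
  closed period, which is compact.\<close>

lemma compactin_cproj_image:
  assumes S: "closed S" and shift: "\<And>x m. x \<in> S \<Longrightarrow> x + of_int m * real k \<in> S"
    and k: "k \<ge> 1"
  shows "compactin (circ_top k) (cproj k ` S)"
proof -
  have "cproj k ` S = cproj k ` (S \<inter> {0..real k})"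
  proof (intro equalityI subsetI)
    fix A assume "A \<in> cproj k ` S"
    then obtain y where y: "y \<in> S" "A = cproj k y" by blast
    then obtain x where x: "0 \<le> x" "x < real k" "A = cproj k x"
      using cproj_representative[OF _ k] by (metis cproj_in_circ)
    then obtain m :: int where "x = y + of_int m * real k" using y(2) cproj_eq_iff by metis
    then have "x \<in> S" using shift[OF y(1)] by simp
    then show "A \<in> cproj k ` (S \<inter> {0..real k})" using x by auto
  qed auto
  moreover have "compact (S \<inter> {0..real k})" using S by (simp add: closed_Int_compact)
  ultimately show ?thesis
    using image_compactin[OF _ continuous_map_cproj] by (simp add: compactin_euclidean_iff)
qed

lemma induced_cproj:
  assumes "\<And>y. cproj k y = cproj k x \<Longrightarrow> cproj k (F y) = cproj k (F x)"
  shows "induced k F (cproj k x) = cproj k (F x)"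
proof -
  have "x \<in> cproj k x" by (simp add: mem_cproj_iff)
  then have ne: "cproj k x \<noteq> {}" by blast
  show ?thesis unfolding induced_def
  proof (rule SUP_eq_const[OF ne])
    fix y assume "y \<in> cproj k x"
    then show "cproj k (F y) = cproj k (F x)" unfolding mem_cproj_iff by (rule assms)
  qed
qed

section \<open>Recurrence expressed on the line\<close>

definition recurrent_mod :: "real \<Rightarrow> (real \<Rightarrow> real) \<Rightarrow> real \<Rightarrow> bool" where
  "recurrent_mod p F x \<longleftrightarrow>
    (\<forall>e>0. \<forall>N. \<exists>n\<ge>N. \<exists>m::int. \<bar>(F ^^ n) x - x - of_int m * p\<bar> < e)"

text \<open>The hypothesis speaks only of the orbit of one point and not of a commuting square. It
  therefore covers \<open>H_map\<close> as well, which follows \<open>gt\<close> only along orbits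
  that stay in \<open>P_set\<close>.\<close>

lemma recurrent_pt_cproj_iff:
  assumes f: "\<And>n. (f ^^ n) (cproj k x) = cproj k ((F ^^ n) x)"
  shows "recurrent_pt (circ_top k) f (cproj k x) \<longleftrightarrow> recurrent_mod (real k) F x"
proof
  assume "recurrent_pt (circ_top k) f (cproj k x)"
  then obtain n where n: "filterlim n at_top sequentially"
    and lim: "limitin (circ_top k) (\<lambda>i. (f ^^ n i) (cproj k x)) (cproj k x) sequentially"
    unfolding recurrent_pt_def by blast
  show "recurrent_mod (real k) F x"
    unfolding recurrent_mod_def
  proof (intro allI impI)
    fix e :: real and N :: nat assume e: "e > 0"
    have "openin (circ_top k) (cproj k ` ball x e)" by (rule openin_cproj_image) simp
    then have "eventually (\<lambda>i. (f ^^ n i) (cproj k x) \<in> cproj k ` ball x e) sequentially"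
      using lim e unfolding limitin_def by auto
    moreover have "eventually (\<lambda>i. n i \<ge> N) sequentially"
      using n by (simp add: filterlim_at_top)
    ultimately have "eventually (\<lambda>i. n i \<ge> N \<and> (f ^^ n i) (cproj k x) \<in> cproj k ` ball x e) sequentially"
      by (rule eventually_elim2) simp
    then obtain i where i: "n i \<ge> N" "(f ^^ n i) (cproj k x) \<in> cproj k ` ball x e"
      unfolding eventually_sequentially by blast
    then obtain y where y: "y \<in> ball x e" "cproj k y = cproj k ((F ^^ n i) x)"
      using f by auto
    then obtain m :: int where "(F ^^ n i) x = y + of_int m * real k" unfolding cproj_eq_iff by blast
    then have "\<bar>(F ^^ n i) x - x - of_int m * real k\<bar> < e"
      using y(1) by (simp add: dist_real_def)
    then show "\<exists>n\<ge>N. \<exists>m::int. \<bar>(F ^^ n) x - x - of_int m * real k\<bar> < e" using i(1) by blast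
  qed
next
  assume rec: "recurrent_mod (real k) F x"
  have "\<forall>i::nat. \<exists>n m. n \<ge> i \<and> \<bar>(F ^^ n) x - x - of_int m * real k\<bar> < 1 / real (Suc i)"
  proof
    fix i :: nat
    have "1 / real (Suc i) > 0" by simp
    then show "\<exists>n m. n \<ge> i \<and> \<bar>(F ^^ n) x - x - of_int m * real k\<bar> < 1 / real (Suc i)"
      using rec unfolding recurrent_mod_def by blast
  qed
  then obtain n m where nm: "\<And>i. n i \<ge> i"
    "\<And>i::nat. \<bar>(F ^^ n i) x - x - of_int (m i) * real k\<bar> < 1 / real (Suc i)"
    by metis
  have "filterlim n at_top sequentially"
    unfolding filterlim_at_top
  proof
    fix N show "eventually (\<lambda>i. N \<le> n i) sequentially"
      using nm(1) by (intro eventually_sequentiallyI[of N]) (meson le_trans)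
  qed
  moreover have "limitin (circ_top k) (\<lambda>i. (f ^^ n i) (cproj k x)) (cproj k x) sequentially"
    unfolding limitin_def
  proof (intro conjI allI impI)
    fix U assume U: "openin (circ_top k) U \<and> cproj k x \<in> U"
    then have "open (cproj k -` U)" "x \<in> cproj k -` U" by (auto simp: openin_circ_top)
    then obtain e where e: "e > 0" "\<And>y. dist y x < e \<Longrightarrow> cproj k y \<in> U"
      unfolding open_dist by auto
    obtain N where N: "1 / real (Suc N) < e" using e(1) by (metis nat_approx_posE)
    show "\<forall>\<^sub>F i in sequentially. (f ^^ n i) (cproj k x) \<in> U"
    proof (rule eventually_sequentiallyI[of N])
      fix i assume "N \<le> i"
      then have "1 / real (Suc i) \<le> 1 / real (Suc N)" by (simp add: frac_le)
      then have "dist ((F ^^ n i) x + of_int (- m i) * real k) x < e"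
        using nm(2)[of i] N by (simp add: dist_real_def algebra_simps)
      from e(2)[OF this] show "(f ^^ n i) (cproj k x) \<in> U"
        using cproj_shift f by metis
    qed
  qed simp
  ultimately show "recurrent_pt (circ_top k) f (cproj k x)"
    unfolding recurrent_pt_def by blast
qed

section \<open>Codes of rotations\<close>

text \<open>Basic open sets of the product constrain finitely many coordinates, and
  \<open>nat\<close> is discrete, so closure means agreement on arbitrarily long initial
  segments.\<close>

lemma closure_nat_seq_iff:
  fixes S :: "(nat \<Rightarrow> nat) set"
  shows "t \<in> closure S \<longleftrightarrow> (\<forall>M. \<exists>s\<in>S. \<forall>n<M. s n = t n)"
proof
  assume t: "t \<in> closure S"
  show "\<forall>M. \<exists>s\<in>S. \<forall>n<M. s n = t n"
  proof
    fix M
    define V where "V = (\<Inter>n\<in>{..<M}. (\<lambda>f::nat \<Rightarrow> nat. f n) -` {t n})"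
    have "open ((\<lambda>f::nat \<Rightarrow> nat. f n) -` {t n})" for n
      by (intro open_vimage open_discrete continuous_on_product_coordinates)
    then have "open V" unfolding V_def by (intro open_INT) auto
    moreover have "t \<in> V" by (simp add: V_def)
    ultimately obtain s where "s \<in> S" "s \<in> V"
      using t unfolding closure_iff_nhds_not_empty by blast
    then show "\<exists>s\<in>S. \<forall>n<M. s n = t n" by (auto simp: V_def)
  qed
next
  assume "\<forall>M. \<exists>s\<in>S. \<forall>n<M. s n = t n"
  then have S: "\<exists>s\<in>S. \<forall>n<M. s n = t n" for M by blast
  show "t \<in> closure S"
    unfolding closure_iff_nhds_not_empty
  proof (intro allI impI)
    fix A V assume V: "V \<subseteq> A" "open V" "t \<in> V"
    obtain X where X: "t \<in> Pi\<^sub>E UNIV X" "finite {i. X i \<noteq> topspace euclidean}" "Pi\<^sub>E UNIV X \<subseteq> V"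
      using product_topology_open_contains_basis[OF V(2)[unfolded open_fun_def] V(3)] by blast
    obtain M where M: "\<And>i. X i \<noteq> UNIV \<Longrightarrow> i < M"
      using X(2) unfolding finite_nat_set_iff_bounded topspace_euclidean by blast
    obtain s where s: "s \<in> S" "\<forall>n<M. s n = t n" using S by blast
    have "s i \<in> X i" for i
      using X(1) M[of i] s(2) by (cases "X i = UNIV") auto
    then have "s \<in> V" using X(3) by auto
    then show "S \<inter> A \<noteq> {}" using s(1) V(1) by blast
  qed
qed

text \<open>A discrete intermediate value argument. It locates the cell of a point when
  \<open>ell\<close> has repeated values and no explicit formula for the index exists.\<close>

lemma int_crossing:
  fixes a b :: int
  assumes "P a" "\<not> P b" "a \<le> b"
  shows "\<exists>i\<ge>a. i < b \<and> P i \<and> \<not> P (i + 1)"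
proof (rule ccontr)
  assume no: "\<not> ?thesis"
  have "i \<le> b \<longrightarrow> P i" if "a \<le> i" for i
    using that
  proof (induction i rule: int_ge_induct)
    case base
    then show ?case using assms(1) by simp
  next
    case (step i)
    then show ?case using no by auto
  qed
  then show False using assms by blast
qed

text \<open>Below, \<open>ell\<close> extends the endpoints \<open>\<ell>\<^sub>i\<close> to all integers \<open>i\<close>. The right (left) code of \<open>x\<close> is
  the limit of the codes \<open>\<zeta>\<close> of points of \<open>G\<close> that decrease (increase) to \<open>x\<close>.\<close>

definition right_code :: "(int \<Rightarrow> real) \<Rightarrow> real \<Rightarrow> real \<Rightarrow> (nat \<Rightarrow> int) \<Rightarrow> bool" where
  "right_code ell \<omega> x s \<longleftrightarrow>
    (\<forall>n. ell (s n) \<le> x + real n * \<omega> \<and> x + real n * \<omega> < ell (s n + 1))"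

definition left_code :: "(int \<Rightarrow> real) \<Rightarrow> real \<Rightarrow> real \<Rightarrow> (nat \<Rightarrow> int) \<Rightarrow> bool" where
  "left_code ell \<omega> x s \<longleftrightarrow>
    (\<forall>n. ell (s n) < x + real n * \<omega> \<and> x + real n * \<omega> \<le> ell (s n + 1))"

definition code_set :: "(int \<Rightarrow> real) \<Rightarrow> real \<Rightarrow> (nat \<Rightarrow> int) set" where
  "code_set ell \<omega> = {s. \<exists>x. right_code ell \<omega> x s \<or> left_code ell \<omega> x s}"

definition parity_seq :: "(nat \<Rightarrow> int) \<Rightarrow> nat \<Rightarrow> nat" where
  "parity_seq s n = nat (s n mod 2)"

text \<open>Monotonicity is not strict because \<open>\<omega>\<close> or some
  \<open>\<nu> i\<close> may vanish. The half-open conditions in the codes then never select a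
  degenerate cell.\<close>

locale partition_seq =
  fixes k :: nat and ell :: "int \<Rightarrow> real"
  assumes k: "k \<ge> 1"
    and ell_mono: "mono ell"
    and ell_period: "ell (i + 2 * int k) = ell i + real k"
begin

lemma ell_shift_nat: "ell (i + 2 * int k * int m) = ell i + real m * real k"
proof (induction m)
  case (Suc m)
  then show ?case using ell_period[of "i + 2 * int k * int m"] by (simp add: algebra_simps)
qed simp

lemma ell_shift: "ell (i + 2 * int k * m) = ell i + of_int m * real k"
proof (cases "m \<ge> 0")
  case True
  then show ?thesis using ell_shift_nat[of i "nat m"] by simp
next
  case False
  then show ?thesis using ell_shift_nat[of "i + 2 * int k * m" "nat (- m)"] by simp
qed

lemma ell_mod_div: "ell (i mod (2 * int k)) + of_int (i div (2 * int k)) * real k = ell i"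
  using ell_shift[of "i mod (2 * int k)" "i div (2 * int k)"] by simp

lemma ell_brackets: "\<exists>a b. a \<le> b \<and> ell a < y \<and> y < ell b"
proof -
  define m where "m = \<lfloor>(y - ell 0) / real k\<rfloor>"
  have k0: "real k > 0" using k by simp
  have "of_int m \<le> (y - ell 0) / real k" "(y - ell 0) / real k < of_int m + 1"
    unfolding m_def by linarith+
  then have "of_int m * real k \<le> y - ell 0" "y - ell 0 < (of_int m + 1) * real k"
    using k0 by (simp_all only: pos_le_divide_eq pos_divide_less_eq)
  moreover have "ell (2 * int k * (m - 1)) = ell 0 + of_int m * real k - real k"
    using ell_shift[of 0 "m - 1"] by (simp add: algebra_simps)
  moreover have "ell (2 * int k * (m + 1)) = ell 0 + (of_int m + 1) * real k"
    using ell_shift[of 0 "m + 1"] by simp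
  moreover have "2 * int k * (m - 1) \<le> 2 * int k * (m + 1)"
    by (intro mult_left_mono) auto
  ultimately show ?thesis using k0
    by (intro exI[of _ "2 * int k * (m - 1)"] exI[of _ "2 * int k * (m + 1)"]) auto
qed

lemma right_index: "\<exists>i. ell i \<le> y \<and> y < ell (i + 1)"
proof -
  obtain a b where ab: "a \<le> b" "ell a < y" "y < ell b" using ell_brackets by blast
  then obtain i where "ell i \<le> y" "\<not> ell (i + 1) \<le> y"
    using int_crossing[of "\<lambda>i. ell i \<le> y" a b] by auto
  then show ?thesis by (intro exI[of _ i]) auto
qed

lemma left_index: "\<exists>i. ell i < y \<and> y \<le> ell (i + 1)"
proof -
  obtain a b where ab: "a \<le> b" "ell a < y" "y < ell b" using ell_brackets by blast
  then obtain i where "ell i < y" "\<not> ell (i + 1) < y"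
    using int_crossing[of "\<lambda>i. ell i < y" a b] by auto
  then show ?thesis by (intro exI[of _ i]) auto
qed

lemma right_code_exists: "\<exists>s. right_code ell \<omega> x s"
  unfolding right_code_def by (rule choice) (simp add: right_index)

lemma left_code_exists: "\<exists>s. left_code ell \<omega> x s"
  unfolding left_code_def by (rule choice) (simp add: left_index)

lemma ell_less_cancel: "ell i < ell j \<Longrightarrow> i < j"
  using ell_mono by (meson monoD not_le)

text \<open>An interior point of one cell lies in no other closed cell, degenerate ones included, so
  at such points the right, left and closed conventions agree.\<close>

lemma open_index_unique:
  assumes "ell i < y" "y < ell (i + 1)" "ell j \<le> y" "y \<le> ell (j + 1)"
  shows "i = j"
proof -
  have "i < j + 1" using assms by (intro ell_less_cancel) linarith
  moreover have "j < i + 1" using assms by (intro ell_less_cancel) linarith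
  ultimately show ?thesis by linarith
qed

text \<open>Moving the base point to the right can violate only the strict upper bounds, and
  finitely many of them have a positive least slack.\<close>

lemma right_code_margin:
  assumes "right_code ell \<omega> x s"
  shows "\<exists>d>0. \<forall>n<M. \<forall>y. x \<le> y \<longrightarrow> y < x + d \<longrightarrow>
    ell (s n) \<le> y + real n * \<omega> \<and> y + real n * \<omega> < ell (s n + 1)"
proof (induction M)
  case 0
  show ?case by (intro exI[of _ 1]) auto
next
  case (Suc M)
  then obtain d where d: "d > 0" "\<forall>n<M. \<forall>y. x \<le> y \<longrightarrow> y < x + d \<longrightarrow>
    ell (s n) \<le> y + real n * \<omega> \<and> y + real n * \<omega> < ell (s n + 1)" by blast
  have M: "ell (s M) \<le> x + real M * \<omega>" "x + real M * \<omega> < ell (s M + 1)"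
    using assms unfolding right_code_def by auto
  define d' where "d' = min d (ell (s M + 1) - (x + real M * \<omega>))"
  have "d' > 0" using d(1) M by (simp add: d'_def)
  moreover have "\<forall>n<Suc M. \<forall>y. x \<le> y \<longrightarrow> y < x + d' \<longrightarrow>
    ell (s n) \<le> y + real n * \<omega> \<and> y + real n * \<omega> < ell (s n + 1)"
    using d(2) M unfolding d'_def less_Suc_eq by auto
  ultimately show ?case by blast
qed

lemma partition_seq_reflect: "partition_seq k (\<lambda>i. - ell (- i))"
proof
  show "mono (\<lambda>i. - ell (- i))" using ell_mono by (auto simp: mono_def)
  show "- ell (- (i + 2 * int k)) = - ell (- i) + real k" for i
    using ell_period[of "- (i + 2 * int k)"] by simp
qed (rule k)

text \<open>The reflection \<open>x \<mapsto> - x\<close> turns the cell between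
  \<open>ell i\<close> and \<open>ell (i + 1)\<close> into the cell numbered \<open>- i - 1\<close>
  and exchanges the closed end with the open one. Statements on left codes thus follow from those on
  right codes for the rotation by \<open>- \<omega>\<close>.\<close>

lemma left_code_reflect:
  "left_code ell \<omega> x s \<longleftrightarrow> right_code (\<lambda>i. - ell (- i)) (- \<omega>) (- x) (\<lambda>n. - s n - 1)"
proof -
  have eq: "- (- s n - 1) = s n + 1" "- (- s n - 1 + 1) = s n" for n by simp_all
  have "ell (s n) < x + real n * \<omega> \<and> x + real n * \<omega> \<le> ell (s n + 1) \<longleftrightarrow>
      - ell (s n + 1) \<le> - x + real n * - \<omega> \<and> - x + real n * - \<omega> < - ell (s n)" for n
    by (simp only: mult_minus_right) linarith
  then show ?thesis unfolding left_code_def right_code_def eq by blast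
qed

lemma left_code_margin:
  assumes "left_code ell \<omega> x s"
  shows "\<exists>d>0. \<forall>n<M. \<forall>y. y \<le> x \<longrightarrow> x - d < y \<longrightarrow>
    ell (s n) < y + real n * \<omega> \<and> y + real n * \<omega> \<le> ell (s n + 1)"
proof -
  obtain d where d: "d > 0" "\<And>n y. n < M \<Longrightarrow> - x \<le> y \<Longrightarrow> y < - x + d \<Longrightarrow>
      - ell (- (- s n - 1)) \<le> y + real n * - \<omega> \<and> y + real n * - \<omega> < - ell (- (- s n - 1 + 1))"
    using partition_seq.right_code_margin[OF partition_seq_reflect iffD1[OF left_code_reflect assms], of M] by blast
  have "ell (s n) < y + real n * \<omega> \<and> y + real n * \<omega> \<le> ell (s n + 1)"
    if "n < M" "y \<le> x" "x - d < y" for n y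
    using d(2)[OF that(1), of "- y"] that by (simp add: add.commute)
  then show ?thesis using d(1) by blast
qed

end

section \<open>The closure \<open>hm_B\<close> as the set of all one-sided codes\<close>

lemma rotation_funpow: "(rotation k \<omega> ^^ n) (cproj k x) = cproj k (x + real n * \<omega>)"
proof (induction n)
  case (Suc n)
  have "rotation k \<omega> (cproj k y) = cproj k (y + \<omega>)" for y
    unfolding rotation_def
  proof (rule induced_cproj)
    fix z assume "cproj k z = cproj k y"
    then obtain m :: int where "y = z + of_int m * real k" unfolding cproj_eq_iff by blast
    then have "y + \<omega> = (z + \<omega>) + of_int m * real k" by simp
    then show "cproj k (z + \<omega>) = cproj k (y + \<omega>)" unfolding cproj_eq_iff by blast
  qed
  then show ?case using Suc by (simp add: algebra_simps)
qed simp

locale hm_partition = partition_seq +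
  fixes \<omega> :: real and \<nu> :: "nat \<Rightarrow> real"
  assumes hm_ell_eq: "i \<le> 2 * k \<Longrightarrow> hm_ell k \<omega> \<nu> i = ell (int i)"
begin

definition generic :: "real \<Rightarrow> bool" where
  "generic x \<longleftrightarrow> (\<forall>n i. x + real n * \<omega> \<noteq> ell i)"

text \<open>Modulo \<open>k\<close> the endpoints with index up to \<open>2 * k\<close> represent
  every value of \<open>ell\<close>, so \<open>generic\<close> describes the lift of
  \<open>G\<close>.\<close>

lemma cproj_in_hm_G_iff: "cproj k x \<in> hm_G k \<omega> \<nu> \<longleftrightarrow> generic x"
proof -
  have "(\<exists>i\<le>2 * k. cproj k y = cproj k (hm_ell k \<omega> \<nu> i)) \<longleftrightarrow> (\<exists>i. y = ell i)" (is "?L \<longleftrightarrow> ?R") for y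
  proof
    assume ?L
    then obtain i where "i \<le> 2 * k" "cproj k (ell (int i)) = cproj k y" using hm_ell_eq by auto
    then obtain m :: int where "y = ell (int i) + of_int m * real k" unfolding cproj_eq_iff by blast
    then have "y = ell (int i + 2 * int k * m)" by (simp add: ell_shift)
    then show ?R by blast
  next
    assume ?R
    then obtain i where i: "y = ell i" by blast
    define j where "j = nat (i mod (2 * int k))"
    have j: "int j = i mod (2 * int k)" "j < 2 * k" using k by (auto simp: j_def nat_less_iff)
    have "y = ell (int j) + of_int (i div (2 * int k)) * real k"
      unfolding i j(1) by (rule ell_mod_div[symmetric])
    then have "cproj k y = cproj k (hm_ell k \<omega> \<nu> j)" using hm_ell_eq[of j] j(2) by simp
    then show ?L using j(2) by (intro exI[of _ j]) simp
  qed
  then show ?thesis unfolding hm_G_def generic_def by (auto simp: rotation_funpow)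
qed

lemma interior_hm_X_iff:
  assumes a: "ell a < y" "y < ell (a + 1)" and i: "i < 2 * k"
  shows "cproj k y \<in> circ_top k interior_of (hm_X k \<omega> \<nu> i) \<longleftrightarrow> int i = a mod (2 * int k)"
proof -
  have X: "hm_X k \<omega> \<nu> i = cproj k ` {ell (int i)..ell (int i + 1)}"
    unfolding hm_X_def using hm_ell_eq[of i] hm_ell_eq[of "i + 1"] i by (simp add: add.commute)
  show ?thesis
  proof
    assume "cproj k y \<in> circ_top k interior_of (hm_X k \<omega> \<nu> i)"
    then have "cproj k y \<in> hm_X k \<omega> \<nu> i" by (rule subsetD[OF interior_of_subset])
    then obtain w where w: "ell (int i) \<le> w" "w \<le> ell (int i + 1)" "cproj k y = cproj k w"
      unfolding X by auto
    then obtain m :: int where m: "w = y + of_int m * real k" unfolding cproj_eq_iff by blast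
    have "ell (a + 2 * int k * m) < w" "w < ell (a + 2 * int k * m + 1)"
      using a ell_shift[of a m] ell_shift[of "a + 1" m] unfolding m by (simp_all add: algebra_simps)
    then have "a + 2 * int k * m = int i" using w by (intro open_index_unique) auto
    then have "int i mod (2 * int k) = a mod (2 * int k)" by (metis mod_mult_self2)
    then show "int i = a mod (2 * int k)" using i by simp
  next
    assume ia: "int i = a mod (2 * int k)"
    define m where "m = a div (2 * int k)"
    define w where "w = y - of_int m * real k"
    have y: "y = w + of_int m * real k" by (simp add: w_def)
    have "int i + 1 + 2 * int k * m = a + 1" using ia by (simp add: m_def)
    then have w: "ell (int i) < w" "w < ell (int i + 1)"
      using a ell_shift[of "int i" m] ell_shift[of "int i + 1" m] ia
      unfolding w_def m_def by (simp_all add: algebra_simps)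
    have "cproj k w \<in> circ_top k interior_of (hm_X k \<omega> \<nu> i)"
      unfolding X mem_interior_of_cproj_image
      using w by (intro exI[of _ "min (w - ell (int i)) (ell (int i + 1) - w)"]) (auto intro!: imageI)
    then show "cproj k y \<in> circ_top k interior_of (hm_X k \<omega> \<nu> i)" unfolding y by simp
  qed
qed

lemma generic_right_code:
  assumes "generic x" "right_code ell \<omega> x s"
  shows "ell (s n) < x + real n * \<omega>" "x + real n * \<omega> < ell (s n + 1)"
  using assms unfolding generic_def right_code_def by (metis order_le_less)+

lemma hm_zeta_eq:
  assumes "generic x" "right_code ell \<omega> x s"
  shows "hm_zeta k \<omega> \<nu> (cproj k x) n = nat (s n mod (2 * int k))"
proof -
  have "(i < 2 * k \<and> (rotation k \<omega> ^^ n) (cproj k x) \<in> circ_top k interior_of (hm_X k \<omega> \<nu> i))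
      \<longleftrightarrow> i = nat (s n mod (2 * int k))" for i
  proof -
    have "nat (s n mod (2 * int k)) < 2 * k" using k by (simp add: nat_less_iff)
    moreover have "s n mod (2 * int k) \<ge> 0" using k by simp
    ultimately show ?thesis
      using interior_hm_X_iff[OF generic_right_code[OF assms, of n], of i]
      unfolding rotation_funpow by auto
  qed
  then show ?thesis unfolding hm_zeta_def by simp
qed

text \<open>Only countably many points are excluded, one for each pair of a time and an
  endpoint.\<close>

lemma generic_dense:
  assumes "a < b"
  shows "\<exists>x. a < x \<and> x < b \<and> generic x"
proof (rule ccontr)
  assume no: "\<not> ?thesis"
  have "{a<..<b} \<subseteq> (\<lambda>(n, i). ell i - real n * \<omega>) ` (UNIV :: (nat \<times> int) set)"
  proof
    fix x assume "x \<in> {a<..<b}"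
    then obtain n i where "x + real n * \<omega> = ell i" using no unfolding generic_def by auto
    then have "x = (\<lambda>(n, i). ell i - real n * \<omega>) (n, i)" by simp
    then show "x \<in> (\<lambda>(n, i). ell i - real n * \<omega>) ` UNIV" by blast
  qed
  then have "countable {a<..<b}" by (meson countable_image countable_subset uncountable_def countableI_type)
  then show False using assms uncountable_open_interval by blast
qed

lemma parity_mod_2k:
  assumes "t n = nat (s n mod (2 * int k))"
  shows "t n mod 2 = parity_seq s n"
proof -
  have "s n mod (2 * int k) \<ge> 0" using k by simp
  then have "t n mod 2 = nat (s n mod (2 * int k) mod 2)" using assms by (simp add: nat_mod_distrib)
  also have "s n mod (2 * int k) mod 2 = s n mod 2" by (simp add: mod_mod_cancel)
  finally show ?thesis by (simp add: parity_seq_def)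
qed

text \<open>By the margin lemmas the first \<open>M\<close> symbols stay valid on an open interval
  at one side of \<open>x\<close>. A generic point of that interval lies in \<open>G\<close> and has
  these symbols.\<close>

lemma code_in_hm_B:
  assumes "right_code ell \<omega> x s \<or> left_code ell \<omega> x s"
  shows "(\<lambda>n. nat (s n mod (2 * int k))) \<in> hm_B k \<omega> \<nu>"
  unfolding hm_B_def closure_nat_seq_iff
proof
  fix M
  have "\<exists>a b. a < b \<and> (\<forall>y. a < y \<longrightarrow> y < b \<longrightarrow> (\<forall>n<M.
      ell (s n) \<le> y + real n * \<omega> \<and> y + real n * \<omega> \<le> ell (s n + 1)))"
    using assms
  proof
    assume "right_code ell \<omega> x s"
    from right_code_margin[OF this, of M] obtain d where "d > 0" "\<forall>n<M. \<forall>y. x \<le> y \<longrightarrow> y < x + d \<longrightarrow>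
      ell (s n) \<le> y + real n * \<omega> \<and> y + real n * \<omega> < ell (s n + 1)" by blast
    then show ?thesis by (intro exI[of _ x] exI[of _ "x + d"]) (auto simp: less_imp_le)
  next
    assume "left_code ell \<omega> x s"
    from left_code_margin[OF this, of M] obtain d where "d > 0" "\<forall>n<M. \<forall>y. y \<le> x \<longrightarrow> x - d < y \<longrightarrow>
      ell (s n) < y + real n * \<omega> \<and> y + real n * \<omega> \<le> ell (s n + 1)" by blast
    then show ?thesis by (intro exI[of _ "x - d"] exI[of _ x]) (auto simp: less_imp_le)
  qed
  then obtain a b where ab: "a < b" "\<And>y n. a < y \<Longrightarrow> y < b \<Longrightarrow> n < M \<Longrightarrow>
    ell (s n) \<le> y + real n * \<omega> \<and> y + real n * \<omega> \<le> ell (s n + 1)" by blast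
  obtain y where y: "a < y" "y < b" "generic y" using generic_dense[OF ab(1)] by blast
  obtain s' where s': "right_code ell \<omega> y s'" using right_code_exists by blast
  have "s' n = s n" if "n < M" for n
    using open_index_unique[OF generic_right_code[OF y(3) s', of n]] ab(2)[OF y(1,2) that] by blast
  then have "\<forall>n<M. hm_zeta k \<omega> \<nu> (cproj k y) n = nat (s n mod (2 * int k))"
    by (simp add: hm_zeta_eq[OF y(3) s'])
  moreover have "cproj k y \<in> hm_G k \<omega> \<nu>" using y(3) cproj_in_hm_G_iff by blast
  ultimately show "\<exists>t\<in>hm_zeta k \<omega> \<nu> ` hm_G k \<omega> \<nu>. \<forall>n<M. t n = nat (s n mod (2 * int k))" by blast
qed

text \<open>Approximating points of \<open>G\<close> are taken in one period, and a subsequence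
  converges to some \<open>y\<close>. The side from which it does so decides between the right and
  the left code of \<open>y\<close>. Only parities are compared, since \<open>\<zeta>\<close>
  records symbols modulo \<open>2 * k\<close>.\<close>

lemma hm_B_code:
  assumes "t \<in> hm_B k \<omega> \<nu>"
  shows "\<exists>s\<in>code_set ell \<omega>. \<forall>n. t n mod 2 = parity_seq s n"
proof -
  have "\<exists>x s. 0 \<le> x \<and> x < real k \<and> generic x \<and> right_code ell \<omega> x s \<and>
      (\<forall>n<M. t n = nat (s n mod (2 * int k)))" for M
  proof -
    obtain A where A: "A \<in> hm_G k \<omega> \<nu>" "\<forall>n<M. hm_zeta k \<omega> \<nu> A n = t n"
      using assms unfolding hm_B_def closure_nat_seq_iff by blast
    then have "A \<in> circ k" unfolding hm_G_def by blast
    then obtain x where x: "0 \<le> x" "x < real k" "A = cproj k x" using cproj_representative k by blast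
    then have "generic x" using A(1) cproj_in_hm_G_iff by blast
    moreover obtain s where "right_code ell \<omega> x s" using right_code_exists by blast
    ultimately show ?thesis using x A(2) hm_zeta_eq by metis
  qed
  then obtain x s where x: "\<And>M. 0 \<le> x M \<and> x M < real k" and gen: "\<And>M. generic (x M)"
    and s: "\<And>M. right_code ell \<omega> (x M) (s M)"
    and t: "\<And>M n. n < M \<Longrightarrow> t n = nat (s M n mod (2 * int k))" by metis
  have "compact {0..real k}" by simp
  moreover have "\<forall>M. x M \<in> {0..real k}" using x by (auto simp: less_imp_le)
  ultimately obtain y r where r: "strict_mono r" "(x \<circ> r) \<longlonglongrightarrow> y"
    unfolding compact_def by blast
  have near: "\<exists>M0. \<forall>M\<ge>M0. \<bar>x (r M) - y\<bar> < d" if "d > 0" for d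
    using LIMSEQ_D[OF r(2) that] by simp
  have agree: "t n mod 2 = parity_seq s' n"
    if "ell (s' n) \<le> x (r M) + real n * \<omega>" "x (r M) + real n * \<omega> \<le> ell (s' n + 1)" "n < M" for s' n M
  proof -
    have "n < r M" using seq_suble[OF r(1), of M] that(3) by simp
    then have "t n = nat (s (r M) n mod (2 * int k))" by (rule t)
    moreover have "s (r M) n = s' n"
      using open_index_unique[OF generic_right_code[OF gen s]] that by blast
    ultimately show ?thesis by (intro parity_mod_2k) simp
  qed
  show ?thesis
  \<comment> \<open>If infinitely many terms are at least \<open>y\<close>, the right code applies;
    otherwise all late terms are strictly below \<open>y\<close> and the left code applies.\<close>
  proof (cases "\<exists>\<^sub>\<infinity>M. y \<le> x (r M)")
    case True
    obtain s' where s': "right_code ell \<omega> y s'" using right_code_exists by blast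
    have "t n mod 2 = parity_seq s' n" for n
    proof -
      obtain d where d: "d > 0" "\<And>z. y \<le> z \<Longrightarrow> z < y + d \<Longrightarrow>
          ell (s' n) \<le> z + real n * \<omega> \<and> z + real n * \<omega> < ell (s' n + 1)"
        using right_code_margin[OF s', of "Suc n"] by blast
      obtain M0 where M0: "\<forall>M\<ge>M0. \<bar>x (r M) - y\<bar> < d" using near[OF d(1)] by blast
      obtain M where M: "M > max M0 n" "y \<le> x (r M)" using True unfolding INFM_nat by blast
      then have "x (r M) < y + d" using M0[rule_format, of M] by auto
      then show ?thesis using agree[of s' n M] d(2)[of "x (r M)"] M by auto
    qed
    then show ?thesis using s' unfolding code_set_def by blast
  next
    case False
    then obtain M1 where M1: "\<And>M. M > M1 \<Longrightarrow> x (r M) < y" unfolding INFM_nat by (auto simp: not_le)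
    obtain s' where s': "left_code ell \<omega> y s'" using left_code_exists by blast
    have "t n mod 2 = parity_seq s' n" for n
    proof -
      obtain d where d: "d > 0" "\<And>z. z \<le> y \<Longrightarrow> y - d < z \<Longrightarrow>
          ell (s' n) < z + real n * \<omega> \<and> z + real n * \<omega> \<le> ell (s' n + 1)"
        using left_code_margin[OF s', of "Suc n"] by blast
      obtain M0 where M0: "\<forall>M\<ge>M0. \<bar>x (r M) - y\<bar> < d" using near[OF d(1)] by blast
      obtain M where M: "M \<ge> M0" "M > n" "M > M1"
        by (meson less_le_trans lessI max.cobounded1 max.cobounded2)
      then have "y - d < x (r M)" using M0 by (auto simp: abs_less_iff)
      moreover have "x (r M) \<le> y" using M1[OF M(3)] by simp
      ultimately show ?thesis using agree[of s' n M] d(2)[of "x (r M)"] M(2) by auto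
    qed
    then show ?thesis using s' unfolding code_set_def by blast
  qed
qed

theorem hm_C_eq: "hm_C k \<omega> \<nu> = parity_seq ` code_set ell \<omega>"
proof (intro equalityI subsetI)
  fix u assume "u \<in> hm_C k \<omega> \<nu>"
  then obtain t where t: "t \<in> hm_B k \<omega> \<nu>" "u = (\<lambda>n. t n mod 2)" unfolding hm_C_def by blast
  then obtain s where "s \<in> code_set ell \<omega>" "\<forall>n. t n mod 2 = parity_seq s n" using hm_B_code by blast
  then show "u \<in> parity_seq ` code_set ell \<omega>" using t(2) by (intro image_eqI[of _ _ s]) auto
next
  fix u assume "u \<in> parity_seq ` code_set ell \<omega>"
  then obtain s where s: "s \<in> code_set ell \<omega>" "u = parity_seq s" by blast
  define t where "t = (\<lambda>n. nat (s n mod (2 * int k)))"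
  have "t \<in> hm_B k \<omega> \<nu>" using s(1) code_in_hm_B unfolding code_set_def t_def by blast
  moreover have "u = (\<lambda>n. t n mod 2)"
    using parity_mod_2k[of t _ s] unfolding s(2) by (auto simp: t_def)
  ultimately show "u \<in> hm_C k \<omega> \<nu>" unfolding hm_C_def by blast
qed

end

lemma hm_partition_exists:
  assumes k: "k \<ge> 1" and al: "allowable k \<omega> \<nu>"
  shows "\<exists>ell. hm_partition k ell \<omega> \<nu> \<and> (\<forall>j. ell (2 * j + 2) = ell (2 * j + 1) + \<omega>)"
proof -
  \<comment> \<open>\<open>S\<close> continues the partial sums of \<open>\<nu>\<close> to all
    integers, gaining the full sum \<open>k * (1 - \<omega>)\<close> with each period. Before
    \<open>ell i\<close> lie \<open>(i + 1) div 2\<close> cells with lengths from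
    \<open>\<nu>\<close> and \<open>i div 2\<close> cells of length \<open>\<omega>\<close>.\<close>
  define S where "S j = (\<Sum>r=1..nat (j mod int k). \<nu> r) + of_int (j div int k) * (real k * (1 - \<omega>))" for j
  define ell where "ell i = S ((i + 1) div 2) + of_int (i div 2) * \<omega>" for i
  have \<omega>: "0 \<le> \<omega>" "\<omega> \<le> 1" and \<nu>: "\<And>i. 1 \<le> i \<Longrightarrow> i \<le> k \<Longrightarrow> 0 \<le> \<nu> i"
    and sum: "(\<Sum>i=1..k. \<nu> i) = real k * (1 - \<omega>)"
    using al unfolding allowable_def by auto
  have S_nat: "S (int j) = (\<Sum>r=1..j. \<nu> r)" if "j \<le> k" for j
  proof (cases "j = k")
    case True
    then show ?thesis using k sum by (simp add: S_def)
  next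
    case False
    then show ?thesis using that by (simp add: S_def)
  qed
  have S_period: "S (j + int k) = S j + real k * (1 - \<omega>)" for j
    using k by (simp add: S_def algebra_simps)
  have S_step: "S j \<le> S (j + 1)" for j
  proof -
    define a where "a = nat (j mod int k)"
    define m where "m = j div int k"
    have a: "a < k" "j = int a + m * int k" using k by (auto simp: a_def m_def nat_less_iff)
    have Sm: "S (i + m * int k) = S i + of_int m * (real k * (1 - \<omega>))" for i
      using k by (simp add: S_def algebra_simps)
    have "S (int a) \<le> S (int (Suc a))"
      using a(1) \<nu>[of "Suc a"] by (simp add: S_nat[of a] S_nat[of "Suc a"] del: of_nat_Suc)
    then show ?thesis using Sm[of "int a"] Sm[of "int a + 1"] a(2) by (simp add: algebra_simps)
  qed
  have step: "ell i \<le> ell (i + 1)" for i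
  proof (cases "even i")
    case True
    then obtain j where "i = 2 * j" by blast
    then show ?thesis using S_step[of j] by (simp add: ell_def add.commute)
  next
    case False
    then obtain j where "i = 2 * j + 1" using oddE by blast
    then show ?thesis using \<omega>(1) by (simp add: ell_def algebra_simps)
  qed
  have "ell i \<le> ell j" if "i \<le> j" for i j
    using that
  proof (induction j rule: int_ge_induct)
    case (step j)
    then show ?case using \<open>\<And>i. ell i \<le> ell (i + 1)\<close>[of j] by linarith
  qed simp
  then have mono: "mono ell" by (rule monoI)
  have period: "ell (i + 2 * int k) = ell i + real k" for i
  proof -
    have "(i + 2 * int k + 1) div 2 = (i + 1) div 2 + int k" "(i + 2 * int k) div 2 = i div 2 + int k"
      by linarith+
    then show ?thesis
      unfolding ell_def using S_period[of "(i + 1) div 2"] by (simp add: algebra_simps)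
  qed
  have eq: "hm_ell k \<omega> \<nu> i = ell (int i)" if i: "i \<le> 2 * k" for i
  proof (cases "even i")
    case True
    then obtain j where j: "i = 2 * j" by blast
    have "ell (int i) = S (int j) + real j * \<omega>" by (simp add: ell_def j)
    also have "S (int j) = (\<Sum>r=1..j. \<nu> r)" using i j by (intro S_nat) simp
    finally show ?thesis using sum by (auto simp: hm_ell_def j algebra_simps)
  next
    case False
    then obtain j where j: "i = 2 * j + 1" using oddE by blast
    have "ell (int i) = S (int (j + 1)) + real j * \<omega>" by (simp add: ell_def j)
    also have "S (int (j + 1)) = (\<Sum>r=1..j + 1. \<nu> r)" using i j by (intro S_nat) simp
    moreover have "i \<noteq> 2 * k" using j by presburger
    ultimately show ?thesis using j by (simp add: hm_ell_def)
  qed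
  have "hm_partition k ell \<omega> \<nu>"
    by unfold_locales (use k mono period eq in auto)
  moreover have "ell (2 * j + 2) = ell (2 * j + 1) + \<omega>" for j
  proof -
    have "(2 * j + 2 + 1) div 2 = j + 1" "(2 * j + 2) div 2 = j + 1" "(2 * j + 1 + 1) div 2 = j + 1"
      "(2 * j + 1) div 2 = j" by linarith+
    then show ?thesis unfolding ell_def by (simp add: algebra_simps)
  qed
  ultimately show ?thesis by blast
qed

section \<open>Lifted itineraries\<close>

text \<open>A maximum on the interval can occur only at \<open>b\<close>, since a positive right
  derivative at any earlier point produces larger values. Applied to \<open>gt t - t\<close>, this
  yields expansion across corners, where no two-sided derivative exists.\<close>

lemma strict_increase_if_right_derivative_pos:
  fixes f :: "real \<Rightarrow> real"
  assumes cont: "continuous_on {a..b} f" and "a < b"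
    and der: "\<And>x. a \<le> x \<Longrightarrow> x < b \<Longrightarrow> \<exists>D>0. (f has_real_derivative D) (at_right x)"
  shows "f a < f b"
proof -
  have no_max: "\<exists>y\<in>{a..b}. f x < f y" if x: "a \<le> x" "x < b" for x
  proof -
    obtain D where D: "D > 0" "(f has_real_derivative D) (at x within {x<..})" using der[OF x] by blast
    from has_real_derivative_pos_inc_right[OF D(2,1)]
    obtain d where d: "d > 0" "\<And>h. h > 0 \<Longrightarrow> x + h \<in> {x<..} \<Longrightarrow> h < d \<Longrightarrow> f x < f (x + h)" by blast
    define h where "h = min (d / 2) (b - x)"
    have "h > 0" "h < d" "x + h \<in> {a..b}" using d(1) x by (auto simp: h_def)
    then show ?thesis using d(2)[of h] by auto
  qed
  have "compact {a..b}" "{a..b} \<noteq> {}" using \<open>a < b\<close> by auto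
  then obtain c where c: "c \<in> {a..b}" "\<forall>y\<in>{a..b}. f y \<le> f c"
    using continuous_attains_sup[OF _ _ cont] by blast
  then have "c = b" using no_max[of c] by force
  moreover obtain y where "y \<in> {a..b}" "f a < f y" using no_max[of a] \<open>a < b\<close> by blast
  ultimately show ?thesis using c(2) by force
qed

text \<open>The derivative condition of the class is condensed into \<open>expand\<close>, a strict
  growth of distances on one branch; the other branches follow by integer translation.\<close>

locale expanding_lift =
  fixes gt :: "real \<Rightarrow> real" and xm zmax zmin :: real
  assumes cont: "continuous_on UNIV gt"
    and gt_add_1: "gt (x + 1) = gt x + 1"
    and expand: "0 \<le> x \<Longrightarrow> x < y \<Longrightarrow> y \<le> xm \<Longrightarrow> y - x < gt y - gt x"
    and gt_0: "0 \<le> gt 0" and gt_xm: "gt xm \<le> xm + 1" and xm: "xm < 1"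
    and zmax: "0 < zmax" "zmax < xm" "gt zmax = xm"
    and zmin: "0 < zmin" "zmin < xm" "gt zmin = 1"
begin

abbreviation "Lam \<equiv> Lambda_inf gt xm"

lemma gt_add_int: "gt (x + of_int m) = gt x + of_int m"
proof -
  have nat: "gt (x + real n) = gt x + real n" for x n
  proof (induction n)
    case (Suc n)
    then show ?case using gt_add_1[of "x + real n"] by (simp add: algebra_simps)
  qed simp
  show ?thesis
  proof (cases "m \<ge> 0")
    case True
    then show ?thesis using nat[of x "nat m"] by simp
  next
    case False
    then show ?thesis using nat[of "x + of_int m" "nat (- m)"] by simp
  qed
qed

lemma funpow_add_int: "(gt ^^ n) (x + of_int m) = (gt ^^ n) x + of_int m"
  by (induction n) (simp_all add: gt_add_int)

lemma continuous_funpow: "continuous_on UNIV (gt ^^ n)"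
proof (induction n)
  case (Suc n)
  then show ?case using continuous_on_compose2[OF cont Suc] by (simp add: o_def)
qed (simp add: id_def)

lemma zmax_less_zmin: "zmax < zmin"
proof (rule ccontr)
  assume "\<not> zmax < zmin"
  then have "zmin < zmax" using zmax(3) zmin(3) xm by (cases "zmin = zmax") auto
  then have "gt zmin < gt zmax" using expand[of zmin zmax] zmin zmax by simp
  then show False using zmax zmin xm by simp
qed

lemma branch_mono:
  assumes "of_int j \<le> x" "x < y" "y \<le> of_int j + xm"
  shows "y - x < gt y - gt x"
  using expand[of "x - of_int j" "y - of_int j"] assms gt_add_int[of "x - of_int j" j]
    gt_add_int[of "y - of_int j" j] by simp

lemma branch_mono_le:
  assumes "of_int j \<le> x" "x \<le> y" "y \<le> of_int j + xm"
  shows "gt x \<le> gt y"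
  using branch_mono[of j x y] assms by (cases "x = y") auto

lemma LamD: "x \<in> Lam \<Longrightarrow> x \<le> of_int \<lfloor>x\<rfloor> + xm"
proof -
  assume "x \<in> Lam"
  then have "(gt ^^ 0) x \<in> (\<Union>j::int. {of_int j..of_int j + xm})" unfolding Lambda_inf_def by blast
  then obtain j :: int where j: "of_int j \<le> x" "x \<le> of_int j + xm" by auto
  then have "\<lfloor>x\<rfloor> = j" using xm by (intro floor_unique) auto
  then show ?thesis using j by simp
qed

lemma Lam_gt: "x \<in> Lam \<Longrightarrow> gt x \<in> Lam"
  unfolding Lambda_inf_def mem_Collect_eq
proof
  fix n assume "\<forall>n. (gt ^^ n) x \<in> (\<Union>j::int. {of_int j..of_int j + xm})"
  from spec[OF this, of "Suc n"] show "(gt ^^ n) (gt x) \<in> (\<Union>j::int. {of_int j..of_int j + xm})"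
    by (simp only: funpow_Suc_right o_apply)
qed

lemma Lam_funpow: "x \<in> Lam \<Longrightarrow> (gt ^^ n) x \<in> Lam"
  by (induction n) (simp_all add: Lam_gt)

lemma Lam_add_int_imp: "x \<in> Lam \<Longrightarrow> x + of_int m \<in> Lam"
  unfolding Lambda_inf_def mem_Collect_eq
proof
  fix n assume "\<forall>n. (gt ^^ n) x \<in> (\<Union>j::int. {of_int j..of_int j + xm})"
  then obtain j :: int where "of_int j \<le> (gt ^^ n) x" "(gt ^^ n) x \<le> of_int j + xm" by fastforce
  then have "(gt ^^ n) (x + of_int m) \<in> {of_int (j + m)..of_int (j + m) + xm}"
    by (simp add: funpow_add_int)
  then show "(gt ^^ n) (x + of_int m) \<in> (\<Union>j::int. {of_int j..of_int j + xm})" by blast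
qed

lemma Lam_add_int [simp]: "x + of_int m \<in> Lam \<longleftrightarrow> x \<in> Lam"
  using Lam_add_int_imp[of x m] Lam_add_int_imp[of "x + of_int m" "- m"] by auto

lemma Lam_if_image:
  assumes "of_int j \<le> x" "x \<le> of_int j + xm" "gt x \<in> Lam"
  shows "x \<in> Lam"
  unfolding Lambda_inf_def mem_Collect_eq
proof
  fix n
  show "(gt ^^ n) x \<in> (\<Union>j::int. {of_int j..of_int j + xm})"
  proof (cases n)
    case 0
    then show ?thesis using assms by auto
  next
    case (Suc m)
    have "(gt ^^ m) (gt x) \<in> (\<Union>j::int. {of_int j..of_int j + xm})"
      using assms(3) unfolding Lambda_inf_def by blast
    then show ?thesis unfolding Suc funpow_Suc_right o_apply .
  qed
qed

lemma closed_Lam: "closed Lam"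
proof -
  have "open (- (\<Union>j::int. {of_int j..of_int j + xm}))" (is "open (- ?U)")
    unfolding open_dist
  proof
    fix x assume x: "x \<in> - ?U"
    then have "\<not> x \<le> of_int \<lfloor>x\<rfloor> + xm" by (force dest: spec[of _ "\<lfloor>x\<rfloor>"])
    moreover have fl: "x < of_int \<lfloor>x\<rfloor> + 1" by linarith
    ultimately have "min (x - (of_int \<lfloor>x\<rfloor> + xm)) (of_int \<lfloor>x\<rfloor> + 1 - x) > 0" (is "?e > 0") by simp
    moreover have "y \<in> - ?U" if "dist y x < ?e" for y
    proof
      assume "y \<in> ?U"
      then obtain j :: int where j: "of_int j \<le> y" "y \<le> of_int j + xm" by auto
      have y: "of_int \<lfloor>x\<rfloor> + xm < y" "y < of_int \<lfloor>x\<rfloor> + 1" using that by (auto simp: dist_real_def)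
      then have "\<lfloor>x\<rfloor> < j" using j(2) by (metis add_le_cancel_right le_less_trans not_le of_int_le_iff)
      then have "real_of_int j \<ge> of_int \<lfloor>x\<rfloor> + 1" by linarith
      then show False using j y by linarith
    qed
    ultimately show "\<exists>e>0. \<forall>y. dist y x < e \<longrightarrow> y \<in> - ?U" by blast
  qed
  then have U: "closed ?U" by (simp add: closed_def)
  have "Lam = (\<Inter>n. (gt ^^ n) -` ?U)" unfolding Lambda_inf_def by auto
  moreover have "closed ((gt ^^ n) -` ?U)" for n
    using U continuous_funpow by (intro closed_vimage) auto
  ultimately show ?thesis by auto
qed

section \<open>Symbols and lifted itineraries\<close>

definition cut :: "int \<Rightarrow> real" where
  "cut i = of_int (i div 2) + (if even i then 0 else zmin)"

text \<open>A point in a gap between address intervals receives the symbol of the interval to its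
  left. This makes \<open>symb\<close> monotone on the whole line, with jumps exactly at the points
  \<open>cut i\<close>.\<close>

definition symb :: "real \<Rightarrow> int" where
  "symb x = 2 * \<lfloor>x\<rfloor> + (if x - of_int \<lfloor>x\<rfloor> < zmin then 0 else 1)"

definition itin :: "real \<Rightarrow> nat \<Rightarrow> int" where
  "itin x n = symb ((gt ^^ n) x)"

lemma symb_div_2: "symb x div 2 = \<lfloor>x\<rfloor>"
  by (simp add: symb_def)

lemma symb_less_iff: "symb x < i \<longleftrightarrow> x < cut i"
proof (cases "even i")
  case True
  then obtain j where j: "i = 2 * j" by blast
  have "symb x < i \<longleftrightarrow> \<lfloor>x\<rfloor> < j" unfolding symb_def j by auto
  also have "\<dots> \<longleftrightarrow> x < of_int j" by (simp add: floor_less_iff)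
  finally show ?thesis by (simp add: cut_def j)
next
  case False
  then obtain j where j: "i = 2 * j + 1" using oddE by blast
  have z: "zmin < 1" using zmin xm by simp
  have "symb x < i \<longleftrightarrow> \<lfloor>x\<rfloor> < j \<or> \<lfloor>x\<rfloor> = j \<and> x - of_int \<lfloor>x\<rfloor> < zmin" unfolding symb_def j by auto
  also have "\<dots> \<longleftrightarrow> x < of_int j + zmin"
  proof
    assume "\<lfloor>x\<rfloor> < j \<or> \<lfloor>x\<rfloor> = j \<and> x - of_int \<lfloor>x\<rfloor> < zmin"
    then show "x < of_int j + zmin"
      using zmin(1) by (auto simp: floor_less_iff)
  next
    assume x: "x < of_int j + zmin"
    then have "x < of_int j + 1" using z by simp
    then have "\<lfloor>x\<rfloor> \<le> j" by (simp add: floor_le_iff)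
    then show "\<lfloor>x\<rfloor> < j \<or> \<lfloor>x\<rfloor> = j \<and> x - of_int \<lfloor>x\<rfloor> < zmin" using x by auto
  qed
  finally show ?thesis by (simp add: cut_def j)
qed

lemma symb_mono: "x \<le> y \<Longrightarrow> symb x \<le> symb y"
proof (rule ccontr)
  assume "x \<le> y" "\<not> symb x \<le> symb y"
  then have "y < cut (symb x)" by (simp add: symb_less_iff[symmetric])
  then have "x < cut (symb x)" using \<open>x \<le> y\<close> by simp
  then show False by (simp add: symb_less_iff[symmetric])
qed

lemma symb_add_int: "symb (x + of_int m) = symb x + 2 * m"
  by (simp add: symb_def)

lemma cut_add_2: "cut (i + 2 * m) = cut i + of_int m"
  by (simp add: cut_def)

lemma itin_0 [simp]: "itin x 0 = symb x"
  by (simp add: itin_def)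

lemma itin_Suc: "itin x (Suc n) = itin (gt x) n"
  unfolding itin_def funpow_Suc_right o_apply ..

lemma itin_funpow: "itin ((gt ^^ m) x) n = itin x (n + m)"
  by (simp add: itin_def funpow_add)

lemma itin_add_int: "itin (x + of_int m) n = itin x n + 2 * m"
  by (simp add: itin_def funpow_add_int symb_add_int)

text \<open>On a branch the image runs monotonically through at most two bands
  \<open>[j, j + xm]\<close> and \<open>[j + 1, j + 1 + xm]\<close>. The part between
  \<open>zmax\<close> and \<open>zmin\<close> is mapped strictly between these bands, hence out of
  \<open>Lam\<close>.\<close>

lemma Lam_cases:
  assumes "x \<in> Lam"
  obtains (low) "x \<le> of_int \<lfloor>x\<rfloor> + zmax" "symb x = 2 * \<lfloor>x\<rfloor>" "\<lfloor>gt x\<rfloor> = \<lfloor>x\<rfloor>"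
  | (high) "of_int \<lfloor>x\<rfloor> + zmin \<le> x" "symb x = 2 * \<lfloor>x\<rfloor> + 1" "\<lfloor>gt x\<rfloor> = \<lfloor>x\<rfloor> + 1"
proof -
  define j where "j = \<lfloor>x\<rfloor>"
  have x: "of_int j \<le> x" "x \<le> of_int j + xm" using LamD[OF assms] by (simp_all add: j_def)
  have gz: "gt (of_int j) = gt 0 + of_int j" "gt (of_int j + zmin) = 1 + of_int j"
    "gt (of_int j + zmax) = xm + of_int j" "gt (of_int j + xm) = gt xm + of_int j"
    using gt_add_int[of 0 j] gt_add_int[of zmin j] gt_add_int[of zmax j] gt_add_int[of xm j] zmin zmax
    by (simp_all add: add.commute)
  have lo: "of_int j \<le> gt x" using branch_mono_le[of j "of_int j" x] x gz gt_0 by simp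
  have hi: "gt x \<le> of_int j + 1 + xm" using branch_mono_le[of j x "of_int j + xm"] x gz gt_xm by simp
  show thesis
  proof (cases "gt x < of_int j + 1")
    case True
    then have fl: "\<lfloor>gt x\<rfloor> = j" using lo by (intro floor_unique) auto
    have "x < of_int j + zmin"
    proof (rule ccontr)
      assume "\<not> x < of_int j + zmin"
      then have "gt (of_int j + zmin) \<le> gt x" using x zmin by (intro branch_mono_le[of j]) auto
      then show False using True gz by simp
    qed
    then have s: "symb x = 2 * j" by (simp add: symb_def j_def)
    have "x \<le> of_int j + zmax"
    proof (rule ccontr)
      assume "\<not> x \<le> of_int j + zmax"
      then have "gt (of_int j + zmax) < gt x" using x zmax branch_mono[of j "of_int j + zmax" x] by auto
      moreover have "gt x \<le> of_int j + xm" using LamD[OF Lam_gt[OF assms]] fl by simp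
      ultimately show False using gz by simp
    qed
    then show ?thesis using low fl s by (simp add: j_def)
  next
    case False
    then have fl: "\<lfloor>gt x\<rfloor> = j + 1" using hi xm by (intro floor_unique) auto
    have "of_int j + zmin \<le> x"
    proof (rule ccontr)
      assume "\<not> of_int j + zmin \<le> x"
      then have "gt x < gt (of_int j + zmin)" using x zmin branch_mono[of j x "of_int j + zmin"] by auto
      then show False using False gz by simp
    qed
    then show ?thesis using high fl by (simp add: j_def symb_def)
  qed
qed

lemma floor_gt: "x \<in> Lam \<Longrightarrow> \<lfloor>gt x\<rfloor> = (symb x + 1) div 2"
  by (erule Lam_cases) simp_all

text \<open>The boundary numbered \<open>2 * j + 2\<close> pulls back to the one numbered
  \<open>2 * j + 1\<close>. This is the dynamical counterpart of the odd cells having length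
  \<open>\<omega>\<close>.\<close>

lemma symb_gt_less_iff:
  assumes "x \<in> Lam"
  shows "symb (gt x) < 2 * j + 2 \<longleftrightarrow> symb x < 2 * j + 1"
proof -
  have "symb (gt x) div 2 = (symb x + 1) div 2" using floor_gt[OF assms] symb_div_2 by simp
  then show ?thesis by presburger
qed

lemma itin_transition: "x \<in> Lam \<Longrightarrow> itin x (Suc n) div 2 = (itin x n + 1) div 2"
  unfolding itin_def funpow.simps o_apply symb_div_2 by (rule floor_gt[OF Lam_funpow])

text \<open>Half of \<open>s n\<close> and its parity give \<open>s n\<close>, and the transition
  law then gives half of \<open>s (Suc n)\<close>. Starting from the integer part of
  \<open>x\<close>, this undoes the reduction modulo 2.\<close>

lemma itin_eqI:
  assumes x: "x \<in> Lam" and s: "\<And>n. s (Suc n) div 2 = (s n + 1) div 2"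
    and p: "parity_seq s = parity_seq (itin x)" and 0: "s 0 div 2 = \<lfloor>x\<rfloor>"
  shows "itin x n = s n"
proof -
  have m: "s n mod 2 = itin x n mod 2" for n
    using fun_cong[OF p, of n] by (simp add: parity_seq_def nat_eq_iff2 eq_nat_nat_iff)
  have "itin x n div 2 = s n div 2"
  proof (induction n)
    case 0
    show ?case using assms(4) by (simp add: symb_div_2)
  next
    case (Suc n)
    then have "itin x n = s n" using m[of n] by (metis div_mult_mod_eq)
    then show ?case using s[of n] itin_transition[OF x, of n] by simp
  qed
  then show ?thesis using m[of n] by (metis div_mult_mod_eq)
qed

section \<open>Itineraries determine points and their order\<close>

lemma gt_mono_same_symb:
  assumes "x \<in> Lam" "y \<in> Lam" "symb x = symb y" "x < y"
  shows "y - x < gt y - gt x"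
proof -
  have "\<lfloor>x\<rfloor> = \<lfloor>y\<rfloor>" using assms(3) symb_div_2 by metis
  moreover have "of_int \<lfloor>x\<rfloor> \<le> x" by simp
  ultimately show ?thesis using assms(4) LamD[OF assms(2)] by (intro branch_mono[of "\<lfloor>x\<rfloor>"]) auto
qed

text \<open>\<open>expand\<close> gives no growth factor bounded away from 1. Pairs of points at
  distance at least \<open>e\<close> in one branch form a compact set, however, so the gain in
  distance has a positive minimum there.\<close>

lemma uniform_expansion:
  assumes e: "e > 0"
  shows "\<exists>h>0. \<forall>j::int. \<forall>x y. of_int j \<le> x \<longrightarrow> x + e \<le> y \<longrightarrow> y \<le> of_int j + xm \<longrightarrow> y - x + h \<le> gt y - gt x"
proof -
  define K where "K = {p :: real \<times> real. fst p \<in> {0..xm} \<and> snd p \<in> {0..xm} \<and> fst p + e \<le> snd p}"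
  define f where "f p = (gt (snd p) - gt (fst p)) - (snd p - fst p)" for p :: "real \<times> real"
  have "K = ({0..xm} \<times> {0..xm}) \<inter> {p. fst p + e \<le> snd p}" unfolding K_def by auto
  moreover have "closed {p :: real \<times> real. fst p + e \<le> snd p}"
    by (intro closed_Collect_le continuous_intros)
  ultimately have K: "compact K" by (simp add: compact_Times compact_Int_closed)
  have cf: "continuous_on K f" unfolding f_def
    by (intro continuous_intros continuous_on_compose2[OF cont]) auto
  have "\<exists>h>0. \<forall>p\<in>K. h \<le> f p"
  proof (cases "K = {}")
    case True
    then show ?thesis by (intro exI[of _ 1]) auto
  next
    case False
    obtain p where p: "p \<in> K" "\<forall>q\<in>K. f p \<le> f q" using continuous_attains_inf[OF K False cf] by blast
    have "f p > 0" using expand[of "fst p" "snd p"] p(1) e unfolding K_def f_def by auto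
    then show ?thesis using p(2) by blast
  qed
  then obtain h where h: "h > 0" "\<And>p. p \<in> K \<Longrightarrow> h \<le> f p" by blast
  have "y - x + h \<le> gt y - gt x" if "of_int j \<le> x" "x + e \<le> y" "y \<le> of_int j + xm" for j x y
  proof -
    have "(x - of_int j, y - of_int j) \<in> K" using that e unfolding K_def by auto
    from h(2)[OF this] show ?thesis
      using gt_add_int[of "x - of_int j" j] gt_add_int[of "y - of_int j" j] unfolding f_def by simp
  qed
  then show ?thesis using h(1) by blast
qed

text \<open>While two points share symbols they share a branch, and a distance of at least
  \<open>e\<close> grows by at least \<open>h\<close> per step. After more than \<open>1 / h\<close>
  steps it would exceed 1, contradicting equal integer parts.\<close>

lemma itin_close:
  assumes e: "e > 0"
  shows "\<exists>M. \<forall>x\<in>Lam. \<forall>y\<in>Lam. (\<forall>n<M. itin x n = itin y n) \<longrightarrow> \<bar>x - y\<bar> < e"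
proof -
  obtain h where h: "h > 0" and grow: "\<And>j x y. of_int j \<le> x \<Longrightarrow> x + e \<le> y \<Longrightarrow> y \<le> of_int j + xm
      \<Longrightarrow> y - x + h \<le> gt y - gt x" using uniform_expansion[OF e] by blast
  obtain M :: nat where M: "real M * h > 1" using h reals_Archimedean3 by blast
  have far: "y - x < e" if "x \<in> Lam" "y \<in> Lam" "\<forall>n<Suc M. itin x n = itin y n" for x y
  proof (rule ccontr)
    assume far: "\<not> y - x < e"
    have "(gt ^^ n) y - (gt ^^ n) x \<ge> e + real n * h" if "n \<le> M" for n
      using that
    proof (induction n)
      case 0
      then show ?case using far by simp
    next
      case (Suc n)
      let ?x = "(gt ^^ n) x" and ?y = "(gt ^^ n) y"
      have "symb ?x = symb ?y" using \<open>\<forall>n<Suc M. itin x n = itin y n\<close> Suc.prems by (simp add: itin_def)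
      then have fl: "\<lfloor>?x\<rfloor> = \<lfloor>?y\<rfloor>" using symb_div_2 by metis
      have ih: "?y - ?x \<ge> e + real n * h" using Suc by simp
      moreover have "real n * h \<ge> 0" using h by simp
      ultimately have "?x + e \<le> ?y" by linarith
      then have "?y - ?x + h \<le> gt ?y - gt ?x"
        using LamD[OF Lam_funpow[OF \<open>y \<in> Lam\<close>, of n]] of_int_floor_le[of ?x] fl
        by (intro grow[of "\<lfloor>?x\<rfloor>"]) (simp_all del: of_int_floor_le)
      then show ?case using ih by (simp add: algebra_simps)
    qed
    then have "(gt ^^ M) y - (gt ^^ M) x > 1" using M e by fastforce
    moreover have "\<lfloor>(gt ^^ M) x\<rfloor> = \<lfloor>(gt ^^ M) y\<rfloor>"
      using \<open>\<forall>n<Suc M. itin x n = itin y n\<close> symb_div_2 unfolding itin_def by (metis lessI)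
    ultimately show False by linarith
  qed
  have "\<bar>x - y\<bar> < e" if "x \<in> Lam" "y \<in> Lam" "\<forall>n<Suc M. itin x n = itin y n" for x y
    using far[of x y] far[of y x] that by auto
  then show ?thesis by blast
qed

lemma itin_inj:
  assumes "x \<in> Lam" "y \<in> Lam" "\<And>n. itin x n = itin y n"
  shows "x = y"
proof (rule ccontr)
  assume "x \<noteq> y"
  then have "\<bar>x - y\<bar> > 0" by simp
  from itin_close[OF this] show False using assms by blast
qed

lemma itin_eq_if_parity:
  assumes "x \<in> Lam" "y \<in> Lam" "parity_seq (itin x) = parity_seq (itin y)" "\<lfloor>x\<rfloor> = \<lfloor>y\<rfloor>"
  shows "x = y"
proof (rule itin_inj[OF assms(1,2)])
  fix n
  show "itin x n = itin y n"
    using assms itin_transition by (intro itin_eqI[where s = "itin y" and n = n]) (simp_all add: symb_div_2)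
qed

lemma itin_le_imp_le:
  assumes "x \<in> Lam" "y \<in> Lam" "\<And>n. itin x n \<le> itin y n"
  shows "x \<le> y"
proof (rule ccontr)
  assume "\<not> x \<le> y"
  then have less: "y < x" by simp
  have "(gt ^^ n) y < (gt ^^ n) x \<and> itin x n = itin y n" for n
  proof (induction n)
    case 0
    show ?case using less symb_mono[of y x] assms(3)[of 0] by simp
  next
    case (Suc n)
    then have "gt ((gt ^^ n) y) < gt ((gt ^^ n) x)"
      using gt_mono_same_symb[of "(gt ^^ n) y" "(gt ^^ n) x"] Lam_funpow assms(1,2)
      by (auto simp: itin_def)
    moreover from this have "itin y (Suc n) \<le> itin x (Suc n)"
      unfolding itin_def by (intro symb_mono) simp
    ultimately show ?case using assms(3)[of "Suc n"] by simp
  qed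
  then show False using itin_inj[OF assms(1,2)] less by simp
qed

text \<open>The two kinds of gaps between consecutive address intervals have lengths
  \<open>zmin - zmax\<close> and \<open>1 - xm\<close>. Points of \<open>Lam\<close> with different
  symbols are separated by at least one of them.\<close>

lemma symb_locally_constant:
  assumes "x \<in> Lam" "y \<in> Lam" "\<bar>x - y\<bar> < min (zmin - zmax) (1 - xm)"
  shows "symb x = symb y"
proof -
  have lt: "symb x = symb y" if "x \<in> Lam" "y \<in> Lam" "x \<le> y" "y - x < min (zmin - zmax) (1 - xm)" for x y
  proof -
    have fl: "\<lfloor>x\<rfloor> = \<lfloor>y\<rfloor>"
    proof (rule ccontr)
      assume "\<lfloor>x\<rfloor> \<noteq> \<lfloor>y\<rfloor>"
      then have "\<lfloor>x\<rfloor> + 1 \<le> \<lfloor>y\<rfloor>" using floor_mono[OF that(3)] by simp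
      then have "of_int \<lfloor>x\<rfloor> + 1 \<le> y" by linarith
      then show False using LamD[OF that(1)] that(4) by simp
    qed
    show ?thesis
    proof (rule ccontr)
      assume "symb x \<noteq> symb y"
      then have "symb x < symb y" using symb_mono[OF that(3)] by simp
      then have "x \<le> of_int \<lfloor>x\<rfloor> + zmax" "of_int \<lfloor>x\<rfloor> + zmin \<le> y"
        using that(1,2) fl by (auto elim!: Lam_cases)
      then show False using that(4) by simp
    qed
  qed
  show ?thesis
  proof (cases "x \<le> y")
    case True
    with lt[OF assms(1,2) True] assms(3) show ?thesis by linarith
  next
    case False
    then have "symb y = symb x" using assms(3) by (intro lt[OF assms(2,1)]) linarith+
    then show ?thesis by simp
  qed
qed

lemma itin_continuous:
  assumes "x \<in> Lam"
  shows "\<exists>e>0. \<forall>y\<in>Lam. \<bar>y - x\<bar> < e \<longrightarrow> (\<forall>n<M. itin y n = itin x n)"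
proof (induction M)
  case 0
  show ?case by (intro exI[of _ 1]) auto
next
  case (Suc M)
  then obtain e where e: "e > 0" "\<And>y n. y \<in> Lam \<Longrightarrow> \<bar>y - x\<bar> < e \<Longrightarrow> n < M \<Longrightarrow> itin y n = itin x n"
    by blast
  have "min (zmin - zmax) (1 - xm) > 0" using zmax_less_zmin xm by simp
  moreover have "isCont (gt ^^ M) x" using continuous_funpow[of M] by (simp add: continuous_on_eq_continuous_at)
  ultimately obtain d where d: "d > 0" "\<And>y. \<bar>y - x\<bar> < d \<Longrightarrow>
      \<bar>(gt ^^ M) y - (gt ^^ M) x\<bar> < min (zmin - zmax) (1 - xm)"
    unfolding continuous_at_eps_delta dist_real_def by metis
  have "itin y M = itin x M" if "y \<in> Lam" "\<bar>y - x\<bar> < d" for y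
    unfolding itin_def using that d(2) by (intro symb_locally_constant Lam_funpow assms) auto
  then have "\<forall>y\<in>Lam. \<bar>y - x\<bar> < min d e \<longrightarrow> (\<forall>n<Suc M. itin y n = itin x n)"
    using e(2) unfolding less_Suc_eq by auto
  then show ?case using d(1) e(1) by (intro exI[of _ "min d e"]) auto
qed

text \<open>On a branch \<open>gt t - t\<close> is increasing, and its end values are at least 0 on
  the left and at most 1 on the right.\<close>

lemma displacement:
  assumes "x \<in> Lam"
  shows "x \<le> gt x" "gt x \<le> x + 1"
proof -
  have gz: "gt (of_int \<lfloor>x\<rfloor>) = gt 0 + of_int \<lfloor>x\<rfloor>" "gt (of_int \<lfloor>x\<rfloor> + xm) = gt xm + of_int \<lfloor>x\<rfloor>"
    using gt_add_int[of 0 "\<lfloor>x\<rfloor>"] gt_add_int[of xm "\<lfloor>x\<rfloor>"] by (simp_all add: add.commute)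
  have fl: "of_int \<lfloor>x\<rfloor> \<le> x" by simp
  show "x \<le> gt x"
  proof (cases "x = of_int \<lfloor>x\<rfloor>")
    case True
    then show ?thesis using gz(1) gt_0 by simp
  next
    case False
    then show ?thesis using branch_mono[of "\<lfloor>x\<rfloor>" "of_int \<lfloor>x\<rfloor>" x] LamD[OF assms] gz(1) gt_0 fl by linarith
  qed
  show "gt x \<le> x + 1"
  proof (cases "x = of_int \<lfloor>x\<rfloor> + xm")
    case True
    then have "gt x = gt xm + of_int \<lfloor>x\<rfloor>" using gz(2) by metis
    then show ?thesis using True gt_xm by linarith
  next
    case False
    then show ?thesis
      using branch_mono[of "\<lfloor>x\<rfloor>" x "of_int \<lfloor>x\<rfloor> + xm"] LamD[OF assms] gz(2) gt_xm fl by linarith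
  qed
qed

end

lemma in_class_G_imp_expanding_lift:
  assumes G: "in_class_G g gt xm"
    and "0 < zmax" "zmax < xm" "gt zmax = xm" and "0 < zmin" "zmin < xm" "gt zmin = 1"
  shows "expanding_lift gt xm zmax zmin"
proof
  show "y - x < gt y - gt x" if xy: "0 \<le> x" "x < y" "y \<le> xm" for x y
  proof -
    have "(\<lambda>t. gt t - t) x < (\<lambda>t. gt t - t) y"
    proof (rule strict_increase_if_right_derivative_pos[OF _ xy(2)])
      have "continuous_on {x..y} gt" using G continuous_on_subset unfolding in_class_G_def by blast
      then show "continuous_on {x..y} (\<lambda>t. gt t - t)" by (intro continuous_intros)
      fix t assume "x \<le> t" "t < y"
      then have "t \<in> {0..<xm}" using xy by auto
      then obtain D where "D > 1" "(gt has_real_derivative D) (at_right t)"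
        using G unfolding in_class_G_def by blast
      then have "D - 1 > 0" "((\<lambda>t. gt t - t) has_real_derivative D - 1) (at_right t)"
        by (auto intro!: derivative_eq_intros)
      then show "\<exists>D>0. ((\<lambda>t. gt t - t) has_real_derivative D) (at_right t)" by blast
    qed
    then show ?thesis by simp
  qed
qed (use assms in \<open>auto simp: in_class_G_def\<close>)

section \<open>From codes to kfsm sets\<close>

lemma irrational_multiples_dense:
  fixes \<omega> p :: real
  assumes "\<omega> / p \<notin> \<rat>" "p > 0" "a < b"
  shows "\<exists>n::nat. n > 0 \<and> (\<exists>m::int. a < real n * \<omega> + of_int m * p \<and> real n * \<omega> + of_int m * p < b)"
proof -
  define c where "c = (a + b) / 2 / p"
  have "(b - a) / 2 / p > 0" using assms by simp
  from sequence_of_fractional_parts_is_dense[OF assms(1) this, of c]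
  obtain h q where hq: "q > 0" "\<bar>of_int q * (\<omega> / p) - of_int h - c\<bar> < (b - a) / 2 / p" by blast
  define n where "n = nat q"
  have n: "n > 0" "of_int q = real n" using hq(1) by (auto simp: n_def)
  have "\<bar>real n * (\<omega> / p) - of_int h - c\<bar> * p < (b - a) / 2 / p * p"
    using hq(2) assms(2) unfolding n(2) by (intro mult_strict_right_mono) auto
  moreover have "\<bar>real n * (\<omega> / p) - of_int h - c\<bar> * p = \<bar>(real n * (\<omega> / p) - of_int h - c) * p\<bar>"
    using assms(2) by (simp add: abs_mult)
  moreover have "(real n * (\<omega> / p) - of_int h - c) * p = real n * \<omega> + of_int (- h) * p - (a + b) / 2"
    using assms(2) by (simp add: c_def field_simps)
  ultimately have "\<bar>real n * \<omega> + of_int (- h) * p - (a + b) / 2\<bar> < (b - a) / 2" using assms(2) by simp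
  then have "a < real n * \<omega> + of_int (- h) * p" "real n * \<omega> + of_int (- h) * p < b"
    unfolding abs_less_iff by (simp_all add: field_simps)
  then show ?thesis using n(1) by blast
qed

text \<open>One-sided smallness is what counts, since a right code survives only small moves to the
  right. In the rational case the multiple returns exactly to 0.\<close>

lemma multiples_near_0:
  fixes \<omega> p :: real
  assumes "p > 0" "d > 0"
  shows "\<exists>n\<ge>N. \<exists>m::int. 0 \<le> real n * \<omega> - of_int m * p \<and> real n * \<omega> - of_int m * p < d"
proof (cases "\<omega> / p \<in> \<rat>")
  case True
  then obtain a b :: int where ab: "\<omega> / p = of_int a / of_int b" "b > 0" by (rule Rats_cases') 
  then have "of_int b * \<omega> = of_int a * p" using assms(1) by (simp add: field_simps)
  moreover have "real (nat b * N) * \<omega> = real N * (of_int b * \<omega>)" using ab(2) by simp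
  ultimately have eq: "real (nat b * N) * \<omega> = of_int (a * int N) * p" by simp
  moreover have "nat b * N \<ge> N" using ab(2) by (cases "nat b") auto
  moreover have "0 \<le> real (nat b * N) * \<omega> - of_int (a * int N) * p"
    "real (nat b * N) * \<omega> - of_int (a * int N) * p < d"
    unfolding eq using assms(2) by simp_all
  ultimately show ?thesis by blast
next
  case False
  \<comment> \<open>Using \<open>real (Suc N) * \<omega>\<close> in place of \<open>\<omega>\<close>
    makes the resulting time a positive multiple of \<open>Suc N\<close>, hence at least
    \<open>N\<close>.\<close>
  have "real (Suc N) * \<omega> / p \<notin> \<rat>"
  proof
    assume "real (Suc N) * \<omega> / p \<in> \<rat>"
    from Rats_divide[OF this Rats_of_nat]
    have "(real (Suc N) * \<omega> / p) / real (Suc N) \<in> \<rat>" .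
    then show False using False by simp
  qed
  from irrational_multiples_dense[OF this assms(1,2)]
  obtain n m where "n > 0" "0 < real n * (real (Suc N) * \<omega>) + of_int m * p"
    "real n * (real (Suc N) * \<omega>) + of_int m * p < d" by blast
  moreover from this have "N \<le> n * Suc N" by (cases n) auto
  ultimately show ?thesis
    by (intro exI[of _ "n * Suc N"] conjI exI[of _ "- m"]) (auto simp: algebra_simps)
qed

text \<open>Codes are ordered as their base points are; at a common base point the left code lies
  below the right one. With repeated values of \<open>ell\<close> this still works, because each
  comparison keeps one strict inequality to cancel.\<close>

lemma (in partition_seq) code_set_total:
  assumes "s \<in> code_set ell \<omega>" "t \<in> code_set ell \<omega>"
  shows "(\<forall>n. s n \<le> t n) \<or> (\<forall>n. t n \<le> s n)"
proof -
  have weak: "ell (s n) \<le> x + real n * \<omega> \<and> x + real n * \<omega> \<le> ell (s n + 1)"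
    if "right_code ell \<omega> x s \<or> left_code ell \<omega> x s" for x s n
    using that unfolding right_code_def left_code_def by (meson less_imp_le)
  have le: "s n \<le> t n" if "ell (s n) < ell (t n + 1)" for s t :: "nat \<Rightarrow> int" and n
    using ell_less_cancel[OF that] by simp
  obtain x y where x: "right_code ell \<omega> x s \<or> left_code ell \<omega> x s"
    and y: "right_code ell \<omega> y t \<or> left_code ell \<omega> y t"
    using assms unfolding code_set_def by blast
  consider "x < y" | "y < x" | "x = y" "right_code ell \<omega> y t" | "x = y" "left_code ell \<omega> x s"
    | "x = y" "right_code ell \<omega> x s" using x by linarith
  then show ?thesis
  proof cases
    case 1
    have "s n \<le> t n" for n using weak[OF x, of n] weak[OF y, of n] 1 by (intro le) linarith
    then show ?thesis by blast
  next
    case 2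
    have "t n \<le> s n" for n using weak[OF x, of n] weak[OF y, of n] 2 by (intro le) linarith
    then show ?thesis by blast
  next
    case 3
    have "s n \<le> t n" for n
      using weak[OF x, of n] 3 unfolding right_code_def by (intro le) (meson le_less_trans)
    then show ?thesis by blast
  next
    case 4
    have "s n \<le> t n" for n
      using weak[OF y, of n] 4 unfolding left_code_def by (intro le) (metis less_le_trans)
    then show ?thesis by blast
  next
    case 5
    have "t n \<le> s n" for n
      using weak[OF y, of n] 5 unfolding right_code_def by (intro le) (metis le_less_trans)
    then show ?thesis by blast
  qed
qed

lemma (in partition_seq) code_set_shift:
  assumes "s \<in> code_set ell \<omega>"
  shows "(\<lambda>n. s (Suc n)) \<in> code_set ell \<omega>"
proof -
  obtain x where x: "right_code ell \<omega> x s \<or> left_code ell \<omega> x s"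
    using assms unfolding code_set_def by blast
  have eq: "x + \<omega> + real n * \<omega> = x + real (Suc n) * \<omega>" for n by (simp add: algebra_simps)
  have "right_code ell \<omega> (x + \<omega>) (\<lambda>n. s (Suc n)) \<or> left_code ell \<omega> (x + \<omega>) (\<lambda>n. s (Suc n))"
    using x unfolding right_code_def left_code_def eq by blast
  then show ?thesis unfolding code_set_def by blast
qed

lemma (in partition_seq) code_set_translate:
  assumes "s \<in> code_set ell \<omega>"
  shows "(\<lambda>n. s n + 2 * int k * m) \<in> code_set ell \<omega>"
proof -
  obtain x where x: "right_code ell \<omega> x s \<or> left_code ell \<omega> x s"
    using assms unfolding code_set_def by blast
  have eq: "i + 2 * int k * m + 1 = (i + 1) + 2 * int k * m" for i by simp
  have "right_code ell \<omega> (x + of_int m * real k) (\<lambda>n. s n + 2 * int k * m) \<or>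
    left_code ell \<omega> (x + of_int m * real k) (\<lambda>n. s n + 2 * int k * m)"
    using x unfolding right_code_def left_code_def eq ell_shift by (auto simp: algebra_simps)
  then show ?thesis unfolding code_set_def by blast
qed

text \<open>The rotation brings \<open>x\<close> back modulo \<open>k\<close> from the right, within
  the margin on which the first \<open>M\<close> symbols persist. The integer \<open>m\<close>
  records the completed turns.\<close>

lemma (in partition_seq) right_code_recurrent:
  assumes s: "right_code ell \<omega> x s"
  shows "\<exists>n\<ge>N. \<exists>m. \<forall>i<M. s (i + n) - 2 * int k * m = s i"
proof -
  have k0: "real k > 0" using k by simp
  from right_code_margin[OF s, of M] obtain d where d: "d > 0" "\<And>n y. n < M \<Longrightarrow> x \<le> y \<Longrightarrow> y < x + d \<Longrightarrow>
    ell (s n) \<le> y + real n * \<omega> \<and> y + real n * \<omega> < ell (s n + 1)" by blast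
  obtain n m where nm: "n \<ge> N" "0 \<le> real n * \<omega> - of_int m * real k" "real n * \<omega> - of_int m * real k < d"
    using multiples_near_0[OF k0 d(1), of N \<omega>] by blast
  have "s (i + n) - 2 * int k * m = s i" if "i < M" for i
  proof -
    have "ell (s i) \<le> x + (real n * \<omega> - of_int m * real k) + real i * \<omega>"
      "x + (real n * \<omega> - of_int m * real k) + real i * \<omega> < ell (s i + 1)"
      using d(2)[OF that, of "x + (real n * \<omega> - of_int m * real k)"] nm by auto
    then have "ell (s i + 2 * int k * m) \<le> x + real (i + n) * \<omega>"
      "x + real (i + n) * \<omega> < ell (s i + 1 + 2 * int k * m)"
      unfolding ell_shift by (auto simp: algebra_simps)
    moreover have "ell (s (i + n)) \<le> x + real (i + n) * \<omega>" "x + real (i + n) * \<omega> < ell (s (i + n) + 1)"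
      using s unfolding right_code_def by blast+
    ultimately have "s (i + n) < s i + 1 + 2 * int k * m" "s i + 2 * int k * m < s (i + n) + 1"
      by (blast intro: ell_less_cancel le_less_trans)+
    then show ?thesis by linarith
  qed
  then show ?thesis using nm(1) by blast
qed

lemma (in partition_seq) code_recurrent:
  assumes "s \<in> code_set ell \<omega>"
  shows "\<exists>n\<ge>N. \<exists>m. \<forall>i<M. s (i + n) - 2 * int k * m = s i"
proof -
  obtain x where "right_code ell \<omega> x s \<or> left_code ell \<omega> x s"
    using assms unfolding code_set_def by blast
  then show ?thesis
  proof
    assume "left_code ell \<omega> x s"
    from partition_seq.right_code_recurrent[OF partition_seq_reflect iffD1[OF left_code_reflect this]]
    obtain n m where n: "n \<ge> N" "\<And>i. i < M \<Longrightarrow> (- s (i + n) - 1) - 2 * int k * m = - s i - 1" by blast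
    have "s (i + n) - 2 * int k * (- m) = s i" if "i < M" for i using n(2)[OF that] by simp
    then show ?thesis using n(1) by blast
  qed (rule right_code_recurrent)
qed

text \<open>Translation by \<open>\<omega>\<close> moves the end of cell \<open>2 * j\<close> to
  \<open>ell (2 * j + 2)\<close>, which is also where the start of cell \<open>2 * j + 1\<close>
  lands. An even cell thus reaches only its own pair of cells, an odd one only the next
  pair.\<close>

lemma (in partition_seq) code_transition:
  assumes s: "s \<in> code_set ell \<omega>" and step: "\<And>j. ell (2 * j + 2) = ell (2 * j + 1) + \<omega>"
  shows "s (Suc n) div 2 = (s n + 1) div 2"
proof -
  have \<omega>: "\<omega> \<ge> 0" using monoD[OF ell_mono, of 1 2] step[of 0] by simp
  obtain x where "right_code ell \<omega> x s \<or> left_code ell \<omega> x s"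
    using s unfolding code_set_def by blast
  then obtain y where
    "(ell (s n) \<le> y \<and> y < ell (s n + 1)) \<and> (ell (s (Suc n)) \<le> y + \<omega> \<and> y + \<omega> < ell (s (Suc n) + 1)) \<or>
     (ell (s n) < y \<and> y \<le> ell (s n + 1)) \<and> (ell (s (Suc n)) < y + \<omega> \<and> y + \<omega> \<le> ell (s (Suc n) + 1))"
  proof
    assume "right_code ell \<omega> x s"
    then have "ell (s n) \<le> x + real n * \<omega>" "x + real n * \<omega> < ell (s n + 1)"
      "ell (s (Suc n)) \<le> x + real (Suc n) * \<omega>" "x + real (Suc n) * \<omega> < ell (s (Suc n) + 1)"
      unfolding right_code_def by blast+
    then show thesis by (intro that[of "x + real n * \<omega>"]) (simp add: algebra_simps)
  next
    assume "left_code ell \<omega> x s"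
    then have "ell (s n) < x + real n * \<omega>" "x + real n * \<omega> \<le> ell (s n + 1)"
      "ell (s (Suc n)) < x + real (Suc n) * \<omega>" "x + real (Suc n) * \<omega> \<le> ell (s (Suc n) + 1)"
      unfolding left_code_def by blast+
    then show thesis by (intro that[of "x + real n * \<omega>"]) (simp add: algebra_simps)
  qed note y = this
  have lower: "a \<le> s (Suc n)" if "ell a \<le> ell (s n) + \<omega>" for a
  proof -
    have "ell a < ell (s (Suc n) + 1)" using that y by linarith
    then show ?thesis using ell_less_cancel by fastforce
  qed
  have upper: "s (Suc n) < b" if "ell (s n + 1) + \<omega> \<le> ell b" for b
  proof -
    have "ell (s (Suc n)) < ell b" using that y by linarith
    then show ?thesis using ell_less_cancel by blast
  qed
  show ?thesis
  proof (cases "even (s n)")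
    case True
    then obtain j where j: "s n = 2 * j" by blast
    have "2 * j \<le> s (Suc n)" using \<omega> by (intro lower) (simp add: j)
    moreover have "s (Suc n) < 2 * j + 2" by (intro upper) (simp add: j step)
    ultimately show ?thesis unfolding j by presburger
  next
    case False
    then obtain j where j: "s n = 2 * j + 1" using oddE by blast
    have "2 * j + 2 \<le> s (Suc n)" by (intro lower) (simp add: j step)
    moreover have "ell (2 * j + 2) + \<omega> \<le> ell (2 * j + 4)"
      using step[of "j + 1"] monoD[OF ell_mono, of "2 * j + 2" "2 * j + 3"] by (simp add: add.commute)
    then have "s (Suc n) < 2 * j + 4" by (intro upper) (simp add: j add.commute)
    ultimately show ?thesis unfolding j by presburger
  qed
qed

lemma kfsm_liftI:
  assumes "\<And>z. z \<in> Y \<Longrightarrow> F z \<in> Y" and shift: "\<And>z m. z \<in> Y \<Longrightarrow> z + of_int m * real k \<in> Y"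
    and "\<And>x y. x \<in> Y \<Longrightarrow> y \<in> Y \<Longrightarrow> x < y \<Longrightarrow> F x \<le> F y"
  shows "kfsm_lift k F Y"
proof -
  have "x \<in> (\<lambda>x. x + real k) ` Y" if "x \<in> Y" for x
    using shift[OF that, of "- 1"] by (intro image_eqI[of _ _ "x - real k"]) auto
  moreover have "x + real k \<in> Y" if "x \<in> Y" for x using shift[OF that, of 1] by simp
  ultimately show ?thesis using assms(1,3) unfolding kfsm_lift_def invariant_set_def by blast
qed

section \<open>Points with prescribed codes as a kfsm set on the circle\<close>

locale circle_map = expanding_lift +
  fixes g :: "real set \<Rightarrow> real set"
  assumes g_cproj: "g (cproj 1 x) = cproj 1 (gt x)"
begin

lemma g_funpow: "(g ^^ n) (cproj 1 x) = cproj 1 ((gt ^^ n) x)"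
  by (induction n) (simp_all add: g_cproj del: One_nat_def)

lemma cproj_1_eq_iff: "cproj 1 x = cproj 1 y \<longleftrightarrow> (\<exists>m::int. y = x + of_int m)"
  unfolding cproj_eq_iff by simp

lemma cproj_in_Lambda_iff: "cproj 1 x \<in> Lambda 1 gt xm \<longleftrightarrow> x \<in> Lam"
proof
  assume "cproj 1 x \<in> Lambda 1 gt xm"
  then obtain y where "y \<in> Lam" "cproj 1 y = cproj 1 x" unfolding Lambda_def by auto
  then show "x \<in> Lam" unfolding cproj_1_eq_iff by auto
qed (auto simp: Lambda_def)

lemma itinerary_eq:
  assumes x: "x \<in> Lam"
  shows "itinerary g xm zmax zmin (cproj 1 x) = parity_seq (itin x)"
proof
  fix n
  define y where "y = (gt ^^ n) x"
  have y: "y \<in> Lam" unfolding y_def by (rule Lam_funpow[OF x])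
  \<comment> \<open>With both ends in \<open>[0, 1)\<close>, a representative inside the interval
    has integer part 0, so membership is decided by the fractional part of \<open>y\<close>.\<close>
  have mem: "cproj 1 y \<in> cproj 1 ` {a..b} \<longleftrightarrow> a \<le> y - of_int \<lfloor>y\<rfloor> \<and> y - of_int \<lfloor>y\<rfloor> \<le> b"
    if ab: "0 \<le> a" "b < 1" for a b
  proof
    assume "cproj 1 y \<in> cproj 1 ` {a..b}"
    then obtain w where w: "a \<le> w" "w \<le> b" "cproj 1 w = cproj 1 y" by auto
    then obtain m :: int where m: "y = w + of_int m" unfolding cproj_1_eq_iff by blast
    then have "\<lfloor>y\<rfloor> = m" using w ab by (intro floor_unique) auto
    then show "a \<le> y - of_int \<lfloor>y\<rfloor> \<and> y - of_int \<lfloor>y\<rfloor> \<le> b" using w m by simp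
  next
    assume "a \<le> y - of_int \<lfloor>y\<rfloor> \<and> y - of_int \<lfloor>y\<rfloor> \<le> b"
    moreover have "cproj 1 (y - of_int \<lfloor>y\<rfloor>) = cproj 1 y"
      unfolding cproj_1_eq_iff by (intro exI[of _ "\<lfloor>y\<rfloor>"]) simp
    ultimately show "cproj 1 y \<in> cproj 1 ` {a..b}" by (metis atLeastAtMost_iff image_eqI)
  qed
  have A0: "address xm zmax zmin (int 0) = {0..zmax}" and A1: "address xm zmax zmin (int 1) = {zmin..xm}"
    by (simp_all add: address_def)
  have m0: "cproj 1 y \<in> cproj 1 ` address xm zmax zmin (int 0) \<longleftrightarrow> y \<le> of_int \<lfloor>y\<rfloor> + zmax"
    unfolding A0 using mem[of 0 zmax] zmax xm by auto
  have m1: "cproj 1 y \<in> cproj 1 ` address xm zmax zmin (int 1) \<longleftrightarrow> of_int \<lfloor>y\<rfloor> + zmin \<le> y"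
    unfolding A1 using mem[of zmin xm] zmin xm LamD[OF y] by auto
  have "itinerary g xm zmax zmin (cproj 1 x) n =
      (THE i. i \<in> {0, 1} \<and> cproj 1 y \<in> cproj 1 ` address xm zmax zmin (int i))"
    unfolding itinerary_def g_funpow y_def ..
  also have "\<dots> = nat (symb y mod 2)"
    using y
  proof (cases rule: Lam_cases)
    case low
    then have "\<not> of_int \<lfloor>y\<rfloor> + zmin \<le> y" using zmax_less_zmin by simp
    then show ?thesis using low(1,2) m0 m1 by (intro the_equality) auto
  next
    case high
    then have "\<not> y \<le> of_int \<lfloor>y\<rfloor> + zmax" using zmax_less_zmin by simp
    then show ?thesis using high(1,2) m0 m1 by (intro the_equality) auto
  qed
  finally show "itinerary g xm zmax zmin (cproj 1 x) n = parity_seq (itin x) n"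
    by (simp add: parity_seq_def itin_def y_def)
qed

lemma recurrent_pt_g_iff: "recurrent_pt (circ_top 1) g (cproj 1 x) \<longleftrightarrow> recurrent_mod 1 gt x"
  using recurrent_pt_cproj_iff[of g 1 x gt, OF g_funpow] by simp

lemma parity_itin_add_int: "parity_seq (itin (x + of_int m)) = parity_seq (itin x)"
  by (rule ext) (simp add: parity_seq_def itin_add_int)

text \<open>Injectivity of the circle coding: an integer translation aligns the integer parts, after
  which parities determine the whole lifted itinerary.\<close>

lemma parity_itin_eq:
  assumes "x \<in> Lam" "y \<in> Lam" "parity_seq (itin x) = parity_seq (itin y)"
  shows "cproj 1 x = cproj 1 y"
proof -
  define x' where "x' = x + of_int (\<lfloor>y\<rfloor> - \<lfloor>x\<rfloor>)"
  have x': "x' \<in> Lam" unfolding x'_def Lam_add_int by (rule assms(1))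
  have "parity_seq (itin x') = parity_seq (itin y)"
    unfolding x'_def parity_itin_add_int by (rule assms(3))
  then have "x' = y" by (rule itin_eq_if_parity[OF x' assms(2)]) (simp add: x'_def)
  then show ?thesis unfolding cproj_1_eq_iff x'_def by metis
qed

theorem constructable_imp_recurrent_kfsm:
  assumes hm: "hm_constructable k g xm zmax zmin Z" and k: "k \<ge> 1" and Z: "Z \<subseteq> Lambda 1 gt xm"
  shows "recurrent_set (circ_top 1) g Z \<and> kfsm k g gt Z"
proof -
  obtain \<omega> \<nu> where al: "allowable k \<omega> \<nu>" and it: "itinerary g xm zmax zmin ` Z = hm_C k \<omega> \<nu>"
    using hm unfolding hm_constructable_def by blast
  obtain ell where "hm_partition k ell \<omega> \<nu>" and step: "\<And>j. ell (2 * j + 2) = ell (2 * j + 1) + \<omega>"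
    using hm_partition_exists[OF k al] by blast
  then interpret hm_partition k ell \<omega> \<nu> by simp
  \<comment> \<open>Taking all points with a code as lifted itinerary makes invariance under
    \<open>gt\<close> and under translation by \<open>k\<close> a matter of shifting and translating
    codes.\<close>
  define Z' where "Z' = {z \<in> Lam. itin z \<in> code_set ell \<omega>}"
  note it = it[unfolded hm_C_eq]
  have Z_lift: "\<exists>z\<in>Z'. cproj 1 z = A" if A: "A \<in> Z" for A
  proof -
    obtain w where w: "w \<in> Lam" "A = cproj 1 w" using A Z unfolding Lambda_def by blast
    obtain s where s: "s \<in> code_set ell \<omega>" "parity_seq (itin w) = parity_seq s"
      using A it itinerary_eq[OF w(1)] w(2) by (metis image_iff)
    \<comment> \<open>The parities of \<open>s\<close> are those of the itinerary of
      \<open>w\<close>; this translation also matches the integer part, so that \<open>z\<close> has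
      \<open>s\<close> itself as itinerary.\<close>
    define z where "z = w + of_int (s 0 div 2 - \<lfloor>w\<rfloor>)"
    have z: "z \<in> Lam" unfolding z_def Lam_add_int by (rule w(1))
    have "parity_seq (itin z) = parity_seq (itin w)"
      unfolding z_def by (rule parity_itin_add_int)
    then have "itin z n = s n" for n
      using s z by (intro itin_eqI code_transition) (auto simp: z_def step simp del: of_int_diff)
    then have "itin z = s" by blast
    moreover have "cproj 1 w = cproj 1 z" unfolding cproj_1_eq_iff z_def by blast
    ultimately show ?thesis using z s(1) w(2) unfolding Z'_def by auto
  qed
  have Z'_Z: "cproj 1 z \<in> Z" if z: "z \<in> Z'" for z
  proof -
    have "parity_seq (itin z) \<in> itinerary g xm zmax zmin ` Z" using z unfolding it Z'_def by blast
    then obtain A where A: "A \<in> Z" "itinerary g xm zmax zmin A = parity_seq (itin z)" by force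
    then obtain w where w: "w \<in> Lam" "A = cproj 1 w" using Z unfolding Lambda_def by blast
    then have "cproj 1 w = cproj 1 z"
      using A z itinerary_eq[OF w(1)] unfolding Z'_def by (intro parity_itin_eq) auto
    then show ?thesis using A w by simp
  qed
  have img: "cproj 1 ` Z' = Z" using Z_lift Z'_Z by blast
  have gt_Z': "gt z \<in> Z'" if "z \<in> Z'" for z
  proof -
    have "itin (gt z) = (\<lambda>n. itin z (Suc n))" by (simp add: itin_Suc)
    then show ?thesis using that code_set_shift Lam_gt unfolding Z'_def by auto
  qed
  have inv: "invariant_set g Z"
    unfolding invariant_set_def img[symmetric] using gt_Z' by (auto simp: g_cproj simp del: One_nat_def)
  have trans: "z + of_int m * real k \<in> Z'" if "z \<in> Z'" for z and m :: int
  proof -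
    have eq: "z + of_int m * real k = z + of_int (m * int k)" by simp
    have "itin (z + of_int m * real k) = (\<lambda>n. itin z n + 2 * int k * m)"
      unfolding eq itin_add_int by (simp add: ac_simps)
    moreover have "z + of_int m * real k \<in> Lam" unfolding eq Lam_add_int using that unfolding Z'_def by blast
    ultimately show ?thesis using that code_set_translate unfolding Z'_def by auto
  qed
  have "recurrent_mod 1 gt z" if z: "z \<in> Z'" for z
    unfolding recurrent_mod_def
  proof (intro allI impI)
    fix e :: real and N :: nat assume e: "e > 0"
    obtain M where M: "\<And>x y. x \<in> Lam \<Longrightarrow> y \<in> Lam \<Longrightarrow> (\<forall>n<M. itin x n = itin y n) \<Longrightarrow> \<bar>x - y\<bar> < e"
      using itin_close[OF e] by blast
    have zL: "z \<in> Lam" "itin z \<in> code_set ell \<omega>" using z unfolding Z'_def by auto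
    obtain n m where nm: "n \<ge> N" "\<And>i. i < M \<Longrightarrow> itin z (i + n) - 2 * int k * m = itin z i"
      using code_recurrent[OF zL(2), of N M] by blast
    define w where "w = (gt ^^ n) z + of_int (- m * int k)"
    have "w \<in> Lam" unfolding w_def Lam_add_int by (rule Lam_funpow[OF zL(1)])
    moreover have "itin w i = itin z i" if "i < M" for i
      using nm(2)[OF that] unfolding w_def itin_add_int itin_funpow by (simp add: ac_simps)
    ultimately have "\<bar>w - z\<bar> < e" using M zL(1) by blast
    then have "\<bar>(gt ^^ n) z - z - of_int (m * int k) * 1\<bar> < e" unfolding w_def by (simp add: algebra_simps)
    then show "\<exists>n\<ge>N. \<exists>m::int. \<bar>(gt ^^ n) z - z - of_int m * 1\<bar> < e" using nm(1) by blast
  qed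
  then have "recurrent_set (circ_top 1) g Z"
    unfolding recurrent_set_def using inv
    by (auto simp: img[symmetric] recurrent_pt_g_iff simp del: One_nat_def)
  moreover have "kfsm_lift k gt Z'"
  proof (rule kfsm_liftI[OF gt_Z' trans])
    fix x y assume xy: "x \<in> Z'" "y \<in> Z'" "x < y"
    then have L: "x \<in> Lam" "y \<in> Lam" unfolding Z'_def by auto
    show "gt x \<le> gt y"
    proof (cases "\<forall>n. itin x n \<le> itin y n")
      case True
      then show ?thesis using L by (intro itin_le_imp_le Lam_gt) (simp_all add: itin_Suc[symmetric])
    next
      case False
      then have "\<forall>n. itin y n \<le> itin x n" using code_set_total xy unfolding Z'_def by blast
      then have "y \<le> x" using L by (intro itin_le_imp_le) auto
      then show ?thesis using xy(3) by simp
    qed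
  qed
  ultimately show ?thesis unfolding kfsm_def using inv img by blast
qed

end

section \<open>Interpolated maps\<close>

text \<open>If each \<open>a\<close> failed for its own tolerance and time, the smallest of these
  tolerances with the largest of these times would leave no \<open>a\<close> at all. It fixes a
  residue class independently of how good or how late a return is asked for.\<close>

lemma frequently_pigeonhole:
  fixes Q :: "'a \<Rightarrow> real \<Rightarrow> nat \<Rightarrow> bool"
  assumes "finite I" and ex: "\<And>e N. e > 0 \<Longrightarrow> \<exists>a\<in>I. Q a e N"
    and anti: "\<And>a e N e' N'. Q a e N \<Longrightarrow> e \<le> e' \<Longrightarrow> N' \<le> N \<Longrightarrow> Q a e' N'"
  shows "\<exists>a\<in>I. \<forall>e>0. \<forall>N. Q a e N"
proof (rule ccontr)
  assume "\<not> ?thesis"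
  then have "\<forall>a. \<exists>e N. a \<in> I \<longrightarrow> e > 0 \<and> \<not> Q a e N" by blast
  then obtain e N where eN: "\<And>a. a \<in> I \<Longrightarrow> e a > 0" "\<And>a. a \<in> I \<Longrightarrow> \<not> Q a (e a) (N a)" by metis
  have ne: "I \<noteq> {}" using ex[of 1 0] by auto
  have "Min (e ` I) > 0" using eN(1) assms(1) ne by (subst Min_gr_iff) auto
  then obtain a where a: "a \<in> I" "Q a (Min (e ` I)) (Max (N ` I))" using ex by blast
  then have "Q a (e a) (N a)" using assms(1) by (intro anti[OF a(2)]) auto
  then show False using eN(2) a(1) by blast
qed

text \<open>Recurrence lifts to finite cyclic covers: the integers \<open>a\<close> for which the orbit of \<open>x\<close> returns
  close to \<open>x + a\<close> modulo \<open>k\<close> form a nonempty set closed under addition, which therefore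
  contains a multiple of \<open>k\<close>.\<close>

lemma recurrent_mod_cover:
  assumes cont: "\<And>n. continuous_on UNIV (F ^^ n)"
    and shift: "\<And>n x m. (F ^^ n) (x + of_int m) = (F ^^ n) x + of_int m"
    and rec: "recurrent_mod 1 F x" and k: "k \<ge> 1"
  shows "recurrent_mod (real k) F x"
proof -
  define R where "R a \<longleftrightarrow> (\<forall>e>0. \<forall>N. \<exists>n\<ge>N. \<exists>m::int. \<bar>(F ^^ n) x - x - of_int (a + m * int k)\<bar> < e)" for a
  have "\<exists>a\<in>{0..<int k}. R a"
    unfolding R_def
  proof (rule frequently_pigeonhole)
    fix e :: real and N :: nat assume "e > 0"
    then obtain n m where nm: "n \<ge> N" "\<bar>(F ^^ n) x - x - of_int m * 1\<bar> < e"
      using rec unfolding recurrent_mod_def by blast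
    moreover have "m mod int k + m div int k * int k = m" by simp
    ultimately have "\<exists>m'. \<bar>(F ^^ n) x - x - of_int (m mod int k + m' * int k)\<bar> < e"
      by (metis mult.right_neutral)
    then show "\<exists>a\<in>{0..<int k}. \<exists>n\<ge>N. \<exists>m. \<bar>(F ^^ n) x - x - of_int (a + m * int k)\<bar> < e"
      using nm(1) k by (intro bexI[of _ "m mod int k"]) auto
  qed (simp, meson le_trans less_le_trans)
  then obtain a where a: "R a" by blast
  have add: "R (b + c)" if b: "R b" and c: "R c" for b c
    unfolding R_def
  proof (intro allI impI)
    fix e :: real and N :: nat assume e: "e > 0"
    then have e2: "e / 2 > 0" by simp
    obtain n1 m1 where n1: "\<bar>(F ^^ n1) x - x - of_int (b + m1 * int k)\<bar> < e / 2"
      using b[unfolded R_def, rule_format, OF e2] by blast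
    \<comment> \<open>The order of choices matters: the modulus \<open>d\<close> depends on the
      already fixed time \<open>n1\<close>, and the second return is then taken within
      \<open>d\<close>, at an arbitrarily late time.\<close>
    have "isCont (F ^^ n1) x" using cont[of n1] by (simp add: continuous_on_eq_continuous_at)
    then obtain d where d: "d > 0" "\<And>y. \<bar>y - x\<bar> < d \<Longrightarrow> \<bar>(F ^^ n1) y - (F ^^ n1) x\<bar> < e / 2"
      using e2 unfolding continuous_at_eps_delta dist_real_def by metis
    obtain n2 m2 where n2: "n2 \<ge> N" "\<bar>(F ^^ n2) x - x - of_int (c + m2 * int k)\<bar> < d"
      using c[unfolded R_def, rule_format, OF d(1)] by blast
    define y where "y = (F ^^ n2) x + of_int (- (c + m2 * int k))"
    have "\<bar>y - x\<bar> < d" using n2(2) unfolding y_def by simp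
    then have "\<bar>(F ^^ n1) y - (F ^^ n1) x\<bar> < e / 2" by (rule d(2))
    then have "\<bar>(F ^^ (n1 + n2)) x - of_int (c + m2 * int k) - (F ^^ n1) x\<bar> < e / 2"
      unfolding y_def shift by (simp add: funpow_add algebra_simps)
    moreover have "of_int (b + c + (m1 + m2) * int k) =
        (of_int (b + m1 * int k) + of_int (c + m2 * int k) :: real)" by (simp add: algebra_simps)
    ultimately have "\<bar>(F ^^ (n1 + n2)) x - x - of_int (b + c + (m1 + m2) * int k)\<bar> < e"
      using n1 by linarith
    then show "\<exists>n\<ge>N. \<exists>m::int. \<bar>(F ^^ n) x - x - of_int (b + c + m * int k)\<bar> < e"
      using n2(1) trans_le_add2 by blast
  qed
  have mult: "R (int (Suc i) * a)" for i
  proof (induction i)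
    case (Suc i)
    have "int (Suc (Suc i)) * a = int (Suc i) * a + a" by (simp add: algebra_simps)
    then show ?case using add[OF Suc a] by metis
  qed (use a in simp)
  have "R (int k * a)" using mult[of "k - 1"] k by simp
  then have Rk: "\<exists>n\<ge>N. \<exists>m::int. \<bar>(F ^^ n) x - x - of_int (int k * a + m * int k)\<bar> < e" if "e > 0" for e N
    unfolding R_def using that by blast
  show ?thesis
    unfolding recurrent_mod_def
  proof (intro allI impI)
    fix e :: real and N :: nat assume "e > 0"
    then obtain n m where nm: "n \<ge> N" "\<bar>(F ^^ n) x - x - of_int (int k * a + m * int k)\<bar> < e"
      using Rk by blast
    have "of_int (int k * a + m * int k) = (of_int (a + m) * real k :: real)" by (simp add: algebra_simps)
    then show "\<exists>n\<ge>N. \<exists>m::int. \<bar>(F ^^ n) x - x - of_int m * real k\<bar> < e" using nm by metis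
  qed
qed

lemma recurrent_mod_1_if_cover: "recurrent_mod (real k) F x \<Longrightarrow> recurrent_mod 1 F x"
  unfolding recurrent_mod_def by (metis mult.right_neutral of_int_mult of_int_of_nat_eq)

lemma kfsm_lift_translate:
  assumes "kfsm_lift k gt Z'" "z \<in> Z'"
  shows "z + of_int m * real k \<in> Z'"
proof -
  have img: "(\<lambda>x. x + real k) ` Z' = Z'" using assms(1) unfolding kfsm_lift_def by blast
  have up: "x + real k \<in> Z'" if "x \<in> Z'" for x
    using imageI[OF that, of "\<lambda>x. x + real k"] unfolding img .
  have down: "x - real k \<in> Z'" if x: "x \<in> Z'" for x
  proof -
    have "x \<in> (\<lambda>x. x + real k) ` Z'" unfolding img by (rule x)
    then show ?thesis by auto
  qed
  have nat: "z + real n * real k \<in> Z' \<and> z - real n * real k \<in> Z'" for n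
  proof (induction n)
    case (Suc n)
    then show ?case using up[of "z + real n * real k"] down[of "z - real n * real k"]
      by (simp add: algebra_simps)
  qed (use assms(2) in simp)
  show ?thesis using nat[of "nat m"] nat[of "nat (- m)"] by (cases "m \<ge> 0") auto
qed

context circle_map
begin

lemma recurrent_lift:
  assumes "recurrent_pt (circ_top 1) g (cproj 1 x)" "k \<ge> 1"
  shows "recurrent_mod (real k) gt x"
  using recurrent_mod_cover[OF continuous_funpow funpow_add_int _ assms(2)] assms(1)
  unfolding recurrent_pt_g_iff by blast

text \<open>A kfsm lift may fail to be closed. Its closure still projects onto \<open>Z\<close>,
  because \<open>Z\<close> has a closed preimage, and monotonicity passes to limits: approximants of
  \<open>x < y\<close> are eventually in strict order.\<close>

lemma closed_lift_exists:
  assumes kf: "kfsm k g gt Z" and Z: "compactin (circ_top 1) Z"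
  shows "\<exists>Z'. closed Z' \<and> kfsm_lift k gt Z' \<and> cproj 1 ` Z' = Z"
proof -
  obtain Y where Y: "kfsm_lift k gt Y" "cproj 1 ` Y = Z" using kf unfolding kfsm_def by blast
  have gtY: "\<And>y. y \<in> Y \<Longrightarrow> gt y \<in> Y" and monoY: "\<And>x y. x \<in> Y \<Longrightarrow> y \<in> Y \<Longrightarrow> x < y \<Longrightarrow> gt x \<le> gt y"
    using Y(1) unfolding kfsm_lift_def invariant_set_def by auto
  have cl: "closed (cproj 1 -` Z)" using closed_vimage_cproj[OF Z] by simp
  have "closure Y \<subseteq> cproj 1 -` Z" by (rule closure_minimal[OF _ cl]) (use Y(2) in blast)
  then have img: "cproj 1 ` closure Y = Z" using closure_subset[of Y] Y(2) by blast
  have seq: "\<exists>u. (\<forall>n. u n \<in> Y) \<and> u \<longlonglongrightarrow> x" if "x \<in> closure Y" for x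
    using that unfolding closure_sequential .
  have lim_gt: "(\<lambda>n. gt (u n)) \<longlonglongrightarrow> gt x" if "u \<longlonglongrightarrow> x" for u :: "nat \<Rightarrow> real" and x
    using cont by (intro isCont_tendsto_compose[where g = gt, OF _ that]) (simp add: continuous_on_eq_continuous_at)
  have "kfsm_lift k gt (closure Y)"
  proof (rule kfsm_liftI)
    fix x assume "x \<in> closure Y"
    then obtain u where "\<forall>n. u n \<in> Y" "u \<longlonglongrightarrow> x" using seq by blast
    then show "gt x \<in> closure Y"
      using gtY lim_gt unfolding closure_sequential by (intro exI[of _ "\<lambda>n. gt (u n)"]) auto
  next
    fix x and m :: int assume "x \<in> closure Y"
    then obtain u where "\<forall>n. u n \<in> Y" "u \<longlonglongrightarrow> x" using seq by blast
    then show "x + of_int m * real k \<in> closure Y"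
      unfolding closure_sequential using kfsm_lift_translate[OF Y(1)]
      by (intro exI[of _ "\<lambda>n. u n + of_int m * real k"]) (auto intro!: tendsto_intros)
  next
    fix x y assume xy: "x \<in> closure Y" "y \<in> closure Y" "x < y"
    obtain u where u: "\<forall>n. u n \<in> Y" "u \<longlonglongrightarrow> x" using seq[OF xy(1)] by blast
    obtain v where v: "\<forall>n. v n \<in> Y" "v \<longlonglongrightarrow> y" using seq[OF xy(2)] by blast
    have "eventually (\<lambda>n. v n - u n > 0) sequentially"
      using order_tendstoD(1)[OF tendsto_diff[OF v(2) u(2)], of 0] xy(3) by simp
    then have "eventually (\<lambda>n. gt (u n) \<le> gt (v n)) sequentially"
      by (rule eventually_mono) (use monoY u(1) v(1) in simp)
    then show "gt x \<le> gt y"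
      by (rule tendsto_le[OF sequentially_bot lim_gt[OF v(2)] lim_gt[OF u(2)]])
  qed
  then show ?thesis using img by (intro exI[of _ "closure Y"]) auto
qed

section \<open>The bounds of the admissible heights\<close>

lemma gt_0_less: "gt 0 < xm"
  using expand[of 0 zmax] zmax by simp

lemma parity_seq_eqI:
  assumes "\<And>n. even (s n) \<longleftrightarrow> even (t n)"
  shows "parity_seq s = parity_seq t"
proof
  fix n
  have "s n mod 2 = t n mod 2" using assms[of n] by presburger
  then show "parity_seq s n = parity_seq t n" by (simp add: parity_seq_def)
qed

lemma Lam_even: "x \<in> Lam \<Longrightarrow> even (symb x) \<Longrightarrow> x \<le> of_int \<lfloor>x\<rfloor> + zmax \<and> symb x = 2 * \<lfloor>x\<rfloor>"
  by (erule Lam_cases) simp_all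

lemma Lam_odd: "x \<in> Lam \<Longrightarrow> odd (symb x) \<Longrightarrow> of_int \<lfloor>x\<rfloor> + zmin \<le> x \<and> symb x = 2 * \<lfloor>x\<rfloor> + 1"
  by (erule Lam_cases) simp_all

text \<open>If only odd symbols occur, a translate of any point is fixed by \<open>gt - 1\<close>.
  Expansion and \<open>gt xm \<le> xm + 1\<close> force this fixed point to be \<open>xm\<close>,
  and its preimage \<open>zmax\<close> then lies in \<open>Lam\<close>. Hence the minimum defining
  \<open>L_val\<close> exists.\<close>

lemma Lam_meets_low:
  assumes "Lam \<noteq> {}"
  shows "\<exists>x\<in>Lam. 0 \<le> x \<and> x \<le> zmax"
proof (cases "\<exists>x\<in>Lam. even (symb x)")
  case True
  then obtain x where x: "x \<in> Lam" "even (symb x)" by blast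
  have "x \<le> of_int \<lfloor>x\<rfloor> + zmax" using Lam_even[OF x] by simp
  moreover have "x + of_int (- \<lfloor>x\<rfloor>) \<in> Lam" unfolding Lam_add_int by (rule x(1))
  ultimately show ?thesis by (intro bexI[of _ "x + of_int (- \<lfloor>x\<rfloor>)"]) auto
next
  case False
  obtain x0 where "x0 \<in> Lam" using assms by blast
  define x where "x = x0 + of_int (- \<lfloor>x0\<rfloor>)"
  have x: "x \<in> Lam" unfolding x_def Lam_add_int by fact
  have fl: "\<lfloor>x\<rfloor> = 0" by (simp add: x_def)
  have odd: "odd (itin x n)" for n using False Lam_funpow[OF x] unfolding itin_def by blast
  have gx: "gt x + of_int (- 1) \<in> Lam" unfolding Lam_add_int by (rule Lam_gt[OF x])
  have "gt x + of_int (- 1) = x"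
  proof (rule itin_eq_if_parity[OF gx x])
    show "parity_seq (itin (gt x + of_int (- 1))) = parity_seq (itin x)"
    proof (rule parity_seq_eqI)
      fix n
      have "itin (gt x + of_int (- 1)) n = itin x (Suc n) - 2" unfolding itin_add_int itin_Suc by simp
      then show "even (itin (gt x + of_int (- 1)) n) \<longleftrightarrow> even (itin x n)"
        using odd[of n] odd[of "Suc n"] by simp
    qed
    have "symb x = 1" using Lam_odd[OF x] odd[of 0] fl unfolding itin_0 by simp
    then show "\<lfloor>gt x + of_int (- 1)\<rfloor> = \<lfloor>x\<rfloor>" using floor_gt[OF x] fl by simp
  qed
  then have "x = xm"
    using expand[of x xm] gt_xm LamD[OF x] fl floor_eq_iff[of x 0] by (cases "x = xm") auto
  then have "zmax \<in> Lam" using Lam_if_image[of 0 zmax] x zmax by simp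
  then show ?thesis using zmax by (intro bexI[of _ zmax]) simp_all
qed

text \<open>The mirror case: with only even symbols the fixed point must be 0, so 1 lies in
  \<open>Lam\<close>, and its preimage \<open>zmin\<close> supplies the required point.\<close>

lemma Lam_meets_high:
  assumes "Lam \<noteq> {}"
  shows "\<exists>x\<in>Lam. zmin - 1 \<le> x \<and> x \<le> xm - 1"
proof (cases "\<exists>x\<in>Lam. odd (symb x)")
  case True
  then obtain x where x: "x \<in> Lam" "odd (symb x)" by blast
  have "of_int \<lfloor>x\<rfloor> + zmin \<le> x" using Lam_odd[OF x] by simp
  moreover have "x + of_int (- \<lfloor>x\<rfloor> - 1) \<in> Lam" unfolding Lam_add_int by (rule x(1))
  ultimately show ?thesis using LamD[OF x(1)] by (intro bexI[of _ "x + of_int (- \<lfloor>x\<rfloor> - 1)"]) auto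
next
  case False
  obtain x0 where "x0 \<in> Lam" using assms by blast
  define x where "x = x0 + of_int (- \<lfloor>x0\<rfloor>)"
  have x: "x \<in> Lam" unfolding x_def Lam_add_int by fact
  have fl: "\<lfloor>x\<rfloor> = 0" by (simp add: x_def)
  have even: "even (itin x n)" for n using False Lam_funpow[OF x] unfolding itin_def by blast
  have "gt x = x"
  proof (rule itin_eq_if_parity[OF Lam_gt[OF x] x])
    show "parity_seq (itin (gt x)) = parity_seq (itin x)"
      using even even[of "Suc _"] unfolding itin_Suc by (intro parity_seq_eqI) simp
    have "symb x = 0" using Lam_even[OF x] even[of 0] fl unfolding itin_0 by simp
    then show "\<lfloor>gt x\<rfloor> = \<lfloor>x\<rfloor>" using floor_gt[OF x] fl by simp
  qed
  then have "x = 0"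
    using expand[of 0 x] gt_0 LamD[OF x] fl floor_eq_iff[of x 0] by (cases "x = 0") auto
  then have "0 + of_int 1 \<in> Lam" using x unfolding Lam_add_int by simp
  then have "zmin \<in> Lam" using Lam_if_image[of 0 zmin] zmin by simp
  from Lam_add_int_imp[OF this, of "- 1"] show ?thesis using zmin by force
qed

text \<open>The minimum is attained by compactness. In the third claim branch \<open>j\<close> is
  compared with that minimum; on later branches \<open>gt x \<ge> x \<ge> j + 1\<close> is enough
  because \<open>L_val\<close> is below 1.\<close>

lemma L_val_props:
  assumes "Lam \<noteq> {}"
  shows "gt 0 \<le> L_val gt xm zmax zmin" "L_val gt xm zmax zmin < 1"
    and "\<And>x j. x \<in> Lam \<Longrightarrow> of_int j \<le> x \<Longrightarrow> L_val gt xm zmax zmin + of_int j \<le> gt x"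
proof -
  have A: "address xm zmax zmin 0 = {0..zmax}" by (simp add: address_def)
  have "compact (Lam \<inter> {0..zmax})" using closed_Lam by (simp add: closed_Int_compact)
  moreover have "Lam \<inter> {0..zmax} \<noteq> {}" using Lam_meets_low[OF assms] by auto
  ultimately obtain a where a: "a \<in> Lam \<inter> {0..zmax}" "\<forall>x\<in>Lam \<inter> {0..zmax}. a \<le> x"
    using compact_attains_inf by blast
  have "(LEAST x. x \<in> Lam \<inter> address xm zmax zmin 0) = a"
    unfolding A by (rule Least_equality) (use a in auto)
  then have L: "L_val gt xm zmax zmin = gt a" unfolding L_val_def by simp
  show "gt 0 \<le> L_val gt xm zmax zmin"
    unfolding L using branch_mono_le[of 0 0 a] a(1) zmax by simp
  have "gt a \<le> gt zmax" using branch_mono_le[of 0 a zmax] a(1) zmax by simp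
  then show L1: "L_val gt xm zmax zmin < 1" unfolding L using zmax xm by simp
  fix x :: real and j :: int assume x: "x \<in> Lam" "of_int j \<le> x"
  show "L_val gt xm zmax zmin + of_int j \<le> gt x"
  proof (cases "\<lfloor>x\<rfloor> = j")
    case True
    define y where "y = x + of_int (- j)"
    have y: "y \<in> Lam" unfolding y_def Lam_add_int by (rule x(1))
    have yb: "0 \<le> y" "y \<le> xm" using x LamD[OF x(1)] True by (auto simp: y_def)
    have "a \<le> y" using a yb(1) zmax
      by (cases "y \<le> zmax") (use y in auto)
    then have "gt a \<le> gt y" using branch_mono_le[of 0 a y] a(1) yb by simp
    then show ?thesis unfolding L y_def gt_add_int by simp
  next
    case False
    then have "j + 1 \<le> \<lfloor>x\<rfloor>" using x(2) le_floor_iff[of j x] by linarith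
    then have "of_int j + 1 \<le> x" by linarith
    then show ?thesis using displacement(1)[OF x(1)] L1 by simp
  qed
qed

text \<open>Beyond the neighbouring branch the bound comes from \<open>gt x \<le> x + 1\<close> and
  from the value at the maximum being nonnegative.\<close>

lemma U_val_props:
  assumes "Lam \<noteq> {}"
  shows "U_val gt xm zmax zmin \<le> gt xm - 1"
    and "\<And>x j. x \<in> Lam \<Longrightarrow> x < of_int j \<Longrightarrow> gt x \<le> U_val gt xm zmax zmin + of_int j"
proof -
  have A: "address xm zmax zmin (- 1) = {zmin - 1..xm - 1}" by (simp add: address_def)
  have "compact (Lam \<inter> {zmin - 1..xm - 1})" using closed_Lam by (simp add: closed_Int_compact)
  moreover have "Lam \<inter> {zmin - 1..xm - 1} \<noteq> {}" using Lam_meets_high[OF assms] by auto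
  ultimately obtain b where b: "b \<in> Lam \<inter> {zmin - 1..xm - 1}" "\<forall>x\<in>Lam \<inter> {zmin - 1..xm - 1}. x \<le> b"
    using compact_attains_sup by blast
  have "(GREATEST x. x \<in> Lam \<inter> address xm zmax zmin (- 1)) = b"
    unfolding A by (rule Greatest_equality) (use b in auto)
  then have U: "U_val gt xm zmax zmin = gt b" unfolding U_val_def by simp
  have g1: "gt (xm - 1) = gt xm - 1" "gt (zmin - 1) = 0"
    using gt_add_int[of xm "- 1"] gt_add_int[of zmin "- 1"] zmin by simp_all
  show "U_val gt xm zmax zmin \<le> gt xm - 1"
    unfolding U using branch_mono_le[of "- 1" b "xm - 1"] b(1) zmin g1 by simp
  have U0: "0 \<le> gt b" using branch_mono_le[of "- 1" "zmin - 1" b] b(1) zmin g1 by simp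
  fix x :: real and j :: int assume x: "x \<in> Lam" "x < of_int j"
  show "gt x \<le> U_val gt xm zmax zmin + of_int j"
  proof (cases "\<lfloor>x\<rfloor> = j - 1")
    case True
    define y where "y = x + of_int (- j)"
    have y: "y \<in> Lam" unfolding y_def Lam_add_int by (rule x(1))
    have "of_int (j - 1) \<le> x" using True by linarith
    then have yb: "- 1 \<le> y" "y \<le> xm - 1" using LamD[OF x(1)] True by (auto simp: y_def)
    have "y \<le> b" using b yb(2) zmin
      by (cases "zmin - 1 \<le> y") (use y in auto)
    then have "gt y \<le> gt b" using branch_mono_le[of "- 1" y b] b(1) yb by simp
    then show ?thesis unfolding U y_def gt_add_int by simp
  next
    case False
    then have "\<lfloor>x\<rfloor> < j - 1" using x(2) by linarith
    then have "x < of_int j - 1" by (simp add: floor_less_iff)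
    then show ?thesis unfolding U using displacement(2)[OF x(1)] U0 by simp
  qed
qed

lemma branch_inv_props:
  assumes "gt 0 + of_int n \<le> y" "y \<le> gt xm + of_int n"
  shows "of_int n \<le> branch_inv gt xm n y" "branch_inv gt xm n y \<le> of_int n + xm"
    "gt (branch_inv gt xm n y) = y"
proof -
  have "gt (of_int n) \<le> y" "y \<le> gt (xm + of_int n)"
    using assms gt_add_int[of 0 n] gt_add_int[of xm n] by simp_all
  moreover have "continuous_on {of_int n..xm + of_int n} gt" using cont continuous_on_subset by blast
  ultimately obtain x where x: "of_int n \<le> x" "x \<le> xm + of_int n" "gt x = y"
    using IVT'[of gt "of_int n" y "xm + of_int n"] zmax by auto
  have uniq: "x' = x" if "x' \<in> {of_int n..xm + of_int n} \<and> gt x' = y" for x'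
    using that x branch_mono[of n x x'] branch_mono[of n x' x] by (cases x x' rule: linorder_cases) auto
  have "(THE x. x \<in> {of_int n..xm + of_int n} \<and> gt x = y) = x"
    using x by (intro the_equality uniq) auto
  then have "branch_inv gt xm n y = x"
    unfolding branch_inv_def .
  then show "of_int n \<le> branch_inv gt xm n y" "branch_inv gt xm n y \<le> of_int n + xm"
    "gt (branch_inv gt xm n y) = y" using x by auto
qed

end

section \<open>Flat spots and the set on which the interpolated map equals \<open>gt\<close>\<close>

locale interpolated_map = circle_map +
  fixes k :: nat and c :: "nat \<Rightarrow> real"
  assumes k: "k \<ge> 1" and Lam_nonempty: "Lambda_inf gt xm \<noteq> {}"
    and c_range: "j \<in> {1..k} \<Longrightarrow> c j \<in> {L_val gt xm zmax zmin..U_val gt xm zmax zmin}"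
begin

definition lo :: "nat \<Rightarrow> real" where
  "lo j = branch_inv gt xm (int j - 2) (c_shift c j)"

definition hi :: "nat \<Rightarrow> real" where
  "hi j = branch_inv gt xm (int j - 1) (c_shift c j)"

lemma flat_spot_eq: "flat_spot gt xm c j = {lo j..hi j}"
  by (simp add: flat_spot_def lo_def hi_def)

lemma c_bounds:
  assumes "j \<in> {1..k}"
  shows "gt 0 \<le> c j" "c j \<le> gt xm - 1"
  using c_range[OF assms] L_val_props(1)[OF Lam_nonempty] U_val_props(1)[OF Lam_nonempty] by auto

lemma lo_props:
  assumes "j \<in> {1..k}"
  shows "real j - 2 \<le> lo j" "lo j \<le> real j - 2 + xm" "gt (lo j) = c_shift c j"
  using branch_inv_props[of "int j - 2" "c_shift c j"] c_bounds[OF assms] gt_0_less xm gt_0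
  unfolding lo_def c_shift_def by auto

lemma hi_props:
  assumes "j \<in> {1..k}"
  shows "real j - 1 \<le> hi j" "hi j \<le> real j - 1 + xm" "gt (hi j) = c_shift c j"
  using branch_inv_props[of "int j - 1" "c_shift c j"] c_bounds[OF assms]
  unfolding hi_def c_shift_def by auto

text \<open>Otherwise \<open>lo j + 1 \<le> hi j\<close> on one branch, although \<open>gt\<close>
  at \<open>lo j + 1\<close> exceeds the common height by 1. Being shorter than the period, a flat
  spot embeds in \<open>S\<^sub>k\<close>.\<close>

lemma flat_spot_length:
  assumes "j \<in> {1..k}"
  shows "hi j - lo j < 1"
proof (rule ccontr)
  assume "\<not> hi j - lo j < 1"
  then have "gt (lo j + of_int 1) \<le> gt (hi j)"
    using lo_props[OF assms] hi_props[OF assms]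
    by (intro branch_mono_le[of "int j - 1"]) auto
  then show False using lo_props(3)[OF assms] hi_props(3)[OF assms] unfolding gt_add_int by simp
qed

lemma P_set_iff:
  "cproj k x \<in> P_set k gt xm c \<longleftrightarrow>
    (\<forall>m::int. \<forall>j\<in>{1..k}. \<not> (lo j < x - of_int m * real k \<and> x - of_int m * real k < hi j))"
proof -
  have "cproj k x \<in> circ_top k interior_of (cproj k ` {lo j..hi j}) \<longleftrightarrow>
    (\<exists>m::int. lo j < x - of_int m * real k \<and> x - of_int m * real k < hi j)" (is "?L \<longleftrightarrow> ?R")
    if j: "j \<in> {1..k}" for j
  proof
    assume ?R
    then obtain m :: int where m: "lo j < x - of_int m * real k" "x - of_int m * real k < hi j" by blast
    define y where "y = x - of_int m * real k"
    have "cproj k y \<in> circ_top k interior_of (cproj k ` {lo j..hi j})"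
      unfolding mem_interior_of_cproj_image
      using m by (intro exI[of _ "min (y - lo j) (hi j - y)"]) (auto simp: y_def intro!: imageI)
    moreover have "cproj k x = cproj k y" using cproj_shift[of k y m] by (simp add: y_def)
    ultimately show ?L by simp
  next
    assume ?L
    then obtain e where e: "e > 0" "\<And>y. \<bar>y - x\<bar> < e \<Longrightarrow> cproj k y \<in> cproj k ` {lo j..hi j}"
      unfolding mem_interior_of_cproj_image by blast
    have near: "\<exists>m::int. lo j \<le> y - of_int m * real k \<and> y - of_int m * real k \<le> hi j"
      if y: "\<bar>y - x\<bar> < e" for y
    proof -
      obtain w where w: "lo j \<le> w" "w \<le> hi j" "cproj k w = cproj k y" using e(2)[OF y] by auto
      then obtain m :: int where "y = w + of_int m * real k" unfolding cproj_eq_iff by blast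
      then show ?thesis using w by (intro exI[of _ m]) simp
    qed
    obtain m :: int where m: "lo j \<le> x - of_int m * real k" "x - of_int m * real k \<le> hi j"
      using near[of x] e(1) by auto
    \<comment> \<open>Translates of the flat spot are separated by gaps of at least
      \<open>1 - (hi j - lo j)\<close>. Within distance \<open>t\<close> of \<open>x\<close> all
      points therefore lie in the same translate, which puts \<open>x\<close> strictly inside
      it.\<close>
    define t where "t = min e (1 - (hi j - lo j)) / 2"
    have t: "t > 0" "t < e" "t < 1 - (hi j - lo j)"
      using e(1) flat_spot_length[OF j] by (auto simp: t_def min_def)
    have inside: "lo j \<le> y - of_int m * real k \<and> y - of_int m * real k \<le> hi j" if y: "\<bar>y - x\<bar> \<le> t" for y
    proof -
      obtain m' :: int where m': "lo j \<le> y - of_int m' * real k" "y - of_int m' * real k \<le> hi j"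
        using near[of y] y t(2) by auto
      have "of_int (m' - m) * real k = (x - of_int m * real k) - (y - of_int m' * real k) + (y - x)"
        by (simp add: algebra_simps)
      then have "\<bar>of_int (m' - m) * real k\<bar> < 1" using m m' y t(3) by linarith
      moreover have "\<bar>real_of_int (m' - m)\<bar> * 1 \<le> \<bar>real_of_int (m' - m)\<bar> * real k"
        using k by (intro mult_left_mono) auto
      ultimately have "\<bar>real_of_int (m' - m)\<bar> * 1 < 1"
        unfolding abs_mult abs_of_nat by (rule le_less_trans[rotated])
      then have "m' = m" unfolding mult_1_right by linarith
      then show ?thesis using m' by simp
    qed
    show ?R using inside[of "x - t"] inside[of "x + t"] t(1) by (intro exI[of _ m]) auto
  qed
  then show ?thesis unfolding P_set_def flat_spot_eq by auto
qed

text \<open>A point of \<open>P_set\<close> can meet a flat spot only at an end point, where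
  \<open>gt\<close> takes the height of the spot.\<close>

lemma H_lift_eq:
  assumes "cproj k x \<in> P_set k gt xm c"
  shows "H_lift k gt xm c x = gt x"
proof -
  have end_pt: "gt x = c_shift c j + of_int m * real k"
    if "j \<in> {1..k}" "x - of_int m * real k \<in> flat_spot gt xm c j" for j and m :: int
  proof -
    have "\<not> (lo j < x - of_int m * real k \<and> x - of_int m * real k < hi j)"
      using assms that(1) unfolding P_set_iff by blast
    then have "x - of_int m * real k = lo j \<or> x - of_int m * real k = hi j"
      using that(2) unfolding flat_spot_eq by auto
    then have "gt (x - of_int m * real k) = c_shift c j"
      using lo_props(3)[OF that(1)] hi_props(3)[OF that(1)] by auto
    then show ?thesis using gt_add_int[of "x - of_int m * real k" "m * int k"] by simp
  qed
  show ?thesis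
  proof (cases "\<exists>m::int. \<exists>j\<in>{1..k}. x - of_int m * real k \<in> flat_spot gt xm c j")
    case True
    then have "(THE y. \<exists>m::int. \<exists>j\<in>{1..k}. x - of_int m * real k \<in> flat_spot gt xm c j \<and>
        y = c_shift c j + of_int m * real k) = gt x"
      using end_pt by (intro the_equality) (blast, metis)
    then show ?thesis using True unfolding H_lift_def by simp
  qed (simp add: H_lift_def)
qed

lemma H_map_cproj:
  assumes "cproj k x \<in> P_set k gt xm c"
  shows "H_map k gt xm c (cproj k x) = cproj k (gt x)"
proof -
  have "induced k (H_lift k gt xm c) (cproj k x) = cproj k (H_lift k gt xm c x)"
  proof (rule induced_cproj)
    fix y assume y: "cproj k y = cproj k x"
    then obtain m :: int where "x = y + of_int m * real k" unfolding cproj_eq_iff by blast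
    then have "gt x = gt y + of_int m * real k" using gt_add_int[of y "m * int k"] by simp
    then have "cproj k (gt y) = cproj k (gt x)" by simp
    then show "cproj k (H_lift k gt xm c y) = cproj k (H_lift k gt xm c x)"
      using H_lift_eq assms y by simp
  qed
  then show ?thesis unfolding H_map_def using H_lift_eq[OF assms] by simp
qed

lemma H_map_funpow:
  assumes inv: "invariant_set (H_map k gt xm c) Zs" and P: "Zs \<subseteq> P_set k gt xm c" and x: "cproj k x \<in> Zs"
  shows "cproj k ((gt ^^ n) x) \<in> Zs \<and> (H_map k gt xm c ^^ n) (cproj k x) = cproj k ((gt ^^ n) x)"
proof (induction n)
  case (Suc n)
  then have "H_map k gt xm c (cproj k ((gt ^^ n) x)) = cproj k (gt ((gt ^^ n) x))"
    using P by (intro H_map_cproj) blast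
  moreover from this have "cproj k (gt ((gt ^^ n) x)) \<in> Zs"
    using Suc inv unfolding invariant_set_def by force
  ultimately show ?case using Suc by simp
qed (use x in simp)

text \<open>Outside the flat spots \<open>gt\<close> agrees with the monotone map \<open>H\<close>; a jump between consecutive
  branches is controlled by the value on the flat spot in between.\<close>

lemma gt_mono_on_P:
  assumes "cproj k x \<in> P_set k gt xm c" "cproj k y \<in> P_set k gt xm c" "x \<in> Lam" "y \<in> Lam" "x < y"
  shows "gt x \<le> gt y"
proof -
  define j where "j = \<lfloor>y\<rfloor>"
  have xb: "of_int \<lfloor>x\<rfloor> \<le> x" "x \<le> of_int \<lfloor>x\<rfloor> + xm" and yb: "of_int j \<le> y" "y \<le> of_int j + xm"
    using LamD[OF assms(3)] LamD[OF assms(4)] by (auto simp: j_def)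
  have "\<lfloor>x\<rfloor> \<le> j" unfolding j_def using assms(5) by (intro floor_mono) simp
  then consider "\<lfloor>x\<rfloor> = j" | "\<lfloor>x\<rfloor> < j - 1" | "\<lfloor>x\<rfloor> = j - 1" by linarith
  then show ?thesis
  proof cases
    case 1
    then show ?thesis using xb yb assms(5) by (intro branch_mono_le[of j]) auto
  next
    case 2
    \<comment> \<open>When a whole branch lies between the points, the displacement bounds alone
      give the order.\<close>
    then have "x + 1 < of_int j" by (simp add: floor_less_iff)
    then show ?thesis using displacement(2)[OF assms(3)] displacement(1)[OF assms(4)] yb by linarith
  next
    case 3
    \<comment> \<open>The branches \<open>j - 1\<close> and \<open>j\<close> are brought into the
      fundamental period: \<open>j = i - 1 + m * k\<close>, and flat spot number \<open>i\<close>
      bridges the branches \<open>i - 2\<close> and \<open>i - 1\<close>.\<close>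
    define i where "i = nat (j mod int k) + 1"
    define m where "m = j div int k"
    have i: "i \<in> {1..k}" using k by (auto simp: i_def Suc_le_eq nat_less_iff)
    have j: "real_of_int j = real i - 1 + of_int m * real k"
    proof -
      have "j = int i - 1 + m * int k" using k by (simp add: i_def m_def)
      then have "real_of_int j = real_of_int (int i - 1 + m * int k)" by simp
      then show ?thesis by simp
    qed
    define x' where "x' = x - of_int m * real k"
    define y' where "y' = y - of_int m * real k"
    have x': "real i - 2 \<le> x'" "x' \<le> real i - 2 + xm" using xb 3 j by (auto simp: x'_def)
    have y': "real i - 1 \<le> y'" "y' \<le> real i - 1 + xm" using yb j by (auto simp: y'_def)
    have gx: "gt x' + of_int m * real k = gt x" "gt y' + of_int m * real k = gt y"
      using gt_add_int[of x' "m * int k"] gt_add_int[of y' "m * int k"] by (simp_all add: x'_def y'_def)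
    have "x' \<le> lo i"
    proof (rule ccontr)
      assume "\<not> x' \<le> lo i"
      moreover have "x' < hi i" using hi_props(1)[OF i] x' xm by linarith
      ultimately show False using assms(1) i unfolding P_set_iff x'_def by force
    qed
    then have "gt x' \<le> c_shift c i"
      using branch_mono_le[of "int i - 2" x' "lo i"] lo_props[OF i] x' by simp
    moreover have "hi i \<le> y'"
    proof (rule ccontr)
      assume "\<not> hi i \<le> y'"
      moreover have "lo i < y'" using lo_props(2)[OF i] y' xm by linarith
      ultimately show False using assms(2) i unfolding P_set_iff y'_def by force
    qed
    then have "c_shift c i \<le> gt y'"
      using branch_mono_le[of "int i - 1" "hi i" y'] hi_props[OF i] y' by simp
    ultimately show ?thesis using gx by linarith
  qed
qed

end

lemma cover_proj_cproj: "cover_proj (cproj k x) = cproj 1 x"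
proof -
  have "cproj 1 y = cproj 1 x" if "y \<in> cproj k x" for y
  proof -
    have "cproj k x = cproj k y" using that unfolding mem_cproj_iff by simp
    then obtain m :: int where "y = x + of_int m * real k" unfolding cproj_eq_iff by blast
    then have "y = x + of_int (m * int k) * real 1" by simp
    then show ?thesis using cproj_shift by metis
  qed
  moreover have "cproj k x \<noteq> {}" using mem_cproj_iff[of x k x] by blast
  ultimately show ?thesis unfolding cover_proj_def by (intro SUP_eq_const)
qed

section \<open>Recurrent kfsm sets and interpolated maps\<close>

context circle_map
begin

theorem interpolated_imp_recurrent_kfsm:
  assumes ir: "interpolated_recurrent k gt xm zmax zmin Z" and k: "k \<ge> 1"
    and Z: "Z \<subseteq> Lambda 1 gt xm" "Z \<noteq> {}"
  shows "recurrent_set (circ_top 1) g Z \<and> kfsm k g gt Z"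
proof -
  obtain c Zs where c: "\<And>j. j \<in> {1..k} \<Longrightarrow> c j \<in> {L_val gt xm zmax zmin..U_val gt xm zmax zmin}"
    and Zs: "Zs \<subseteq> P_set k gt xm c" "cover_proj ` Zs = Z"
    and rec: "recurrent_set (circ_top k) (H_map k gt xm c) Zs"
    using ir unfolding interpolated_recurrent_def by blast
  have "Lam \<noteq> {}" using Z unfolding Lambda_def by auto
  then interpret interpolated_map gt xm zmax zmin g k c
    using k c by unfold_locales
  define Z' where "Z' = {x. cproj k x \<in> Zs}"
  have "Zs = cproj k ` Z'"
  proof
    show "Zs \<subseteq> cproj k ` Z'"
    proof
      fix A assume A: "A \<in> Zs"
      then have "A \<in> circ k" using Zs(1) unfolding P_set_def by blast
      then obtain x where "A = cproj k x" using range_cproj by blast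
      then show "A \<in> cproj k ` Z'" using A unfolding Z'_def by blast
    qed
  qed (auto simp: Z'_def)
  then have img: "cproj 1 ` Z' = Z" unfolding Zs(2)[symmetric] by (simp add: image_image cover_proj_cproj)
  have Lam: "x \<in> Lam" if "x \<in> Z'" for x
    using that img Z(1) cproj_in_Lambda_iff by blast
  have inv: "invariant_set (H_map k gt xm c) Zs" using rec unfolding recurrent_set_def by blast
  have gtZ': "gt x \<in> Z'" if "x \<in> Z'" for x
    using H_map_funpow[OF inv Zs(1), of x 1] that unfolding Z'_def by simp
  have "recurrent_mod 1 gt x" if x: "x \<in> Z'" for x
  proof -
    have "recurrent_pt (circ_top k) (H_map k gt xm c) (cproj k x)"
      using rec x unfolding recurrent_set_def Z'_def by blast
    then have "recurrent_mod (real k) gt x"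
      using recurrent_pt_cproj_iff[of "H_map k gt xm c" k x gt] H_map_funpow[OF inv Zs(1)] x
      unfolding Z'_def by blast
    then show ?thesis by (rule recurrent_mod_1_if_cover)
  qed
  moreover have invZ: "invariant_set g Z"
    unfolding invariant_set_def img[symmetric] using gtZ' by (auto simp: g_cproj simp del: One_nat_def)
  ultimately have "recurrent_set (circ_top 1) g Z"
    unfolding recurrent_set_def by (auto simp: img[symmetric] recurrent_pt_g_iff simp del: One_nat_def)
  moreover have "kfsm_lift k gt Z'"
  proof (rule kfsm_liftI[OF gtZ'])
    show "x + of_int m * real k \<in> Z'" if "x \<in> Z'" for x m using that by (simp add: Z'_def)
    fix x y assume "x \<in> Z'" "y \<in> Z'" "x < y"
    then show "gt x \<le> gt y" using Zs(1) Lam by (intro gt_mono_on_P) (auto simp: Z'_def)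
  qed
  ultimately show ?thesis unfolding kfsm_def using invZ img by blast
qed

theorem recurrent_kfsm_imp_interpolated:
  assumes rec: "recurrent_set (circ_top 1) g Z" and kf: "kfsm k g gt Z" and k: "k \<ge> 1"
    and Z: "Z \<subseteq> Lambda 1 gt xm" "Z \<noteq> {}" "compactin (circ_top 1) Z"
    and LU: "L_val gt xm zmax zmin \<le> U_val gt xm zmax zmin"
  shows "interpolated_recurrent k gt xm zmax zmin Z"
proof -
  let ?L = "L_val gt xm zmax zmin" and ?U = "U_val gt xm zmax zmin"
  obtain Z' where cl: "closed Z'" and lift: "kfsm_lift k gt Z'" and img: "cproj 1 ` Z' = Z"
    using closed_lift_exists[OF kf Z(3)] by blast
  have Lam: "x \<in> Lam" if "x \<in> Z'" for x
    using that img Z(1) cproj_in_Lambda_iff by blast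
  have gtZ': "\<And>y. y \<in> Z' \<Longrightarrow> gt y \<in> Z'" and monoZ': "\<And>x y. x \<in> Z' \<Longrightarrow> y \<in> Z' \<Longrightarrow> x < y \<Longrightarrow> gt x \<le> gt y"
    using lift unfolding kfsm_lift_def invariant_set_def by auto
  obtain z0 where z0: "z0 \<in> Z'" using Z(2) img by blast
  then have ne: "Lam \<noteq> {}" using Lam by blast
  have k0: "real k > 0" using k by simp
  have below: "\<exists>z\<in>Z'. z < y" for y
  proof -
    obtain n :: nat where "real n * real k > z0 - y" using reals_Archimedean3[OF k0] by blast
    then show ?thesis using kfsm_lift_translate[OF lift z0, of "- int n"]
      by (intro bexI[of _ "z0 + of_int (- int n) * real k"]) auto
  qed
  have above: "\<exists>z\<in>Z'. y \<le> z" for y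
  proof -
    obtain n :: nat where "real n * real k > y - z0" using reals_Archimedean3[OF k0] by blast
    then show ?thesis using kfsm_lift_translate[OF lift z0, of "int n"]
      by (intro bexI[of _ "z0 + of_int (int n) * real k"]) auto
  qed
  define A where "A j = (\<lambda>z. gt z - (real j - 1)) ` {z \<in> Z'. z < real j - 1}" for j :: nat
  \<comment> \<open>On \<open>Z'\<close> every value left of the boundary \<open>j - 1\<close> is at
    most every value right of it, so the supremum of the former separates them. It may fall below
    \<open>L_val\<close>, hence the maximum; the result is at most \<open>U_val\<close> by
    \<open>LU\<close>.\<close>
  define c where "c j = max ?L (Sup (A j))" for j
  have A_ne: "A j \<noteq> {}" for j using below[of "real j - 1"] by (auto simp: A_def)
  have A_upper: "a \<le> gt z - (real j - 1)" if "a \<in> A j" "z \<in> Z'" "real j - 1 \<le> z" for a j z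
    using that monoZ'[of _ z] by (auto simp: A_def)
  have A_bdd: "bdd_above (A j)" for j
    using above[of "real j - 1"] A_upper by (meson bdd_above.I)
  have c_le: "c j \<le> gt z - (real j - 1)" if "z \<in> Z'" "real j - 1 \<le> z" for j z
  proof -
    have "?L \<le> gt z - (real j - 1)"
      using L_val_props(3)[OF ne Lam[OF that(1)], of "int j - 1"] that(2) by simp
    moreover have "Sup (A j) \<le> gt z - (real j - 1)" by (rule cSup_least[OF A_ne]) (rule A_upper[OF _ that])
    ultimately show ?thesis by (simp add: c_def)
  qed
  have c_ge: "gt z - (real j - 1) \<le> c j" if "z \<in> Z'" "z < real j - 1" for j z
  proof -
    have "gt z - (real j - 1) \<le> Sup (A j)" using that A_bdd by (intro cSup_upper) (auto simp: A_def)
    then show ?thesis by (simp add: c_def)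
  qed
  have c_range: "c j \<in> {?L..?U}" for j
  proof -
    have "Sup (A j) \<le> ?U"
    proof (rule cSup_least[OF A_ne])
      fix a assume "a \<in> A j"
      then obtain z where z: "z \<in> Z'" "z < real j - 1" "a = gt z - (real j - 1)" by (auto simp: A_def)
      then show "a \<le> ?U" using U_val_props(2)[OF ne Lam[OF z(1)], of "int j - 1"] by simp
    qed
    then show ?thesis using LU by (simp add: c_def)
  qed
  interpret interpolated_map gt xm zmax zmin g k c
    using k ne c_range by unfold_locales
  \<comment> \<open>Inside a flat spot \<open>gt\<close> exceeds the height on the left branch and
    stays below it on the right branch, contrary to the separation by \<open>c j\<close>.\<close>
  have avoid: "\<not> (lo j < z \<and> z < hi j)" if z: "z \<in> Z'" and j: "j \<in> {1..k}" for z j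
  proof
    assume b: "lo j < z \<and> z < hi j"
    have zb: "of_int \<lfloor>z\<rfloor> \<le> z" "z \<le> of_int \<lfloor>z\<rfloor> + xm" using LamD[OF Lam[OF z]] by auto
    show False
    proof (cases "z < real j - 1")
      case True
      have "\<lfloor>z\<rfloor> = int j - 2" using True b lo_props(1)[OF j] by (intro floor_unique) auto
      then have "gt (lo j) < gt z"
        using branch_mono[of "int j - 2" "lo j" z] lo_props[OF j] b zb by simp
      then show False using lo_props(3)[OF j] c_ge[OF z, of j] True by (simp add: c_shift_def)
    next
      case False
      then have "gt z < gt (hi j)"
        using branch_mono[of "int j - 1" z "hi j"] hi_props[OF j] b by simp
      then show False using hi_props(3)[OF j] c_le[OF z, of j] False by (simp add: c_shift_def)
    qed
  qed
  define Zs where "Zs = cproj k ` Z'"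
  have P: "Zs \<subseteq> P_set k gt xm c"
  proof
    fix A assume "A \<in> Zs"
    then obtain z where z: "z \<in> Z'" "A = cproj k z" by (auto simp: Zs_def)
    have "z - of_int m * real k \<in> Z'" for m using kfsm_lift_translate[OF lift z(1), of "- m"] by simp
    then show "A \<in> P_set k gt xm c" unfolding z(2) P_set_iff using avoid by blast
  qed
  have comp: "compactin (circ_top k) Zs"
    unfolding Zs_def
    by (intro compactin_cproj_image cl kfsm_lift_translate[OF lift] k)
  have inv: "invariant_set (H_map k gt xm c) Zs"
    unfolding invariant_set_def
  proof
    fix B assume "B \<in> H_map k gt xm c ` Zs"
    then obtain z where z: "z \<in> Z'" "B = H_map k gt xm c (cproj k z)" by (auto simp: Zs_def)
    then have "B = cproj k (gt z)" using P by (auto simp: Zs_def H_map_cproj)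
    then show "B \<in> Zs" using gtZ'[OF z(1)] by (simp add: Zs_def)
  qed
  have "recurrent_pt (circ_top k) (H_map k gt xm c) (cproj k z)" if z: "z \<in> Z'" for z
  proof -
    have "recurrent_pt (circ_top 1) g (cproj 1 z)" using rec z img unfolding recurrent_set_def by blast
    then have "recurrent_mod (real k) gt z" using k by (rule recurrent_lift)
    then show ?thesis
      using recurrent_pt_cproj_iff[of "H_map k gt xm c" k z gt] H_map_funpow[OF inv P, of z] z
      unfolding Zs_def by blast
  qed
  then have "recurrent_set (circ_top k) (H_map k gt xm c) Zs"
    unfolding recurrent_set_def using inv by (auto simp: Zs_def)
  moreover have "cover_proj ` Zs = Z" unfolding Zs_def img[symmetric] by (simp add: image_image cover_proj_cproj)
  ultimately show ?thesis
    unfolding interpolated_recurrent_def using c_range comp P by blast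
qed

end

section \<open>Coding a recurrent kfsm set\<close>

locale recurrent_kfsm = circle_map +
  fixes k :: nat and Y :: "real set"
  assumes k: "k \<ge> 1" and closed_Y: "closed Y" and lift_Y: "kfsm_lift k gt Y"
    and Y_Lam: "Y \<subseteq> Lambda_inf gt xm" and Y_nonempty: "Y \<noteq> {}"
    and rec_Y: "z \<in> Y \<Longrightarrow> recurrent_mod (real k) gt z"
begin

lemma k0: "real k > 0"
  using k by simp

lemma LamY: "z \<in> Y \<Longrightarrow> z \<in> Lam"
  using Y_Lam by blast

lemma gtY: "z \<in> Y \<Longrightarrow> gt z \<in> Y"
  using lift_Y unfolding kfsm_lift_def invariant_set_def by blast

lemma gt_monoY: "x \<in> Y \<Longrightarrow> y \<in> Y \<Longrightarrow> x \<le> y \<Longrightarrow> gt x \<le> gt y"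
  using lift_Y unfolding kfsm_lift_def by (cases "x = y") auto

lemma funpowY: "z \<in> Y \<Longrightarrow> (gt ^^ n) z \<in> Y"
  by (induction n) (simp_all add: gtY)

lemma funpow_monoY: "x \<in> Y \<Longrightarrow> y \<in> Y \<Longrightarrow> x \<le> y \<Longrightarrow> (gt ^^ n) x \<le> (gt ^^ n) y"
  by (induction n) (simp_all add: gt_monoY funpowY)

lemma translateY: "z \<in> Y \<Longrightarrow> z + of_int m * real k \<in> Y"
  by (rule kfsm_lift_translate[OF lift_Y])

lemma funpow_translate: "(gt ^^ n) (z + of_int m * real k) = (gt ^^ n) z + of_int m * real k"
  using funpow_add_int[of n z "m * int k"] by simp

lemma gt_translate: "gt (z + of_int m * real k) = gt z + of_int m * real k"
  using funpow_translate[of 1 z m] by simp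

lemma translate_into:
  obtains m :: int where "y \<le> z + of_int m * real k" "z + of_int m * real k < y + real k"
proof -
  define m where "m = \<lceil>(y - z) / real k\<rceil>"
  have "(y - z) / real k \<le> of_int m" "of_int m < (y - z) / real k + 1"
    unfolding m_def by linarith+
  then have "y - z \<le> of_int m * real k" "of_int m * real k < ((y - z) / real k + 1) * real k"
    using k0 by (simp_all only: pos_divide_le_eq mult_less_cancel_right_pos)
  moreover have "((y - z) / real k + 1) * real k = y - z + real k" using k0 by (simp add: field_simps)
  ultimately show ?thesis by (intro that[of m]) linarith+
qed

text \<open>Late returns of \<open>z\<close>, translated back, are images of points of
  \<open>Y\<close> that approach \<open>z\<close>. Displacements between 0 and 1 confine those
  points to a compact set, so the limit has a preimage in \<open>Y\<close>.\<close>

lemma surjY: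
  assumes z: "z \<in> Y"
  shows "\<exists>w\<in>Y. gt w = z"
proof -
  let ?K = "Y \<inter> {z - 2..z + 1}"
  have "compact ?K" using closed_Y by (simp add: closed_Int_compact)
  then have "compact (gt ` ?K)"
    using cont continuous_on_subset by (intro compact_continuous_image) blast+
  then have cl: "closed (gt ` ?K)" by (rule compact_imp_closed)
  have "z \<in> closure (gt ` ?K)"
    unfolding closure_approachable dist_real_def
  proof (intro allI impI)
    fix e :: real assume "e > 0"
    then have "min e 1 > 0" by simp
    then obtain n m where nm: "n \<ge> 1" "\<bar>(gt ^^ n) z - z - of_int m * real k\<bar> < min e 1"
      using rec_Y[OF z] unfolding recurrent_mod_def by blast
    define w where "w = (gt ^^ (n - 1)) z + of_int (- m) * real k"
    have w: "w \<in> Y" unfolding w_def by (intro translateY funpowY z)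
    have "gt ((gt ^^ (n - 1)) z) = (gt ^^ n) z" using nm(1) by (cases n) auto
    then have gw: "gt w = (gt ^^ n) z - of_int m * real k" unfolding w_def gt_translate by simp
    then have "gt w - z = (gt ^^ n) z - z - of_int m * real k" by simp
    then have near: "\<bar>gt w - z\<bar> < min e 1" using nm(2) by (simp only:)
    moreover have "w \<in> {z - 2..z + 1}" using near displacement[OF LamY[OF w]] by auto
    ultimately show "\<exists>y\<in>gt ` ?K. \<bar>y - z\<bar> < e" using w by auto
  qed
  then show ?thesis using cl by auto
qed

section \<open>The rotation number of the lift\<close>

lemma displacement_diff:
  assumes "z \<in> Y" "w \<in> Y"
  shows "\<bar>((gt ^^ n) w - w) - ((gt ^^ n) z - z)\<bar> \<le> real k"
proof -
  obtain m :: int where m: "w \<le> z + of_int m * real k" "z + of_int m * real k < w + real k"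
    by (rule translate_into)
  have "(gt ^^ n) w \<le> (gt ^^ n) z + of_int m * real k"
    using funpow_monoY[OF assms(2) translateY[OF assms(1)] m(1), of n] unfolding funpow_translate .
  moreover have "z + of_int (m - 1) * real k \<le> w" using m(2) by (simp add: algebra_simps)
  from funpow_monoY[OF translateY[OF assms(1)] assms(2) this, of n]
  have "(gt ^^ n) z + of_int m * real k - real k \<le> (gt ^^ n) w"
    unfolding funpow_translate by (simp add: algebra_simps)
  ultimately show ?thesis using m by linarith
qed

text \<open>The displacements \<open>D n\<close> of one orbit are additive up to an error
  \<open>k\<close>. Estimating \<open>D (m * n)\<close> in two ways shows that every
  \<open>(D n - k) / n\<close> is at most every \<open>(D m + k) / m\<close>, and
  \<open>\<omega>\<close> is taken between them. The final \<open>2 * k\<close> adds the cost of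
  changing the orbit.\<close>

lemma rotation_number_exists:
  "\<exists>\<omega>. \<forall>z\<in>Y. \<forall>n. \<bar>(gt ^^ n) z - z - real n * \<omega>\<bar> \<le> 2 * real k"
proof -
  obtain z0 where z0: "z0 \<in> Y" using Y_nonempty by blast
  define D where "D n = (gt ^^ n) z0 - z0" for n
  have add: "\<bar>D (n + m) - D n - D m\<bar> \<le> real k" for n m
    using displacement_diff[OF z0 funpowY[OF z0, of m], of n] unfolding D_def by (simp add: funpow_add)
  have mult: "\<bar>D (m * n) - real m * D n\<bar> \<le> real m * real k" for m n
  proof (induction m)
    case 0
    show ?case by (simp add: D_def)
  next
    case (Suc m)
    have "\<bar>D (n + m * n) - D n - D (m * n)\<bar> \<le> real k" by (rule add)
    then have "\<bar>D (n + m * n) - D n - real m * D n\<bar> \<le> real k + real m * real k"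
      using Suc by linarith
    then show ?case by (simp add: algebra_simps)
  qed
  have le: "(D n - real k) / real n \<le> (D m + real k) / real m" if "n \<ge> 1" "m \<ge> 1" for n m
  proof -
    have "real m * D n - real m * real k \<le> real n * D m + real n * real k"
      using mult[of m n] mult[of n m] by (simp add: mult.commute abs_le_iff)
    then show ?thesis using that by (simp add: field_simps)
  qed
  define S where "S = (\<lambda>n. (D n - real k) / real n) ` {1..}"
  define \<omega> where "\<omega> = Sup S"
  have bdd: "bdd_above S" unfolding S_def by (intro bdd_aboveI2[of _ _ "(D 1 + real k) / real 1"] le) auto
  have up: "\<omega> \<le> (D m + real k) / real m" if "m \<ge> 1" for m
    unfolding \<omega>_def by (rule cSup_least) (use le that in \<open>auto simp: S_def\<close>)
  have low: "(D m - real k) / real m \<le> \<omega>" if "m \<ge> 1" for m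
    unfolding \<omega>_def by (rule cSup_upper[OF _ bdd]) (use that in \<open>auto simp: S_def\<close>)
  have D: "\<bar>D n - real n * \<omega>\<bar> \<le> real k" for n
  proof (cases "n \<ge> 1")
    case True
    then show ?thesis using up[OF True] low[OF True] by (simp add: field_simps abs_le_iff)
  next
    case False
    then have "n = 0" by simp
    then show ?thesis by (simp add: D_def)
  qed
  have "\<bar>(gt ^^ n) z - z - real n * \<omega>\<bar> \<le> 2 * real k" if z: "z \<in> Y" for z n
    using displacement_diff[OF z0 z, of n] D[of n] unfolding D_def by linarith
  then show ?thesis by blast
qed

lemma cut_mono: "i \<le> j \<Longrightarrow> cut i \<le> cut j"
proof (rule ccontr)
  assume "i \<le> j" "\<not> cut i \<le> cut j"
  then have "symb (cut j) < i" by (simp add: symb_less_iff)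
  then have "cut j < cut j" using \<open>i \<le> j\<close> symb_less_iff[of "cut j" j] by simp
  then show False by simp
qed

lemma cut_period: "cut (i + 2 * int k) = cut i + real k"
  using cut_add_2[of i "int k"] by simp

lemma gt_less_cut_iff: "z \<in> Y \<Longrightarrow> gt z < cut (2 * j + 2) \<longleftrightarrow> z < cut (2 * j + 1)"
  using symb_gt_less_iff[OF LamY] unfolding symb_less_iff .

lemma cut_symb: "cut (symb z) \<le> z" "z < cut (symb z + 1)"
  using symb_less_iff[of z "symb z"] symb_less_iff[of z "symb z + 1"] by auto

end

section \<open>Rational rotation number: periodicity\<close>

context recurrent_kfsm
begin

text \<open>If \<open>\<omega> / k\<close> is rational, some iterate of \<open>gt\<close>, followed by a translation, has bounded orbits
  on \<open>Y\<close>; by monotonicity its orbits converge to fixed points, and recurrence forces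
  every point of \<open>Y\<close> to be one of these limits.\<close>

lemma rational_imp_periodic:
  assumes \<omega>: "\<And>z n. z \<in> Y \<Longrightarrow> \<bar>(gt ^^ n) z - z - real n * \<omega>\<bar> \<le> 2 * real k"
    and N: "N \<ge> 1" "real N * \<omega> = of_int M * real k" and z: "z \<in> Y"
  shows "(gt ^^ N) z = z + of_int M * real k"
proof -
  define E where "E x = (gt ^^ N) x + of_int (- M) * real k" for x
  have EY: "E x \<in> Y" if "x \<in> Y" for x unfolding E_def by (intro translateY funpowY that)
  have E_mono: "E x \<le> E y" if "x \<in> Y" "y \<in> Y" "x \<le> y" for x y
    using funpow_monoY[OF that, of N] by (simp add: E_def)
  have E_trans: "E (x + of_int m * real k) = E x + of_int m * real k" for x m
    unfolding E_def funpow_translate by simp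
  have E_cont: "isCont E x" for x
    using continuous_funpow[of N] unfolding E_def
    by (intro continuous_intros) (simp add: continuous_on_eq_continuous_at)
  have E_pow: "(E ^^ a) x = (gt ^^ (a * N)) x - of_int (int a * M) * real k" for a x
  proof (induction a)
    case (Suc a)
    have "(E ^^ Suc a) x = E ((gt ^^ (a * N)) x + of_int (- (int a * M)) * real k)" using Suc by simp
    also have "\<dots> = E ((gt ^^ (a * N)) x) + of_int (- (int a * M)) * real k" by (rule E_trans)
    also have "\<dots> = (gt ^^ (N + a * N)) x - of_int (int (Suc a) * M) * real k"
      unfolding E_def funpow_add by (simp add: algebra_simps)
    finally show ?case by simp
  qed simp
  have E_powY: "(E ^^ a) x \<in> Y" if "x \<in> Y" for a x by (induction a) (simp_all add: EY that)
  have bound: "\<bar>(E ^^ a) x - x\<bar> \<le> 2 * real k" if "x \<in> Y" for a x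
  proof -
    have eq: "real (a * N) * \<omega> = of_int (int a * M) * real k" using N(2) by simp
    have "(E ^^ a) x - x = (gt ^^ (a * N)) x - x - real (a * N) * \<omega>" unfolding E_pow eq by simp
    then show ?thesis using \<omega>[OF that, of "a * N"] by (simp only:)
  qed
  have lim: "\<exists>l. E l = l \<and> (\<lambda>a. (E ^^ a) v) \<longlonglongrightarrow> l" if v: "v \<in> Y" for v
  proof -
    have "monoseq (\<lambda>a. (E ^^ a) v)"
    proof (cases "v \<le> E v")
      case True
      have "(E ^^ a) v \<le> (E ^^ Suc a) v" for a
        by (induction a) (use True E_mono E_powY v EY in auto)
      then show ?thesis unfolding monoseq_Suc by blast
    next
      case False
      have "(E ^^ Suc a) v \<le> (E ^^ a) v" for a
        by (induction a) (use False E_mono E_powY v EY in auto)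
      then show ?thesis unfolding monoseq_Suc by blast
    qed
    moreover have "Bseq (\<lambda>a. (E ^^ a) v)"
    proof (rule BseqI'[of _ "\<bar>v\<bar> + 2 * real k"])
      fix a show "norm ((E ^^ a) v) \<le> \<bar>v\<bar> + 2 * real k" using bound[OF v, of a] by simp
    qed
    ultimately obtain l where l: "(\<lambda>a. (E ^^ a) v) \<longlonglongrightarrow> l"
      using Bseq_monoseq_convergent unfolding convergent_def by blast
    then have "(\<lambda>a. E ((E ^^ a) v)) \<longlonglongrightarrow> E l" using E_cont isCont_tendsto_compose by blast
    moreover have "(\<lambda>a. E ((E ^^ a) v)) \<longlonglongrightarrow> l" using LIMSEQ_Suc[OF l] by simp
    ultimately show ?thesis using l LIMSEQ_unique by blast
  qed
  \<comment> \<open>Return times are sorted by residue modulo \<open>N\<close>. Once a residue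
    \<open>r\<close> occurs for all tolerances, those returns lie, up to translation, on the
    \<open>E\<close>-orbit of \<open>(gt ^^ r) z\<close>, which converges.\<close>
  have "\<exists>r\<in>{..<N}. \<forall>e>0. \<forall>n0. \<exists>n\<ge>n0. n mod N = r \<and> (\<exists>m::int. \<bar>(gt ^^ n) z - z - of_int m * real k\<bar> < e)"
  proof (rule frequently_pigeonhole)
    fix e :: real and n0 :: nat assume "e > 0"
    then obtain n m where "n \<ge> n0" "\<bar>(gt ^^ n) z - z - of_int m * real k\<bar> < e"
      using rec_Y[OF z] unfolding recurrent_mod_def by blast
    then show "\<exists>r\<in>{..<N}. \<exists>n\<ge>n0. n mod N = r \<and> (\<exists>m::int. \<bar>(gt ^^ n) z - z - of_int m * real k\<bar> < e)"
      using N(1) by (intro bexI[of _ "n mod N"]) auto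
  next
    fix r e n0 e' n1 assume *: "\<exists>n\<ge>n0. n mod N = r \<and> (\<exists>m::int. \<bar>(gt ^^ n) z - z - of_int m * real k\<bar> < e)"
      and le: "e \<le> e'" "n1 \<le> n0"
    obtain n m where "n \<ge> n0" "n mod N = r" "\<bar>(gt ^^ n) z - z - of_int m * real k\<bar> < e" using * by blast
    moreover from this have "n \<ge> n1" "\<bar>(gt ^^ n) z - z - of_int m * real k\<bar> < e'" using le by linarith+
    ultimately show "\<exists>n\<ge>n1. n mod N = r \<and> (\<exists>m::int. \<bar>(gt ^^ n) z - z - of_int m * real k\<bar> < e')"
      by blast
  qed simp
  then obtain r where r: "\<And>e n0. e > 0 \<Longrightarrow>
      \<exists>n\<ge>n0. n mod N = r \<and> (\<exists>m::int. \<bar>(gt ^^ n) z - z - of_int m * real k\<bar> < e)" by blast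
  define v where "v = (gt ^^ r) z"
  have v: "v \<in> Y" unfolding v_def by (rule funpowY[OF z])
  obtain l where l: "E l = l" "(\<lambda>a. (E ^^ a) v) \<longlonglongrightarrow> l" using lim[OF v] by blast
  have near: "\<exists>m::int. \<bar>l - z - of_int m * real k\<bar> < e" if e: "e > 0" for e
  proof -
    have e2: "e / 2 > 0" using e by simp
    obtain a0 where a0: "\<And>a. a \<ge> a0 \<Longrightarrow> \<bar>(E ^^ a) v - l\<bar> < e / 2"
      using LIMSEQ_D[OF l(2) e2] by auto
    obtain n m where n: "n \<ge> a0 * N + N" "n mod N = r" "\<bar>(gt ^^ n) z - z - of_int m * real k\<bar> < e / 2"
      using r[OF e2] by blast
    define a where "a = n div N"
    have na: "n = a * N + r" unfolding a_def n(2)[symmetric] by simp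
    have "r < N" using n(2) N(1) by auto
    then have "a0 * N < (a + 1) * N" using n(1) na by simp
    then have "a \<ge> a0" using mult_less_cancel2[of a0 N "a + 1"] by simp
    then have "\<bar>(E ^^ a) v - l\<bar> < e / 2" by (rule a0)
    moreover have "(gt ^^ n) z = (E ^^ a) v + of_int (int a * M) * real k"
      unfolding E_pow v_def na funpow_add by simp
    moreover have "l - z - of_int (m - int a * M) * real k =
        (l + of_int (int a * M) * real k) - z - of_int m * real k" by (simp add: algebra_simps)
    ultimately have "\<bar>l - z - of_int (m - int a * M) * real k\<bar> < e"
      using n(3) by linarith
    then show ?thesis by blast
  qed
  \<comment> \<open>Two different multiples of \<open>k\<close> cannot both be within
    \<open>k / 4\<close> of \<open>l - z\<close>. The nearby multiple is thus the same for all small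
    tolerances, and the difference vanishes.\<close>
  have "real k / 4 > 0" using k0 by simp
  from near[OF this] obtain m where m: "\<bar>l - z - of_int m * real k\<bar> < real k / 4" by blast
  have "l - z - of_int m * real k = 0"
  proof (rule ccontr)
    assume nz: "l - z - of_int m * real k \<noteq> 0"
    define e where "e = min \<bar>l - z - of_int m * real k\<bar> (real k / 4)"
    have "e > 0" using nz k0 by (simp add: e_def)
    from near[OF this] obtain m' where m': "\<bar>l - z - of_int m' * real k\<bar> < e" by blast
    have "\<bar>l - z - of_int m' * real k\<bar> < real k / 4" using m' by (simp add: e_def)
    moreover have "of_int (m - m') * real k = (l - z - of_int m' * real k) - (l - z - of_int m * real k)"
      by (simp add: algebra_simps)
    ultimately have "\<bar>of_int (m - m') * real k\<bar> < 1 * real k" using m k0 by linarith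
    then have "\<bar>real_of_int (m - m')\<bar> < 1" using k0 by (simp add: abs_mult)
    then have "m = m'" by linarith
    then show False using m' unfolding e_def by simp
  qed
  then have "z = l + of_int (- m) * real k" by simp
  then have "E z = z" using E_trans[of l "- m"] l(1) by simp
  then show ?thesis by (simp add: E_def)
qed

end

section \<open>Rational rotation number: counting points\<close>

locale periodic_kfsm = recurrent_kfsm +
  fixes N :: nat and M :: int
  assumes N: "N \<ge> 1" and periodic: "z \<in> Y \<Longrightarrow> (gt ^^ N) z = z + of_int M * real k"
begin

lemma gt_less_iff:
  assumes "x \<in> Y" "y \<in> Y"
  shows "gt x < gt y \<longleftrightarrow> x < y"
proof -
  have inj: "x = y" if "gt x = gt y" "x \<in> Y" "y \<in> Y" for x y
  proof -
    have "(gt ^^ (N - 1)) (gt x) = (gt ^^ N) x" for x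
      using N by (cases N) (simp_all add: funpow_swap1)
    then show ?thesis using periodic[OF that(2)] periodic[OF that(3)] that(1) by (metis add_right_cancel)
  qed
  show ?thesis
    using gt_monoY[OF assms] gt_monoY[OF assms(2,1)] inj[OF _ assms]
    by (cases x y rule: linorder_cases) (auto simp: order_less_le)
qed

text \<open>By periodicity the first \<open>N\<close> symbols determine the itinerary and hence the
  point. Bounded displacement leaves finitely many symbols for points of a bounded interval.\<close>

lemma finite_Y: "finite (Y \<inter> {a..b})"
proof -
  define f where "f z = map (itin z) [0..<N]" for z
  define I where "I = {symb a..symb (b + real N)}"
  have range: "itin z n \<in> I" if z: "z \<in> Y" "a \<le> z" "z \<le> b" and n: "n < N" for z n
  proof -
    have "z \<le> (gt ^^ n) z \<and> (gt ^^ n) z \<le> z + real n"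
    proof (induction n)
      case (Suc n)
      then show ?case using displacement[OF LamY[OF funpowY[OF z(1), of n]]] by simp
    qed simp
    then have "a \<le> (gt ^^ n) z" "(gt ^^ n) z \<le> b + real N" using z n by auto
    then show ?thesis unfolding I_def itin_def using symb_mono by simp
  qed
  have "f ` (Y \<inter> {a..b}) \<subseteq> {xs. set xs \<subseteq> I \<and> length xs = N}"
    using range by (auto simp: f_def)
  moreover have "finite {xs. set xs \<subseteq> I \<and> length xs = N}"
    by (intro finite_lists_length_eq) (simp add: I_def)
  ultimately have "finite (f ` (Y \<inter> {a..b}))" using finite_subset by blast
  moreover have "inj_on f (Y \<inter> {a..b})"
  proof (rule inj_onI)
    fix x y assume xy: "x \<in> Y \<inter> {a..b}" "y \<in> Y \<inter> {a..b}" "f x = f y"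
    have per: "itin z (n + N) = itin z n + 2 * (M * int k)" if "z \<in> Y" for z n
    proof -
      have "(gt ^^ N) z = z + of_int (M * int k)" using periodic[OF that] by simp
      then show ?thesis by (metis itin_funpow itin_add_int)
    qed
    have "itin x n = itin y n" for n
    proof (induction n rule: less_induct)
      case (less n)
      show ?case
      proof (cases "n < N")
        case True
        then show ?thesis using arg_cong[OF xy(3), of "\<lambda>l. l ! n"] by (simp add: f_def)
      next
        case False
        then have "itin x (n - N) = itin y (n - N)" using N by (intro less) simp
        then show ?thesis using per[of x "n - N"] per[of y "n - N"] xy False by simp
      qed
    qed
    then show "x = y" using itin_inj xy LamY by blast
  qed
  ultimately show ?thesis by (rule finite_imageD)
qed

lemma finite_Y_less: "finite (Y \<inter> {a..<b})"
  by (rule finite_subset[OF _ finite_Y[of a b]]) auto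

text \<open>A signed count from 0. The half-open intervals make consecutive points of
  \<open>Y\<close> differ by exactly 1, so \<open>cnt\<close> numbers \<open>Y\<close> by the
  integers.\<close>

definition cnt :: "real \<Rightarrow> int" where
  "cnt x = int (card (Y \<inter> {0..<x})) - int (card (Y \<inter> {x..<0}))"

lemma card_split:
  assumes "a \<le> b" "b \<le> c"
  shows "int (card (Y \<inter> {a..<c})) = int (card (Y \<inter> {a..<b})) + int (card (Y \<inter> {b..<c}))"
proof -
  have "Y \<inter> {a..<c} = (Y \<inter> {a..<b}) \<union> (Y \<inter> {b..<c})" using assms by auto
  moreover have "card ((Y \<inter> {a..<b}) \<union> (Y \<inter> {b..<c})) = card (Y \<inter> {a..<b}) + card (Y \<inter> {b..<c})"
    by (intro card_Un_disjoint finite_Y_less) auto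
  ultimately show ?thesis by simp
qed

lemma cnt_diff:
  assumes "a \<le> b"
  shows "cnt b - cnt a = int (card (Y \<inter> {a..<b}))"
proof -
  consider "0 \<le> a" | "a < 0" "0 \<le> b" | "b < 0" using assms by linarith
  then show ?thesis
  proof cases
    case 1
    then show ?thesis using card_split[of 0 a b] assms by (simp add: cnt_def)
  next
    case 2
    then show ?thesis using card_split[of a 0 b] by (simp add: cnt_def)
  next
    case 3
    then show ?thesis using card_split[of a b 0] assms by (simp add: cnt_def)
  qed
qed

lemma cnt_mono: "a \<le> b \<Longrightarrow> cnt a \<le> cnt b"
  using cnt_diff[of a b] by simp

lemma cnt_less: "a \<in> Y \<Longrightarrow> a < b \<Longrightarrow> cnt a + 1 \<le> cnt b"
proof -
  assume "a \<in> Y" "a < b"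
  then have "Y \<inter> {a..<b} \<noteq> {}" by auto
  then have "card (Y \<inter> {a..<b}) > 0" using finite_Y_less by (simp add: card_gt_0_iff)
  then show ?thesis using cnt_diff[of a b] \<open>a < b\<close> by simp
qed

lemma cnt_0: "cnt 0 = 0"
  by (simp add: cnt_def)

definition shift_cnt :: int where
  "shift_cnt = cnt (real k)"

lemma cnt_period: "cnt (x + real k) = cnt x + shift_cnt"
proof -
  have card: "card (Y \<inter> {a + real k..<b + real k}) = card (Y \<inter> {a..<b})" for a b
  proof -
    have "(\<lambda>z. z + real k) ` (Y \<inter> {a..<b}) = Y \<inter> {a + real k..<b + real k}"
    proof (intro equalityI subsetI)
      fix y assume "y \<in> Y \<inter> {a + real k..<b + real k}"
      then show "y \<in> (\<lambda>z. z + real k) ` (Y \<inter> {a..<b})"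
        using translateY[of y "- 1"] by (intro image_eqI[of _ _ "y - real k"]) auto
    next
      fix y assume "y \<in> (\<lambda>z. z + real k) ` (Y \<inter> {a..<b})"
      then show "y \<in> Y \<inter> {a + real k..<b + real k}" using translateY[of _ 1] by auto
    qed
    then show ?thesis using card_image[of "\<lambda>z. z + real k" "Y \<inter> {a..<b}"] by (simp add: inj_on_def)
  qed
  have "cnt (b + real k) - cnt (a + real k) = cnt b - cnt a" if "a \<le> b" for a b
    using cnt_diff[of a b] cnt_diff[of "a + real k" "b + real k"] card[of a b] that by simp
  from this[of 0 x] this[of x 0] show ?thesis
    by (cases "x \<ge> 0") (simp_all add: shift_cnt_def cnt_0)
qed

lemma shift_cnt_pos: "shift_cnt > 0"
proof -
  obtain z where z: "z \<in> Y" using Y_nonempty by blast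
  obtain m :: int where m: "0 \<le> z + of_int m * real k" "z + of_int m * real k < 0 + real k"
    by (rule translate_into)
  then have "cnt (z + of_int m * real k) + 1 \<le> cnt (real k)"
    using translateY[OF z] by (intro cnt_less) auto
  then show ?thesis using cnt_mono[OF m(1)] cnt_0 by (simp add: shift_cnt_def)
qed

lemma cnt_translate: "cnt (x + of_int m * real k) = cnt x + m * shift_cnt"
proof -
  have nat: "cnt (x + real n * real k) = cnt x + int n * shift_cnt" for x n
  proof (induction n)
    case (Suc n)
    then show ?case using cnt_period[of "x + real n * real k"] by (simp add: algebra_simps)
  qed simp
  show ?thesis
  proof (cases "m \<ge> 0")
    case True
    then show ?thesis using nat[of x "nat m"] by simp
  next
    case False
    then show ?thesis using nat[of "x + of_int m * real k" "nat (- m)"] by simp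
  qed
qed

text \<open>On \<open>Y\<close> the map is an order isomorphism, so it carries the points of
  \<open>Y\<close> between \<open>a\<close> and \<open>b\<close> bijectively to those between their
  images.\<close>

lemma cnt_gt_diff:
  assumes "a \<in> Y" "b \<in> Y"
  shows "cnt (gt b) - cnt (gt a) = cnt b - cnt a"
proof -
  have *: "cnt (gt b) - cnt (gt a) = cnt b - cnt a" if ab: "a \<in> Y" "b \<in> Y" "a \<le> b" for a b
  proof -
    have "gt ` (Y \<inter> {a..<b}) = Y \<inter> {gt a..<gt b}"
    proof (intro equalityI subsetI)
      fix y assume "y \<in> gt ` (Y \<inter> {a..<b})"
      then show "y \<in> Y \<inter> {gt a..<gt b}" using gtY gt_monoY gt_less_iff ab by auto
    next
      fix y assume y: "y \<in> Y \<inter> {gt a..<gt b}"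
      then obtain w where w: "w \<in> Y" "gt w = y" using surjY by blast
      then have "\<not> w < a" "w < b" using y gt_less_iff[OF w(1) ab(1)] gt_less_iff[OF w(1) ab(2)] by auto
      then show "y \<in> gt ` (Y \<inter> {a..<b})" using w by auto
    qed
    moreover have "inj_on gt (Y \<inter> {a..<b})"
    proof (rule inj_onI)
      fix x y assume "x \<in> Y \<inter> {a..<b}" "y \<in> Y \<inter> {a..<b}" "gt x = gt y"
      then show "x = y" using gt_less_iff[of x y] gt_less_iff[of y x] by auto
    qed
    ultimately have "card (Y \<inter> {gt a..<gt b}) = card (Y \<inter> {a..<b})" by (metis card_image)
    then show ?thesis using cnt_diff[OF that(3)] cnt_diff[OF gt_monoY[OF ab]] by simp
  qed
  show ?thesis using *[OF assms] *[OF assms(2,1)] by (cases "a \<le> b") auto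
qed

lemma cnt_gt_const: "\<exists>q. \<forall>z\<in>Y. cnt (gt z) = cnt z + q"
proof -
  obtain z0 where "z0 \<in> Y" using Y_nonempty by blast
  then have "\<forall>z\<in>Y. cnt (gt z) = cnt z + (cnt (gt z0) - cnt z0)" using cnt_gt_diff by force
  then show ?thesis by blast
qed

lemma cnt_pred:
  assumes "y \<in> Y"
  shows "\<exists>x\<in>Y. cnt x = cnt y - 1"
proof -
  define x where "x = Max (Y \<inter> {y - real k..<y})"
  have "y - real k \<in> Y" using translateY[OF assms, of "- 1"] by simp
  then have ne: "Y \<inter> {y - real k..<y} \<noteq> {}" using k0 by auto
  have x: "x \<in> Y \<inter> {y - real k..<y}" unfolding x_def by (rule Max_in[OF finite_Y_less ne])
  have "w \<le> x" if "w \<in> Y \<inter> {y - real k..<y}" for w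
    unfolding x_def by (rule Max_ge[OF finite_Y_less that])
  then have "Y \<inter> {x..<y} = {x}" using x by force
  then show ?thesis using cnt_diff[of x y] x by (intro bexI[of _ x]) auto
qed

lemma cnt_surj: "\<exists>z\<in>Y. cnt z = t"
proof -
  obtain z0 where z0: "z0 \<in> Y" using Y_nonempty by blast
  define m where "m = \<bar>t - cnt z0\<bar>"
  define y where "y = z0 + of_int m * real k"
  have "m * shift_cnt \<ge> m" using shift_cnt_pos by (simp add: m_def mult_le_cancel_left1)
  then have yt: "cnt y \<ge> t" unfolding y_def cnt_translate m_def by linarith
  have "\<exists>z\<in>Y. cnt z = cnt y - int n" for n
  proof (induction n)
    case 0
    then show ?case using translateY[OF z0] unfolding y_def by auto
  next
    case (Suc n)
    then obtain z where "z \<in> Y" "cnt z = cnt y - int n" by blast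
    then show ?case using cnt_pred[of z] by force
  qed
  from this[of "nat (cnt y - t)"] show ?thesis using yt by simp
qed

text \<open>The first point of \<open>Y\<close> at or after one cut is mapped to the first point at
  or after the next cut, and \<open>cnt\<close> cannot change between a cut and the first point
  after it.\<close>

lemma cnt_cut_step:
  assumes q: "\<And>z. z \<in> Y \<Longrightarrow> cnt (gt z) = cnt z + q"
  shows "cnt (cut (2 * j + 2)) = cnt (cut (2 * j + 1)) + q"
proof -
  let ?a = "cut (2 * j + 1)" and ?b = "cut (2 * j + 2)"
  define y where "y = Min (Y \<inter> {?a..?a + real k})"
  obtain z0 where z0: "z0 \<in> Y" using Y_nonempty by blast
  obtain m :: int where "?a \<le> z0 + of_int m * real k" "z0 + of_int m * real k < ?a + real k"
    by (rule translate_into)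
  then have ne: "Y \<inter> {?a..?a + real k} \<noteq> {}" using translateY[OF z0, of m] by auto
  have y: "y \<in> Y \<inter> {?a..?a + real k}" unfolding y_def by (rule Min_in[OF finite_Y ne])
  have least: "y \<le> w" if w: "w \<in> Y" "?a \<le> w" for w
  proof (cases "w \<le> ?a + real k")
    case True
    then show ?thesis unfolding y_def by (intro Min_le finite_Y) (use w in auto)
  next
    case False
    then show ?thesis using y by auto
  qed
  have "Y \<inter> {?a..<y} = {}" using least by force
  then have 1: "cnt y = cnt ?a" using cnt_diff[of ?a y] y by simp
  have b_le: "?b \<le> gt y" using gt_less_cut_iff[of y j] y by auto
  have "Y \<inter> {?b..<gt y} = {}"
  proof (rule ccontr)
    assume "Y \<inter> {?b..<gt y} \<noteq> {}"
    then obtain w where w: "w \<in> Y" "?b \<le> w" "w < gt y" by auto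
    then obtain v where v: "v \<in> Y" "gt v = w" using surjY by blast
    then have "?a \<le> v" using gt_less_cut_iff[of v j] w by auto
    then have "y \<le> v" using least v by blast
    then show False using gt_monoY[of y v] y v w by auto
  qed
  then have "cnt (gt y) = cnt ?b" using cnt_diff[OF b_le] by simp
  then show ?thesis using q[of y] y 1 by simp
qed

theorem periodic_coding:
  "\<exists>\<omega> ell. partition_seq k ell \<and> ell 0 = 0 \<and> (\<forall>j. ell (2 * j + 2) = ell (2 * j + 1) + \<omega>) \<and>
    itin ` Y = code_set ell \<omega>"
proof -
  obtain q where q: "\<And>z. z \<in> Y \<Longrightarrow> cnt (gt z) = cnt z + q" using cnt_gt_const by blast
  \<comment> \<open>Each of the \<open>shift_cnt\<close> points in a period is allotted an interval
    of the same length \<open>d\<close>, so that the whole period has length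
    \<open>k\<close>.\<close>
  define d where "d = real k / of_int shift_cnt"
  have d: "d > 0" "d * of_int shift_cnt = real k" using k0 shift_cnt_pos by (simp_all add: d_def)
  define \<omega> where "\<omega> = d * of_int q"
  define ell where "ell i = d * of_int (cnt (cut i))" for i
  have "partition_seq k ell"
  proof
    show "mono ell"
      using d(1) by (intro monoI) (simp add: ell_def cnt_mono cut_mono)
    show "ell (i + 2 * int k) = ell i + real k" for i
      unfolding ell_def cut_period cnt_period using d(2) by (simp add: algebra_simps)
  qed (rule k)
  then interpret ps: partition_seq k ell .
  have step: "ell (2 * j + 2) = ell (2 * j + 1) + \<omega>" for j
  proof -
    have "cnt (cut (2 * j + 2)) = cnt (cut (2 * j + 1)) + q" by (rule cnt_cut_step) (rule q)
    then show ?thesis by (simp only: ell_def \<omega>_def of_int_add distrib_left)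
  qed
  have ell_0: "ell 0 = 0" by (simp add: ell_def cut_def cnt_0)
  have cnt_pow: "cnt ((gt ^^ n) z) = cnt z + int n * q" if "z \<in> Y" for z n
  proof (induction n)
    case (Suc n)
    then show ?case using q[OF funpowY[OF that, of n]] by (simp add: algebra_simps)
  qed simp
  \<comment> \<open>The interval allotted to \<open>z\<close> is translated at every time into a
    single cell, the one named by the itinerary. All its points therefore share the code of
    \<open>z\<close>.\<close>
  have range: "ell (itin z n) \<le> d * of_int (cnt z) + real n * \<omega>"
    "d * of_int (cnt z + 1) + real n * \<omega> \<le> ell (itin z n + 1)" if z: "z \<in> Y" for z n
  proof -
    let ?w = "(gt ^^ n) z"
    have "cnt (cut (symb ?w)) \<le> cnt ?w" "cnt ?w + 1 \<le> cnt (cut (symb ?w + 1))"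
      using cnt_mono[OF cut_symb(1)] cnt_less[OF funpowY[OF z] cut_symb(2)] by auto
    then have "real_of_int (cnt (cut (symb ?w))) \<le> of_int (cnt z + int n * q)"
      "of_int (cnt z + int n * q + 1) \<le> real_of_int (cnt (cut (symb ?w + 1)))"
      unfolding cnt_pow[OF z] of_int_le_iff by auto
    then have "d * of_int (cnt (cut (symb ?w))) \<le> d * of_int (cnt z + int n * q)"
      "d * of_int (cnt z + int n * q + 1) \<le> d * of_int (cnt (cut (symb ?w + 1)))"
      using d(1) by (auto intro: mult_left_mono)
    then show "ell (itin z n) \<le> d * of_int (cnt z) + real n * \<omega>"
      "d * of_int (cnt z + 1) + real n * \<omega> \<le> ell (itin z n + 1)"
      by (simp_all add: ell_def itin_def \<omega>_def algebra_simps)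
  qed
  have "itin ` Y = code_set ell \<omega>"
  proof (intro equalityI subsetI)
    fix s assume "s \<in> itin ` Y"
    then obtain z where z: "z \<in> Y" "s = itin z" by blast
    have "right_code ell \<omega> (d * of_int (cnt z)) s"
      unfolding right_code_def
    proof
      fix n
      have "d * of_int (cnt z) < d * of_int (cnt z + 1)" using d(1) by simp
      then show "ell (s n) \<le> d * of_int (cnt z) + real n * \<omega> \<and> d * of_int (cnt z) + real n * \<omega> < ell (s n + 1)"
        using range[OF z(1), of n] unfolding z(2) by linarith
    qed
    then show "s \<in> code_set ell \<omega>" unfolding code_set_def by blast
  next
    fix s assume "s \<in> code_set ell \<omega>"
    then obtain x where "right_code ell \<omega> x s \<or> left_code ell \<omega> x s" unfolding code_set_def by blast
    then show "s \<in> itin ` Y"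
    proof
      assume s: "right_code ell \<omega> x s"
      have "of_int \<lfloor>x / d\<rfloor> \<le> x / d" "x / d < of_int (\<lfloor>x / d\<rfloor> + 1)" by linarith+
      then have t: "d * of_int \<lfloor>x / d\<rfloor> \<le> x" "x < d * of_int (\<lfloor>x / d\<rfloor> + 1)"
        using d(1) by (simp_all only: pos_le_divide_eq pos_divide_less_eq mult.commute)
      obtain z where z: "z \<in> Y" "cnt z = \<lfloor>x / d\<rfloor>" using cnt_surj by blast
      have "itin z n = s n" for n
      proof -
        have "ell (s n) \<le> x + real n * \<omega>" "x + real n * \<omega> < ell (s n + 1)"
          using s unfolding right_code_def by blast+
        then have "ell (itin z n) < ell (s n + 1)" "ell (s n) < ell (itin z n + 1)"
          using range[OF z(1), of n] t unfolding z(2) by linarith+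
        then show ?thesis
          using ps.ell_less_cancel[of "itin z n" "s n + 1"] ps.ell_less_cancel[of "s n" "itin z n + 1"] by linarith
      qed
      then have "s = itin z" by auto
      then show ?thesis using z(1) by blast
    next
      assume s: "left_code ell \<omega> x s"
      \<comment> \<open>For left codes the allotted intervals are closed on the right, so a grid
        point counts with the preceding point of \<open>Y\<close>; hence the ceiling minus
        1.\<close>
      have "of_int (\<lceil>x / d\<rceil> - 1) < x / d" "x / d \<le> of_int (\<lceil>x / d\<rceil> - 1 + 1)" by linarith+
      then have t: "d * of_int (\<lceil>x / d\<rceil> - 1) < x" "x \<le> d * of_int (\<lceil>x / d\<rceil> - 1 + 1)"
        using d(1) by (simp_all only: pos_less_divide_eq pos_divide_le_eq mult.commute)
      obtain z where z: "z \<in> Y" "cnt z = \<lceil>x / d\<rceil> - 1" using cnt_surj by blast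
      have "itin z n = s n" for n
      proof -
        have "ell (s n) < x + real n * \<omega>" "x + real n * \<omega> \<le> ell (s n + 1)"
          using s unfolding left_code_def by blast+
        then have "ell (itin z n) < ell (s n + 1)" "ell (s n) < ell (itin z n + 1)"
          using range[OF z(1), of n] t unfolding z(2) by linarith+
        then show ?thesis
          using ps.ell_less_cancel[of "itin z n" "s n + 1"] ps.ell_less_cancel[of "s n" "itin z n + 1"] by linarith
      qed
      then have "s = itin z" by auto
      then show ?thesis using z(1) by blast
    qed
  qed
  then show ?thesis using \<open>partition_seq k ell\<close> ell_0 step by blast
qed

end

section \<open>Irrational rotation number: semiconjugacy to a translation\<close>

lemma SUP_add_const:
  fixes f :: "'a \<Rightarrow> real"
  assumes "bdd_above (range f)"
  shows "(SUP n. f n + c) = (SUP n. f n) + c"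
proof (rule antisym)
  show "(SUP n. f n + c) \<le> (SUP n. f n) + c"
    using assms by (intro cSUP_least) (auto intro: cSUP_upper)
  have "bdd_above (range (\<lambda>n. f n + c))"
    using assms unfolding bdd_above_def by (auto intro: add_right_mono)
  then have "f n + c \<le> (SUP n. f n + c)" for n by (intro cSUP_upper) auto
  then have "(SUP n. f n) \<le> (SUP n. f n + c) - c"
    by (intro cSUP_least) (auto simp: le_diff_eq)
  then show "(SUP n. f n) + c \<le> (SUP n. f n + c)" by simp
qed

locale irrational_kfsm = recurrent_kfsm +
  fixes \<omega> :: real
  assumes irrational: "\<omega> / real k \<notin> \<rat>"
    and \<omega>: "z \<in> Y \<Longrightarrow> \<bar>(gt ^^ n) z - z - real n * \<omega>\<bar> \<le> 2 * real k"
begin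

definition drift :: "real \<Rightarrow> nat \<Rightarrow> real" where
  "drift z n = (gt ^^ n) z - real n * \<omega>"

definition sup_drift :: "real \<Rightarrow> nat \<Rightarrow> real" where
  "sup_drift z N = (SUP n. drift z (n + N))"

text \<open>The limsup of a sequence known only to be bounded, written as the limit of its
  decreasing tail suprema. Passing from \<open>z\<close> to \<open>gt z\<close> drops one term and
  adds \<open>\<omega>\<close> to the rest, so the conjugacy relation is exact.\<close>

definition semiconj :: "real \<Rightarrow> real" where
  "semiconj z = lim (sup_drift z)"

lemma drift_bound: "z \<in> Y \<Longrightarrow> \<bar>drift z n - z\<bar> \<le> 2 * real k"
  using \<omega>[of z n] by (simp add: drift_def algebra_simps)

lemma bdd_drift: "z \<in> Y \<Longrightarrow> bdd_above (range (\<lambda>n. drift z (n + N)))"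
proof (rule bdd_aboveI2)
  fix n assume "z \<in> Y"
  then show "drift z (n + N) \<le> z + 2 * real k" using drift_bound[of z "n + N"] by linarith
qed

lemma sup_drift_tendsto:
  assumes z: "z \<in> Y"
  shows "sup_drift z \<longlonglongrightarrow> semiconj z"
proof -
  have "decseq (sup_drift z)"
  proof (rule decseq_SucI)
    fix N
    show "sup_drift z (Suc N) \<le> sup_drift z N"
      unfolding sup_drift_def
    proof (rule cSUP_least)
      fix n
      show "drift z (n + Suc N) \<le> (SUP n. drift z (n + N))"
        using cSUP_upper[OF _ bdd_drift[OF z], of "Suc n" N] by simp
    qed simp
  qed
  moreover have "z - 2 * real k \<le> sup_drift z N" for N
  proof -
    have "drift z (0 + N) \<le> sup_drift z N"
      unfolding sup_drift_def by (rule cSUP_upper[OF _ bdd_drift[OF z]]) simp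
    then show ?thesis using drift_bound[OF z, of N] by simp
  qed
  ultimately obtain l where "sup_drift z \<longlonglongrightarrow> l" using decseq_convergent by metis
  then show ?thesis unfolding semiconj_def using limI by metis
qed

lemma semiconj_mono:
  assumes "x \<in> Y" "y \<in> Y" "x \<le> y"
  shows "semiconj x \<le> semiconj y"
proof (rule LIMSEQ_le[OF sup_drift_tendsto sup_drift_tendsto])
  have "sup_drift x N \<le> sup_drift y N" for N
    unfolding sup_drift_def
  proof (rule cSUP_mono[OF _ bdd_drift[OF assms(2)]])
    fix n
    have "drift x (n + N) \<le> drift y (n + N)"
      using funpow_monoY[OF assms, of "n + N"] by (simp add: drift_def)
    then show "\<exists>m\<in>UNIV. drift x (n + N) \<le> drift y (m + N)" by blast
  qed simp
  then show "\<exists>N. \<forall>n\<ge>N. sup_drift x n \<le> sup_drift y n" by blast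
qed (use assms in auto)

lemma semiconj_gt:
  assumes z: "z \<in> Y"
  shows "semiconj (gt z) = semiconj z + \<omega>"
proof -
  have d: "drift (gt z) n = drift z (Suc n) + \<omega>" for n
    unfolding drift_def by (simp add: funpow_swap1 algebra_simps)
  have "sup_drift (gt z) N = sup_drift z (Suc N) + \<omega>" for N
    using SUP_add_const[OF bdd_drift[OF z, of "Suc N"], of \<omega>] unfolding sup_drift_def d by simp
  moreover have "(\<lambda>N. sup_drift z (Suc N) + \<omega>) \<longlonglongrightarrow> semiconj z + \<omega>"
    by (rule tendsto_add[OF LIMSEQ_Suc[OF sup_drift_tendsto[OF z]] tendsto_const])
  ultimately have "sup_drift (gt z) \<longlonglongrightarrow> semiconj z + \<omega>" by presburger
  then show ?thesis using sup_drift_tendsto[OF gtY[OF z]] LIMSEQ_unique by blast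
qed

lemma semiconj_translate:
  assumes z: "z \<in> Y"
  shows "semiconj (z + of_int m * real k) = semiconj z + of_int m * real k"
proof -
  have d: "drift (z + of_int m * real k) n = drift z n + of_int m * real k" for n
    unfolding drift_def funpow_translate by simp
  have "sup_drift (z + of_int m * real k) N = sup_drift z N + of_int m * real k" for N
    using SUP_add_const[OF bdd_drift[OF z, of N], of "of_int m * real k"] unfolding sup_drift_def d by simp
  moreover have "(\<lambda>N. sup_drift z N + of_int m * real k) \<longlonglongrightarrow> semiconj z + of_int m * real k"
    by (intro tendsto_add sup_drift_tendsto z tendsto_const)
  ultimately have "sup_drift (z + of_int m * real k) \<longlonglongrightarrow> semiconj z + of_int m * real k" by presburger
  then show ?thesis using sup_drift_tendsto[OF translateY[OF z]] LIMSEQ_unique by blast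
qed

lemma semiconj_funpow: "z \<in> Y \<Longrightarrow> semiconj ((gt ^^ n) z) = semiconj z + real n * \<omega>"
  by (induction n) (simp_all add: semiconj_gt funpowY algebra_simps)

lemma semiconj_dense:
  assumes "a < b"
  shows "\<exists>z\<in>Y. a < semiconj z \<and> semiconj z < b"
proof -
  obtain z0 where z0: "z0 \<in> Y" using Y_nonempty by blast
  have "a - semiconj z0 < b - semiconj z0" using assms by simp
  from irrational_multiples_dense[OF irrational k0 this] obtain n m where
    nm: "a - semiconj z0 < real n * \<omega> + of_int m * real k" "real n * \<omega> + of_int m * real k < b - semiconj z0"
    by blast
  have w: "(gt ^^ n) z0 + of_int m * real k \<in> Y" by (intro translateY funpowY z0)
  have "semiconj ((gt ^^ n) z0 + of_int m * real k) = semiconj z0 + real n * \<omega> + of_int m * real k"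
    using semiconj_translate[OF funpowY[OF z0], of n m] semiconj_funpow[OF z0, of n] by simp
  then show ?thesis using nm w by (intro bexI[OF _ w]) auto
qed

lemma less_if_semiconj_less:
  assumes "x \<in> Y" "y \<in> Y" "semiconj x < semiconj y"
  shows "x < y"
  using semiconj_mono[OF assms(2,1)] assms(3) by (cases "x < y") auto

definition separates :: "int \<Rightarrow> real \<Rightarrow> bool" where
  "separates i a \<longleftrightarrow> (\<forall>z\<in>Y. (z < cut i \<longrightarrow> semiconj z \<le> a) \<and> (cut i \<le> z \<longrightarrow> a \<le> semiconj z))"

text \<open>Values of \<open>semiconj\<close> are dense, so no interval of separating values can
  exist. Identities between separators then reduce to checking that both sides separate.\<close>

lemma separates_unique:
  assumes "separates i a" "separates i b"
  shows "a = b"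
proof -
  have *: "\<not> a < b" if sep: "separates i a" "separates i b" for a b
  proof
    assume "a < b"
    then obtain z where "z \<in> Y" "a < semiconj z" "semiconj z < b" using semiconj_dense by blast
    then show False using sep unfolding separates_def by (cases "z < cut i") force+
  qed
  show ?thesis using *[OF assms] *[OF assms(2,1)] by simp
qed

lemma unboundedY:
  "\<exists>z\<in>Y. z < y" "\<exists>z\<in>Y. y \<le> z"
proof -
  obtain z0 where z0: "z0 \<in> Y" using Y_nonempty by blast
  obtain m :: int where m: "y \<le> z0 + of_int m * real k" "z0 + of_int m * real k < y + real k"
    by (rule translate_into)
  then show "\<exists>z\<in>Y. y \<le> z" using translateY[OF z0] by blast
  have "z0 + of_int (m - 1) * real k < y" using m by (simp add: algebra_simps)
  then show "\<exists>z\<in>Y. z < y" using translateY[OF z0] by blast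
qed

definition separator :: "int \<Rightarrow> real" where
  "separator i = Sup (semiconj ` {z \<in> Y. z < cut i})"

lemma separator: "separates i (separator i)"
proof -
  let ?S = "semiconj ` {z \<in> Y. z < cut i}"
  have ne: "?S \<noteq> {}" using unboundedY(1)[of "cut i"] by blast
  have ub: "a \<le> semiconj z" if "a \<in> ?S" "z \<in> Y" "cut i \<le> z" for a z
    using that semiconj_mono[of _ z] by auto
  obtain z1 where "z1 \<in> Y" "cut i \<le> z1" using unboundedY(2) by blast
  then have bdd: "bdd_above ?S" using ub by (intro bdd_aboveI[of _ "semiconj z1"]) blast
  show ?thesis
    unfolding separates_def separator_def
  proof (intro ballI conjI impI)
    fix z assume "z \<in> Y" "z < cut i"
    then show "semiconj z \<le> Sup ?S" using bdd by (intro cSup_upper) auto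
  next
    fix z assume "z \<in> Y" "cut i \<le> z"
    then show "Sup ?S \<le> semiconj z" using ub by (intro cSup_least ne) blast
  qed
qed

lemma separator_mono: "mono separator"
proof (rule monoI)
  fix i j :: int assume ij: "i \<le> j"
  show "separator i \<le> separator j"
  proof (rule ccontr)
    assume "\<not> separator i \<le> separator j"
    then obtain z where z: "z \<in> Y" "separator j < semiconj z" "semiconj z < separator i"
      using semiconj_dense[of "separator j" "separator i"] by auto
    then have "z < cut i" "cut j \<le> z" using separator[of i] separator[of j] unfolding separates_def by force+
    then show False using cut_mono[OF ij] by simp
  qed
qed

lemma separator_period: "separator (i + 2 * int k) = separator i + real k"
proof (rule separates_unique[OF separator])
  show "separates (i + 2 * int k) (separator i + real k)"
    unfolding separates_def
  proof
    fix z assume z: "z \<in> Y"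
    define w where "w = z + of_int (- 1) * real k"
    have w: "w \<in> Y" unfolding w_def by (rule translateY[OF z])
    have "semiconj w = semiconj z - real k" unfolding w_def semiconj_translate[OF z] by simp
    moreover have "(w < cut i \<longrightarrow> semiconj w \<le> separator i) \<and> (cut i \<le> w \<longrightarrow> separator i \<le> semiconj w)"
      using separator[of i] w unfolding separates_def by blast
    moreover have "w = z - real k" by (simp add: w_def)
    ultimately show "(z < cut (i + 2 * int k) \<longrightarrow> semiconj z \<le> separator i + real k) \<and>
        (cut (i + 2 * int k) \<le> z \<longrightarrow> separator i + real k \<le> semiconj z)"
      unfolding cut_period by auto
  qed
qed

lemma separator_step: "separator (2 * j + 2) = separator (2 * j + 1) + \<omega>"
proof (rule separates_unique[OF separator])
  show "separates (2 * j + 2) (separator (2 * j + 1) + \<omega>)"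
    unfolding separates_def
  proof
    fix z assume "z \<in> Y"
    then obtain w where w: "w \<in> Y" "gt w = z" using surjY by blast
    have "(w < cut (2 * j + 1) \<longrightarrow> semiconj w \<le> separator (2 * j + 1)) \<and>
        (cut (2 * j + 1) \<le> w \<longrightarrow> separator (2 * j + 1) \<le> semiconj w)"
      using separator[of "2 * j + 1"] w(1) unfolding separates_def by blast
    then show "(z < cut (2 * j + 2) \<longrightarrow> semiconj z \<le> separator (2 * j + 1) + \<omega>) \<and>
        (cut (2 * j + 2) \<le> z \<longrightarrow> separator (2 * j + 1) + \<omega> \<le> semiconj z)"
      using gt_less_cut_iff[OF w(1), of j] semiconj_gt[OF w(1)] unfolding w(2)[symmetric] by auto
  qed
qed

lemma symb_eqI:
  assumes "z \<in> Y" "separator i < semiconj z" "semiconj z < separator (i + 1)"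
  shows "symb z = i"
proof -
  have "\<not> z < cut i" "\<not> cut (i + 1) \<le> z"
    using separator[of i] separator[of "i + 1"] assms unfolding separates_def by force+
  then show ?thesis using symb_less_iff[of z i] symb_less_iff[of z "i + 1"] by simp
qed

text \<open>Subtracting \<open>separator 0\<close> yields the normalisation \<open>ell 0 = 0\<close>
  of the HM endpoints.\<close>

definition ell :: "int \<Rightarrow> real" where
  "ell i = separator i - separator 0"

definition angle :: "real \<Rightarrow> real" where
  "angle z = semiconj z - separator 0"

lemma itin_eqI_angle:
  assumes "z \<in> Y" "ell a < angle z + real n * \<omega>" "angle z + real n * \<omega> < ell (a + 1)"
  shows "itin z n = a"
  unfolding itin_def using assms
  by (intro symb_eqI funpowY) (simp_all add: semiconj_funpow ell_def angle_def)

lemma angle_dense: "a < b \<Longrightarrow> \<exists>z\<in>Y. a < angle z \<and> angle z < b"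
  using semiconj_dense[of "a + separator 0" "b + separator 0"] by (auto simp: angle_def less_diff_eq diff_less_eq)

lemma angle_mono: "x \<in> Y \<Longrightarrow> y \<in> Y \<Longrightarrow> x \<le> y \<Longrightarrow> angle x \<le> angle y"
  using semiconj_mono by (simp add: angle_def)

lemma less_if_angle_less: "x \<in> Y \<Longrightarrow> y \<in> Y \<Longrightarrow> angle x < angle y \<Longrightarrow> x < y"
  using less_if_semiconj_less by (simp add: angle_def)

lemma angle_return: "z \<in> Y \<Longrightarrow> angle ((gt ^^ n) z + of_int m * real k) = angle z + real n * \<omega> + of_int m * real k"
  using semiconj_translate[OF funpowY] semiconj_funpow by (simp add: angle_def)

lemma partition_seq_ell: "partition_seq k ell"
  using separator_mono k separator_period unfolding ell_def mono_def by unfold_locales (auto simp: mono_def)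

lemma return_ne_0:
  assumes "n \<ge> 1"
  shows "real n * \<omega> + of_int m * real k \<noteq> 0"
proof
  assume "real n * \<omega> + of_int m * real k = 0"
  then have "\<omega> / real k = - of_int m / real n" using assms k0 by (simp add: field_simps)
  then show False using irrational by simp
qed

text \<open>A recurrent point is approached by its own returns, whose images under the semiconjugacy
  differ from its own and lie on one side infinitely often; that side decides between the
  right and the left code.\<close>

lemma itin_in_code_set:
  assumes z: "z \<in> Y"
  shows "itin z \<in> code_set ell \<omega>"
proof -
  interpret ps: partition_seq k ell by (rule partition_seq_ell)
  obtain s where s: "right_code ell \<omega> (angle z) s" using ps.right_code_exists by blast
  obtain t where t: "left_code ell \<omega> (angle z) t" using ps.left_code_exists by blast
  have agree: "(\<forall>i<M. itin z i = s i) \<or> (\<forall>i<M. itin z i = t i)" for M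
  proof -
    let ?x = "angle z"
    obtain d1 where d1: "d1 > 0" "\<And>i y. i < M \<Longrightarrow> ?x \<le> y \<Longrightarrow> y < ?x + d1 \<Longrightarrow>
        ell (s i) \<le> y + real i * \<omega> \<and> y + real i * \<omega> < ell (s i + 1)"
      using ps.right_code_margin[OF s, of M] by blast
    obtain d2 where d2: "d2 > 0" "\<And>i y. i < M \<Longrightarrow> y \<le> ?x \<Longrightarrow> ?x - d2 < y \<Longrightarrow>
        ell (t i) < y + real i * \<omega> \<and> y + real i * \<omega> \<le> ell (t i + 1)"
      using ps.left_code_margin[OF t, of M] by blast
    \<comment> \<open>The points \<open>w1\<close> and \<open>w2\<close> enclose \<open>z\<close>
      and have angles within the margins. By monotonicity every point of \<open>Y\<close> between
      them has an angle within the margins too, which replaces continuity of \<open>angle\<close> at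
      \<open>z\<close>.\<close>
    obtain w1 where w1: "w1 \<in> Y" "?x < angle w1" "angle w1 < ?x + d1"
      using angle_dense[of ?x "?x + d1"] d1(1) by auto
    obtain w2 where w2: "w2 \<in> Y" "?x - d2 < angle w2" "angle w2 < ?x"
      using angle_dense[of "?x - d2" ?x] d2(1) by auto
    have w: "w2 < z" "z < w1" using less_if_angle_less z w1 w2 by auto
    obtain e where e: "e > 0" "\<And>y i. y \<in> Lam \<Longrightarrow> \<bar>y - z\<bar> < e \<Longrightarrow> i < M \<Longrightarrow> itin y i = itin z i"
      using itin_continuous[OF LamY[OF z], of M] by blast
    define e' where "e' = min e (min (w1 - z) (z - w2))"
    have "e' > 0" using e(1) w by (simp add: e'_def)
    then obtain n m where nm: "n \<ge> 1" "\<bar>(gt ^^ n) z - z - of_int m * real k\<bar> < e'"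
      using rec_Y[OF z] unfolding recurrent_mod_def by blast
    define y where "y = (gt ^^ n) z + of_int (- m) * real k"
    have y: "y \<in> Y" unfolding y_def by (intro translateY funpowY z)
    have yz: "\<bar>y - z\<bar> < e'" using nm(2) unfolding y_def by (simp add: algebra_simps)
    then have itin_y: "itin y i = itin z i" if "i < M" for i
      using that by (intro e(2) LamY[OF y]) (simp_all add: e'_def)
    have "w2 \<le> y" "y \<le> w1" using yz unfolding e'_def by linarith+
    then have cy: "?x - d2 < angle y" "angle y < ?x + d1"
      using angle_mono[OF w2(1) y] angle_mono[OF y w1(1)] w1(3) w2(2) by linarith+
    \<comment> \<open>Equality would express \<open>\<omega> / k\<close> as a fraction. Excluding it
      puts the angle of the return strictly on one side, where itineraries are read off from open
      cells.\<close>
    have "angle y \<noteq> ?x" using return_ne_0[OF nm(1), of "- m"] unfolding y_def angle_return[OF z] by linarith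
    then consider "?x < angle y" | "angle y < ?x" by linarith
    then show ?thesis
    proof cases
      case 1
      have "itin z i = s i" if i: "i < M" for i
      proof -
        have "ell (s i) < angle y + real i * \<omega>" using d1(2)[OF i, of ?x] d1(1) 1 by auto
        moreover have "angle y + real i * \<omega> < ell (s i + 1)" using d1(2)[OF i, of "angle y"] 1 cy by auto
        ultimately have "itin y i = s i" by (rule itin_eqI_angle[OF y])
        then show ?thesis using itin_y[OF i] by simp
      qed
      then show ?thesis by blast
    next
      case 2
      have "itin z i = t i" if i: "i < M" for i
      proof -
        have "angle y + real i * \<omega> < ell (t i + 1)" using d2(2)[OF i, of ?x] d2(1) 2 by auto
        moreover have "ell (t i) < angle y + real i * \<omega>" using d2(2)[OF i, of "angle y"] 2 cy by auto
        ultimately have "itin y i = t i" by (intro itin_eqI_angle[OF y])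
        then show ?thesis using itin_y[OF i] by simp
      qed
      then show ?thesis by blast
    qed
  qed
  \<comment> \<open>The side found above may depend on \<open>M\<close>. Agreement up to a larger
    \<open>M\<close> includes all smaller ones, so a disagreement with \<open>s\<close> and another
    with \<open>t\<close> exclude each other.\<close>
  have "(\<forall>i. itin z i = s i) \<or> (\<forall>i. itin z i = t i)"
  proof (rule ccontr)
    assume "\<not> ?thesis"
    then obtain i j where ij: "itin z i \<noteq> s i" "itin z j \<noteq> t j" by blast
    then show False using agree[of "Suc (max i j)"] by (metis lessI less_Suc_eq_le max.cobounded1 max.cobounded2)
  qed
  then have "itin z = s \<or> itin z = t" by auto
  then show ?thesis using s t unfolding code_set_def by auto
qed

text \<open>The point is the infimum of those with angle above \<open>x\<close>. Its own angle is
  not consulted: points of \<open>Y\<close> at or just above it have angles slightly above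
  \<open>x\<close>, and local constancy of itineraries transfers their symbols.\<close>

lemma right_code_in_itin:
  assumes s: "right_code ell \<omega> x s"
  shows "s \<in> itin ` Y"
proof -
  interpret ps: partition_seq k ell by (rule partition_seq_ell)
  let ?S = "{w \<in> Y. x < angle w}"
  define z where "z = Inf ?S"
  obtain w0 where w0: "w0 \<in> Y" "angle w0 < x" using angle_dense[of "x - 1" x] by auto
  have ne: "?S \<noteq> {}" using angle_dense[of x "x + 1"] by auto
  have bdd: "bdd_below ?S"
  proof (rule bdd_belowI)
    fix w assume "w \<in> ?S"
    then have "w0 < w" using less_if_angle_less[of w0 w] w0 by auto
    then show "w0 \<le> w" by simp
  qed
  have "z \<in> closure ?S" unfolding z_def by (rule closure_contains_Inf[OF ne bdd])
  moreover have "closure ?S \<subseteq> Y" by (rule closure_minimal[OF _ closed_Y]) auto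
  ultimately have z: "z \<in> Y" by blast
  have near: "\<exists>w\<in>Y. x < angle w \<and> angle w < x + d \<and> \<bar>w - z\<bar> < e" if d: "d > 0" and e: "e > 0" for d e
  proof -
    obtain w1 where w1: "w1 \<in> ?S" "w1 < z + e"
      using cInf_lessD[OF ne, of "z + e"] e unfolding z_def by auto
    obtain w2 where w2: "w2 \<in> Y" "x < angle w2" "angle w2 < x + d" using angle_dense[of x "x + d"] d by auto
    define w where "w = min w1 w2"
    have w: "w \<in> Y" "x < angle w" using w1(1) w2 by (auto simp: w_def min_def)
    have "angle w < x + d" using angle_mono[OF w(1) w2(1)] w2(3) by (simp add: w_def)
    moreover have "z \<le> w" unfolding z_def by (rule cInf_lower[OF _ bdd]) (use w in auto)
    moreover have "w < z + e" using w1(2) by (simp add: w_def)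
    ultimately show ?thesis using w by (intro bexI[of _ w]) auto
  qed
  have "itin z i = s i" for i
  proof -
    obtain e where e: "e > 0" "\<And>y. y \<in> Lam \<Longrightarrow> \<bar>y - z\<bar> < e \<Longrightarrow> itin y i = itin z i"
      using itin_continuous[OF LamY[OF z], of "Suc i"] by blast
    obtain d where d: "d > 0" "\<And>y. x \<le> y \<Longrightarrow> y < x + d \<Longrightarrow>
        ell (s i) \<le> y + real i * \<omega> \<and> y + real i * \<omega> < ell (s i + 1)"
      using ps.right_code_margin[OF s, of "Suc i"] by blast
    obtain w where w: "w \<in> Y" "x < angle w" "angle w < x + d" "\<bar>w - z\<bar> < e" using near[OF d(1) e(1)] by blast
    have "ell (s i) < angle w + real i * \<omega>" using d(2)[of x] d(1) w(2) by auto
    moreover have "angle w + real i * \<omega> < ell (s i + 1)" using d(2)[of "angle w"] w by auto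
    ultimately have "itin w i = s i" by (rule itin_eqI_angle[OF w(1)])
    then show ?thesis using e(2)[OF LamY[OF w(1)] w(4)] by simp
  qed
  then have "s = itin z" by auto
  then show ?thesis using z by blast
qed

lemma left_code_in_itin:
  assumes s: "left_code ell \<omega> x s"
  shows "s \<in> itin ` Y"
proof -
  interpret ps: partition_seq k ell by (rule partition_seq_ell)
  let ?S = "{w \<in> Y. angle w < x}"
  define z where "z = Sup ?S"
  obtain w0 where w0: "w0 \<in> Y" "x < angle w0" using angle_dense[of x "x + 1"] by auto
  have ne: "?S \<noteq> {}" using angle_dense[of "x - 1" x] by auto
  have bdd: "bdd_above ?S"
  proof (rule bdd_aboveI)
    fix w assume "w \<in> ?S"
    then have "w < w0" using less_if_angle_less[of w w0] w0 by auto
    then show "w \<le> w0" by simp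
  qed
  have "z \<in> closure ?S" unfolding z_def by (rule closure_contains_Sup[OF ne bdd])
  moreover have "closure ?S \<subseteq> Y" by (rule closure_minimal[OF _ closed_Y]) auto
  ultimately have z: "z \<in> Y" by blast
  have near: "\<exists>w\<in>Y. x - d < angle w \<and> angle w < x \<and> \<bar>w - z\<bar> < e" if d: "d > 0" and e: "e > 0" for d e
  proof -
    obtain w1 where w1: "w1 \<in> ?S" "z - e < w1"
      using less_cSupD[OF ne, of "z - e"] e unfolding z_def by auto
    obtain w2 where w2: "w2 \<in> Y" "x - d < angle w2" "angle w2 < x" using angle_dense[of "x - d" x] d by auto
    define w where "w = max w1 w2"
    have w: "w \<in> Y" "angle w < x" using w1(1) w2 by (auto simp: w_def max_def)
    have "x - d < angle w" using angle_mono[OF w2(1) w(1)] w2(2) by (simp add: w_def)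
    moreover have "w \<le> z" unfolding z_def by (rule cSup_upper[OF _ bdd]) (use w in auto)
    moreover have "z - e < w" using w1(2) by (simp add: w_def)
    ultimately show ?thesis using w by (intro bexI[of _ w]) auto
  qed
  have "itin z i = s i" for i
  proof -
    obtain e where e: "e > 0" "\<And>y. y \<in> Lam \<Longrightarrow> \<bar>y - z\<bar> < e \<Longrightarrow> itin y i = itin z i"
      using itin_continuous[OF LamY[OF z], of "Suc i"] by blast
    obtain d where d: "d > 0" "\<And>y. y \<le> x \<Longrightarrow> x - d < y \<Longrightarrow>
        ell (s i) < y + real i * \<omega> \<and> y + real i * \<omega> \<le> ell (s i + 1)"
      using ps.left_code_margin[OF s, of "Suc i"] by blast
    obtain w where w: "w \<in> Y" "x - d < angle w" "angle w < x" "\<bar>w - z\<bar> < e" using near[OF d(1) e(1)] by blast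
    have "angle w + real i * \<omega> < ell (s i + 1)" using d(2)[of x] d(1) w(3) by auto
    moreover have "ell (s i) < angle w + real i * \<omega>" using d(2)[of "angle w"] w by auto
    ultimately have "itin w i = s i" by (intro itin_eqI_angle[OF w(1)])
    then show ?thesis using e(2)[OF LamY[OF w(1)] w(4)] by simp
  qed
  then have "s = itin z" by auto
  then show ?thesis using z by blast
qed

theorem irrational_coding:
  "partition_seq k ell \<and> ell 0 = 0 \<and> (\<forall>j. ell (2 * j + 2) = ell (2 * j + 1) + \<omega>) \<and>
    itin ` Y = code_set ell \<omega>"
proof (intro conjI allI)
  show "ell 0 = 0" by (simp add: ell_def)
  show "ell (2 * j + 2) = ell (2 * j + 1) + \<omega>" for j using separator_step[of j] by (simp add: ell_def)
  show "itin ` Y = code_set ell \<omega>"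
    using itin_in_code_set right_code_in_itin left_code_in_itin unfolding code_set_def by blast
qed (rule partition_seq_ell)

end

section \<open>Both cases combined and the HM data read off\<close>

context recurrent_kfsm
begin

theorem coding_exists:
  "\<exists>\<omega> ell. partition_seq k ell \<and> ell 0 = 0 \<and> (\<forall>j. ell (2 * j + 2) = ell (2 * j + 1) + \<omega>) \<and>
    itin ` Y = code_set ell \<omega>"
proof -
  obtain \<omega> where \<omega>: "\<And>z n. z \<in> Y \<Longrightarrow> \<bar>(gt ^^ n) z - z - real n * \<omega>\<bar> \<le> 2 * real k"
    using rotation_number_exists by blast
  show ?thesis
  proof (cases "\<omega> / real k \<in> \<rat>")
    case True
    then obtain M b :: int where Mb: "\<omega> / real k = of_int M / of_int b" "b > 0" by (rule Rats_cases')
    define N where "N = nat b"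
    have N: "N \<ge> 1" "of_int b = real N" using Mb(2) by (auto simp: N_def)
    have "real N * \<omega> = of_int M * real k" using Mb(1) N k0 unfolding N(2) by (simp add: field_simps)
    then interpret periodic_kfsm gt xm zmax zmin g k Y N M
      using rational_imp_periodic[OF \<omega> N(1)] N(1) by unfold_locales auto
    show ?thesis by (rule periodic_coding)
  next
    case False
    then interpret irrational_kfsm gt xm zmax zmin g k Y \<omega>
      using \<omega> by unfold_locales auto
    show ?thesis using irrational_coding by blast
  qed
qed

end

context circle_map
begin

theorem recurrent_kfsm_imp_constructable:
  assumes rec: "recurrent_set (circ_top 1) g Z" and kf: "kfsm k g gt Z" and k: "k \<ge> 1"
    and Z: "Z \<subseteq> Lambda 1 gt xm" "Z \<noteq> {}" "compactin (circ_top 1) Z"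
  shows "hm_constructable k g xm zmax zmin Z"
proof -
  obtain Y where cl: "closed Y" and lift: "kfsm_lift k gt Y" and img: "cproj 1 ` Y = Z"
    using closed_lift_exists[OF kf Z(3)] by blast
  have Lam: "Y \<subseteq> Lam" using img Z(1) cproj_in_Lambda_iff by blast
  have recY: "recurrent_mod (real k) gt z" if "z \<in> Y" for z
    using rec that img k unfolding recurrent_set_def by (intro recurrent_lift) auto
  have "Y \<noteq> {}" using img Z(2) by blast
  then interpret recurrent_kfsm gt xm zmax zmin g k Y
    using k cl lift Lam recY by unfold_locales auto
  obtain \<omega> ell where ps: "partition_seq k ell" and ell_0: "ell 0 = 0"
    and step: "\<And>j. ell (2 * j + 2) = ell (2 * j + 1) + \<omega>" and codes: "itin ` Y = code_set ell \<omega>"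
    using coding_exists by blast
  interpret ps: partition_seq k ell by (rule ps)
  \<comment> \<open>The lengths of the even cells \<open>2 * i - 2\<close>. Since odd cells have
    length \<open>\<omega>\<close> and \<open>ell 0 = 0\<close>, partial sums of these lengths
    recover every HM endpoint.\<close>
  define \<nu> where "\<nu> i = ell (2 * int i - 1) - ell (2 * int i - 2)" for i :: nat
  have sum: "(\<Sum>r=1..j. \<nu> r) = ell (2 * int j) - real j * \<omega>" for j
  proof (induction j)
    case 0
    then show ?case using ell_0 by simp
  next
    case (Suc j)
    have "ell (2 * int (Suc j)) = ell (2 * int j + 1) + \<omega>" using step[of "int j"] by (simp add: add.commute)
    moreover have "\<nu> (Suc j) = ell (2 * int j + 1) - ell (2 * int j)" unfolding \<nu>_def by (simp add: algebra_simps)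
    ultimately show ?case using Suc by (simp add: algebra_simps)
  qed
  have ell_2k: "ell (2 * int k) = real k" using ps.ell_period[of 0] ell_0 by simp
  have \<nu>: "\<nu> i \<ge> 0" for i unfolding \<nu>_def using monoD[OF ps.ell_mono] by simp
  have \<omega>0: "\<omega> \<ge> 0" using monoD[OF ps.ell_mono, of 1 2] step[of 0] by simp
  have total: "(\<Sum>r=1..k. \<nu> r) = real k * (1 - \<omega>)" unfolding sum ell_2k by (simp add: algebra_simps)
  have "real k * (1 - \<omega>) \<ge> 0" unfolding total[symmetric] by (intro sum_nonneg \<nu>)
  then have "\<omega> \<le> 1" using k by (simp add: zero_le_mult_iff)
  then have al: "allowable k \<omega> \<nu>" unfolding allowable_def using \<omega>0 \<nu> total by auto
  have eq: "hm_ell k \<omega> \<nu> i = ell (int i)" for i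
  proof (cases "even i")
    case True
    then obtain j where j: "i = 2 * j" by blast
    show ?thesis unfolding hm_ell_def using sum[of j] ell_2k by (auto simp: j)
  next
    case False
    then obtain j where j: "i = 2 * j + 1" using oddE by blast
    have "i \<noteq> 2 * k" using j by presburger
    moreover have "ell (2 * int (j + 1)) = ell (int i) + \<omega>" using step[of "int j"] by (simp add: j algebra_simps)
    ultimately show ?thesis unfolding hm_ell_def using sum[of "j + 1"] j by (simp add: algebra_simps)
  qed
  interpret hm: hm_partition k ell \<omega> \<nu> by unfold_locales (rule eq)
  have "itinerary g xm zmax zmin ` Z = parity_seq ` itin ` Y"
    unfolding img[symmetric] image_image using itinerary_eq LamY by (intro image_cong) auto
  then have "itinerary g xm zmax zmin ` Z = hm_C k \<omega> \<nu>" unfolding codes hm.hm_C_eq .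
  then show ?thesis unfolding hm_constructable_def using al by blast
qed

end

theorem theorem1p1:
  fixes g :: "real set \<Rightarrow> real set" and gt :: "real \<Rightarrow> real"
    and xm zmax zmin :: real and k :: nat and Z :: "real set set"
  assumes G: "in_class_G g gt xm"
    and zmax: "0 < zmax" "zmax < xm" "gt zmax = xm"
    and zmin: "0 < zmin" "zmin < xm" "gt zmin = 1"
    and LU: "L_val gt xm zmax zmin \<le> U_val gt xm zmax zmin"
    and k: "k \<ge> 1"
    and Z: "Z \<subseteq> Lambda 1 gt xm" "Z \<noteq> {}" "compactin (circ_top 1) Z"
  shows "(recurrent_set (circ_top 1) g Z \<and> kfsm k g gt Z \<longleftrightarrow>
            hm_constructable k g xm zmax zmin Z) \<and>
         (hm_constructable k g xm zmax zmin Z \<longleftrightarrow>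
            interpolated_recurrent k gt xm zmax zmin Z)"
proof -
  interpret expanding_lift gt xm zmax zmin
    by (rule in_class_G_imp_expanding_lift[OF G zmax zmin])
  interpret circle_map gt xm zmax zmin g
    using G by unfold_locales (auto simp: in_class_G_def)
  show ?thesis
    using constructable_imp_recurrent_kfsm[OF _ k Z(1)] recurrent_kfsm_imp_constructable[OF _ _ k Z]
      interpolated_imp_recurrent_kfsm[OF _ k Z(1,2)] recurrent_kfsm_imp_interpolated[OF _ _ k Z LU]
    by blast
qed

end
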